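(* Let $\Phi\in H(\mathbb{C})$ be of finite exponential type with $|\Phi(0)|<1$ and such that the level set $\{z\in\mathbb{C}: |\Phi(z)|=1\}$ contains a non-trivial, strictly convex compact arc $\Gamma$ satisfying \[ \mathrm{conv}(\Gamma\cup\{0\})\setminus\Gamma\subset\Phi^{-1}(\mathbb{D}). \] Then the set of hypercyclic vectors for the convolution operator $\Phi(D)$ on $H(\mathbb{C})$ is dense algebrable. Moreover: (a) For each $N\in\mathbb{N}$ the set of $f=(f_j)_{j=1}^N$ in $H(\mathbb{C})^N$ that freely generate a hypercyclic algebra for $\Phi(D)$ is residual in $H(\mathbb{C})^N$. (b) The set of $f=(f_j)_{j=1}^\infty\in H(\mathbb{C})^{\mathbb{N}}$ that freely generate a dense hypercyclic algebra for $\Phi(D)$ is residual in $H(\mathbb{C})^{\mathbb{N}}$. In particular, the set of hypercyclic vectors for $\Phi(D)$ is densely strongly algebrable.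
   Context: $H(\mathbb{C})$ is the algebra of entire functions with pointwise product and the compact-open topology; powers $H(\mathbb{C})^N$ and $H(\mathbb{C})^{\mathbb{N}}$ carry the product topology. $\mathbb{D}$ is the open unit disc and $\mathrm{conv}(A)$ is the convex hull of $A\subset\mathbb{C}$. An arc is non-trivial if it is not a single point; an arc $\mathcal{C}$ is strictly convex if each segment with both endpoints in $\mathcal{C}$ intersects $\mathcal{C}$ only at those endpoints. An entire function $\Phi(z)=\sum_{n\ge0}a_nz^n$ is of (finite) exponential type if there are $M,R>0$ with $|a_n|\le M R^n/n!$ for all $n\ge 0$; then $\Phi(D)f=\sum_{n\ge0}a_nD^nf$, where $D$ is complex differentiation, defines an operator (continuous linear self-map) on $H(\mathbb{C})$, called a convolution operator. For an operator $T$ on a topological algebra $X$, $f\in X$ is hypercyclic for $T$ if $\{f,Tf,T^2f,\dots\}$ is dense in $X$. A hypercyclic algebra for $T$ is a nonzero subalgebra of $X$ all of whose nonzero elements are hypercyclic for $T$. Subalgebras are not required to contain the unit. For a finite or infinite sequence $f=(f_j)$ in $X=H(\mathbb{C})$, $A(f)$ is the subalgebra generated by its terms, i.e. the set of all $P(f_1,\dots,f_n)$ with $n\in\mathbb{N}$ (with $n$ at most the length of $f$) and $P$ a polynomial in $n$ variables with complex coefficients and $P(0)=0$. The sequence $f$ is algebraically independent if $P(f_1,\dots,f_n)\neq0$ for all such $n$ and all nonzero such $P$ with $P(0)=0$. We say $f$ freely generates a (dense) hypercyclic algebra for $T$ if $f$ is algebraically independent and $A(f)$ is a (dense) hypercyclic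 algebra for $T$. A subset $E$ of $X$ is dense algebrable if $E\cup\{0\}$ contains a dense subalgebra of $X$ that is not finitely generated. It is densely strongly algebrable if $E\cup\{0\}$ contains a dense subalgebra of $X$ that is freely generated by an infinite algebraically independent set (a set being algebraically independent if every finite tuple of pairwise distinct elements of it is). *)

theory Defs
  imports "HOL-Analysis.Analysis" "HOL-Library.Poly_Mapping"
begin

section \<open>Density and residual sets in a topology\<close>

definition dense_in_top :: "'a topology \<Rightarrow> 'a set \<Rightarrow> bool" where
  "dense_in_top X S \<longleftrightarrow> S \<subseteq> topspace X \<and> X closure_of S = topspace X"

text \<open>Residual: the complement is of first category, i.e. the set contains a countable
  intersection of dense open sets.\<close>

definition residual_in_top :: "'a topology \<Rightarrow> 'a set \<Rightarrow> bool" where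
  "residual_in_top X S \<longleftrightarrow> S \<subseteq> topspace X \<and>
     (\<exists>\<G>. countable \<G> \<and> (\<forall>G\<in>\<G>. openin X G \<and> dense_in_top X G) \<and>
          topspace X \<inter> \<Inter>\<G> \<subseteq> S)"

definition hypercyclic_vector :: "'a topology \<Rightarrow> ('a \<Rightarrow> 'a) \<Rightarrow> 'a \<Rightarrow> bool" where
  "hypercyclic_vector X T f \<longleftrightarrow> f \<in> topspace X \<and> dense_in_top X (range (\<lambda>n. (T ^^ n) f))"

section \<open>The algebra of entire functions\<close>

definition entire_top :: "(complex \<Rightarrow> complex) topology" where
  "entire_top = subtopology
     (topology_generated_by {{f. f ` K \<subseteq> U} | K U. compact K \<and> open U})
     {f. f holomorphic_on UNIV}"

lemma topspace_entire_top: "topspace entire_top = {f. f holomorphic_on UNIV}"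
proof -
  have "UNIV \<in> {{f :: complex \<Rightarrow> complex. f ` K \<subseteq> U} | K U. compact K \<and> open U}"
    by (rule CollectI, rule exI[of _ "{}"], rule exI[of _ UNIV]) auto
  then have "\<Union>{{f :: complex \<Rightarrow> complex. f ` K \<subseteq> U} | K U. compact K \<and> open U} = UNIV"
    by blast
  then show ?thesis
    by (simp add: entire_top_def topology_generated_by_topspace)
qed

text \<open>Finite powers have index set \<open>{..<N}\<close> and the countable power has index set \<open>UNIV\<close>;
  sequences are thus indexed from 0.\<close>

abbreviation entire_power_top :: "nat set \<Rightarrow> (nat \<Rightarrow> complex \<Rightarrow> complex) topology" where
  "entire_power_top I \<equiv> product_topology (\<lambda>_. entire_top) I"

definition subalgebra :: "(complex \<Rightarrow> complex) set \<Rightarrow> bool" where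
  "subalgebra A \<longleftrightarrow> A \<subseteq> {f. f holomorphic_on UNIV} \<and> (\<lambda>z. 0) \<in> A \<and>
     (\<forall>f\<in>A. \<forall>g\<in>A. (\<lambda>z. f z + g z) \<in> A) \<and>
     (\<forall>c. \<forall>f\<in>A. (\<lambda>z. c * f z) \<in> A) \<and>
     (\<forall>f\<in>A. \<forall>g\<in>A. (\<lambda>z. f z * g z) \<in> A)"

definition finitely_generated :: "(complex \<Rightarrow> complex) set \<Rightarrow> bool" where
  "finitely_generated A \<longleftrightarrow> (\<exists>F. finite F \<and> F \<subseteq> A \<and> A = subalgebra hull F)"

section \<open>Polynomials in several variables and algebraic independence\<close>

text \<open>A polynomial maps each monomial (a finitely supported exponent vector) to its coefficient.\<close>

type_synonym cmpoly = "(nat \<Rightarrow>\<^sub>0 nat) \<Rightarrow>\<^sub>0 complex"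

definition cmpoly_eval :: "cmpoly \<Rightarrow> (nat \<Rightarrow> complex) \<Rightarrow> complex" where
  "cmpoly_eval P x =
     (\<Sum>m\<in>Poly_Mapping.keys P. Poly_Mapping.lookup P m *
        (\<Prod>j\<in>Poly_Mapping.keys m. x j ^ Poly_Mapping.lookup m j))"

definition polys0 :: "nat \<Rightarrow> cmpoly set" where
  "polys0 n = {P. (\<forall>m\<in>Poly_Mapping.keys P. Poly_Mapping.keys m \<subseteq> {..<n}) \<and>
                  cmpoly_eval P (\<lambda>_. 0) = 0}"

text \<open>In the next two definitions the condition \<open>{..<n} \<subseteq> I\<close> says that \<open>n\<close> is at most the length
  of the sequence \<open>f\<close> with index set \<open>I\<close>.\<close>

definition generated_algebra ::
    "nat set \<Rightarrow> (nat \<Rightarrow> complex \<Rightarrow> complex) \<Rightarrow> (complex \<Rightarrow> complex) set" where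
  "generated_algebra I f = {(\<lambda>z. cmpoly_eval P (\<lambda>j. f j z)) | n P. {..<n} \<subseteq> I \<and> P \<in> polys0 n}"

definition alg_independent :: "nat set \<Rightarrow> (nat \<Rightarrow> complex \<Rightarrow> complex) \<Rightarrow> bool" where
  "alg_independent I f \<longleftrightarrow>
     (\<forall>n. \<forall>P\<in>polys0 n. {..<n} \<subseteq> I \<and> P \<noteq> 0 \<longrightarrow> (\<lambda>z. cmpoly_eval P (\<lambda>j. f j z)) \<noteq> (\<lambda>z. 0))"

definition alg_independent_set :: "(complex \<Rightarrow> complex) set \<Rightarrow> bool" where
  "alg_independent_set S \<longleftrightarrow>
     (\<forall>n f. inj_on f {..<n} \<and> f ` {..<n} \<subseteq> S \<longrightarrow> alg_independent {..<n} f)"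

section \<open>Algebrability\<close>

definition dense_algebrable :: "(complex \<Rightarrow> complex) set \<Rightarrow> bool" where
  "dense_algebrable E \<longleftrightarrow>
     (\<exists>A. subalgebra A \<and> A \<subseteq> E \<union> {\<lambda>z. 0} \<and> dense_in_top entire_top A \<and> \<not> finitely_generated A)"

definition densely_strongly_algebrable :: "(complex \<Rightarrow> complex) set \<Rightarrow> bool" where
  "densely_strongly_algebrable E \<longleftrightarrow>
     (\<exists>S. S \<subseteq> {f. f holomorphic_on UNIV} \<and> infinite S \<and> alg_independent_set S \<and>
          subalgebra hull S \<subseteq> E \<union> {\<lambda>z. 0} \<and> dense_in_top entire_top (subalgebra hull S))"

section \<open>Hypercyclic algebras\<close>

type_synonym operator = "(complex \<Rightarrow> complex) \<Rightarrow> (complex \<Rightarrow> complex)"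

definition hypercyclic_algebra :: "operator \<Rightarrow> (complex \<Rightarrow> complex) set \<Rightarrow> bool" where
  "hypercyclic_algebra T A \<longleftrightarrow> subalgebra A \<and> A \<noteq> {\<lambda>z. 0} \<and>
     (\<forall>f\<in>A. f \<noteq> (\<lambda>z. 0) \<longrightarrow> hypercyclic_vector entire_top T f)"

definition freely_generates_hypercyclic_algebra ::
    "operator \<Rightarrow> nat set \<Rightarrow> (nat \<Rightarrow> complex \<Rightarrow> complex) \<Rightarrow> bool" where
  "freely_generates_hypercyclic_algebra T I f \<longleftrightarrow>
     alg_independent I f \<and> hypercyclic_algebra T (generated_algebra I f)"

definition freely_generates_dense_hypercyclic_algebra ::
    "operator \<Rightarrow> nat set \<Rightarrow> (nat \<Rightarrow> complex \<Rightarrow> complex) \<Rightarrow> bool" where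
  "freely_generates_dense_hypercyclic_algebra T I f \<longleftrightarrow>
     freely_generates_hypercyclic_algebra T I f \<and>
     dense_in_top entire_top (generated_algebra I f)"

section \<open>Convolution operators\<close>

definition taylor_coeff :: "(complex \<Rightarrow> complex) \<Rightarrow> nat \<Rightarrow> complex" where
  "taylor_coeff \<Phi> n = (deriv ^^ n) \<Phi> 0 / fact n"

definition finite_exponential_type :: "(complex \<Rightarrow> complex) \<Rightarrow> bool" where
  "finite_exponential_type \<Phi> \<longleftrightarrow>
     (\<exists>M>0. \<exists>R>0. \<forall>n. norm (taylor_coeff \<Phi> n) \<le> M * R ^ n / fact n)"

text \<open>The series is evaluated pointwise: for \<open>\<Phi>\<close> of finite exponential type it converges in
  \<open>entire_top\<close>, hence pointwise to the same limit.\<close>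

definition convolution_operator :: "(complex \<Rightarrow> complex) \<Rightarrow> operator" where
  "convolution_operator \<Phi> f = (\<lambda>z. suminf (\<lambda>n. taylor_coeff \<Phi> n * (deriv ^^ n) f z))"

section \<open>Arcs\<close>

text \<open>A library \<open>arc\<close> is an injective path on \<open>[0,1]\<close>, so its image is compact and not a single
  point.\<close>

definition nontrivial_compact_arc :: "complex set \<Rightarrow> bool" where
  "nontrivial_compact_arc \<Gamma> \<longleftrightarrow> (\<exists>g. arc g \<and> path_image g = \<Gamma>)"

definition strictly_convex_arc :: "complex set \<Rightarrow> bool" where
  "strictly_convex_arc \<Gamma> \<longleftrightarrow> (\<forall>x\<in>\<Gamma>. \<forall>y\<in>\<Gamma>. closed_segment x y \<inter> \<Gamma> = {x, y})"

end

theory Submission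
  imports Defs "HOL-Complex_Analysis.Complex_Analysis"
begin

text \<open>
  The proof is a Baire category argument. Write \<open>T\<close> for the operator \<open>\<Phi>(D)\<close>. Every exponential
  \<open>exp (\<lambda> z)\<close> is an eigenvector of \<open>T\<close> with eigenvalue \<open>\<Phi> \<lambda>\<close>.

  Let \<open>A\<close> be a finite set of nonzero exponents and let \<open>\<alpha>\<close> in \<open>A\<close> be leading, i.e. the strict
  maximum on \<open>A\<close> of a linear form with positive coefficients \<open>w i\<close>. Consider the sequences \<open>f\<close> for which some
  iterate of \<open>T\<close> moves the power product of \<open>f\<close> with exponent \<open>\<alpha>\<close> close to a given function and
  those with the other exponents of \<open>A\<close> close to zero. They form an open set. If \<open>f\<close> lies in all
  of these sets, then every polynomial in \<open>f\<close> with set of exponents \<open>A\<close> is hypercyclic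
  (\<open>hypercyclic_if_steered\<close>): its iterates approach any function, because its leading term does and the
  rest vanishes. In particular it is not zero, so algebraic independence comes for free. By
  separability countably many of these sets suffice.

  The sets are dense (\<open>power_product_transitivity\<close>). Scale \<open>w\<close> so that \<open>\<alpha>\<close> has total weight one, and
  approximate the given function by a sum of terms \<open>c \<mu> * exp (\<kappa> \<mu> * z)\<close> with frequencies \<open>\<kappa> \<mu>\<close> as
  close to points \<open>\<mu>\<close> of \<open>\<Gamma>\<close> as desired but with \<open>\<Phi> (\<kappa> \<mu>)\<close> of modulus greater than one. Add to the
  \<open>i\<close>-th prescribed function, itself approximated by exponentials with tiny frequencies, the sum of
  the \<open>w i\<close>-th powers of \<open>c \<mu> / \<Phi> (\<kappa> \<mu>) ^ n * exp (\<kappa> \<mu> * z)\<close>. These tend to zero as \<open>n\<close> grows. The frequencies in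
  the expansion of a power product are, up to a small error, convex combinations of the origin and
  of points of \<open>\<Gamma>\<close>. Unless the combination consists of a single point of \<open>\<Gamma>\<close>, which happens only
  for the exponent \<open>\<alpha>\<close>, the modulus of \<open>\<Phi>\<close> there is smaller than one and the iterates of \<open>T\<close> send the
  term to zero. The remaining terms of the leading power product are mapped to \<open>c \<mu> * exp (\<kappa> \<mu> * z)\<close>.

  This requires that a proper convex combination of the origin and of points of \<open>\<Gamma>\<close> never lies on \<open>\<Gamma>\<close>
  (\<open>convex_combination_on_arc\<close>). By the maximum principle \<open>\<Gamma>\<close> lies in the boundary of the convex hull of
  \<open>\<Gamma>\<close> and the origin. So a combination that lies on \<open>\<Gamma>\<close> uses only points of a supporting line, and by
  strict convexity this line contains at most two points of \<open>\<Gamma>\<close>. The only exceptions come from points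
  \<open>y\<close> of \<open>\<Gamma>\<close> with a multiple \<open>t y\<close> in \<open>\<Gamma>\<close> for some \<open>0 < t < 1\<close>. There are finitely many of
  them (\<open>finite_radially_doubled\<close>), and the rest of \<open>\<Gamma>\<close> still has a limit point, which is
  enough for the exponentials with frequencies there to span a dense space (\<open>exp_span_dense\<close>).

  For infinite sequences the terms are moreover dense for generic \<open>f\<close>, so that the generated algebra
  is dense. The space of entire functions is completely metrizable, hence generic sequences exist.
  The terms of one of them are infinitely many free generators of a dense hypercyclic algebra, which is
  not finitely generated by algebraic independence.
\<close>

section \<open>The compact-open topology on entire functions\<close>

text \<open>
  A single index measures both the size of the disc and the precision, so that the sets
  \<open>near f k\<close> decrease in \<open>k\<close> and form a countable neighbourhood basis of \<open>f\<close> in the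
  compact-open topology.
\<close>

definition near :: "(complex \<Rightarrow> complex) \<Rightarrow> nat \<Rightarrow> (complex \<Rightarrow> complex) set" where
  "near f k = {g. g holomorphic_on UNIV \<and> (\<forall>z\<in>cball 0 (real k). dist (g z) (f z) < 1 / (real k + 1))}"

text \<open>
  Cutting the difference off at \<open>1 / (1 + norm z)\<close> makes far away points count little: on the disc
  of radius \<open>k\<close> a distance below \<open>1 / (k + 1)\<close> bounds the difference itself. A single supremum
  thus replaces the usual weighted sum over an exhaustion by discs.
\<close>

definition entire_dist :: "(complex \<Rightarrow> complex) \<Rightarrow> (complex \<Rightarrow> complex) \<Rightarrow> real" where
  "entire_dist f g = (SUP z. min (1 / (1 + norm z)) (dist (f z) (g z)))"

lemma near_antimono:
  assumes "k \<le> l"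
  shows "near f l \<subseteq> near f k"
proof
  fix g assume g: "g \<in> near f l"
  have le: "1 / (real l + 1) \<le> 1 / (real k + 1)" using assms by (simp add: frac_le)
  have "dist (g z) (f z) < 1 / (real k + 1)" if "z \<in> cball 0 (real k)" for z
  proof -
    have "z \<in> cball 0 (real l)" using that assms by simp
    then have "dist (g z) (f z) < 1 / (real l + 1)" using g by (simp add: near_def)
    with le show ?thesis by linarith
  qed
  with g show "g \<in> near f k" by (simp add: near_def)
qed

lemma near_self: "f holomorphic_on UNIV \<Longrightarrow> f \<in> near f k"
  by (simp add: near_def)

lemma entire_on: "f holomorphic_on UNIV \<Longrightarrow> f holomorphic_on S"
  using holomorphic_on_subset by blast

lemma entire_cont: "f holomorphic_on UNIV \<Longrightarrow> continuous_on S f"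
  using holomorphic_on_imp_continuous_on entire_on by blast

lemma entire_dist_ge: "min (1 / (1 + norm z)) (dist (f z) (g z)) \<le> entire_dist f g"
proof -
  have "bdd_above (range (\<lambda>z. min (1 / (1 + norm z)) (dist (f z) (g z))))"
    by (rule bdd_aboveI[of _ 1]) (auto intro!: min.coboundedI1 simp: divide_le_eq_1_pos add_pos_nonneg)
  then show ?thesis unfolding entire_dist_def by (rule cSUP_upper[rotated]) simp
qed

lemma entire_dist_le: "(\<And>z. min (1 / (1 + norm z)) (dist (f z) (g z)) \<le> r) \<Longrightarrow> entire_dist f g \<le> r"
  unfolding entire_dist_def by (rule cSUP_least) auto

lemma near_if_entire_dist:
  assumes "entire_dist f g < 1 / (real k + 1)" "norm z \<le> k"
  shows "dist (g z) (f z) \<le> entire_dist f g"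
proof -
  have "1 / (real k + 1) \<le> 1 / (1 + norm z)" using assms(2) by (intro frac_le) (auto intro: add_pos_nonneg)
  with entire_dist_ge[of z f g] assms show ?thesis by (auto simp: dist_commute)
qed

lemma entire_dist_if_near:
  assumes "\<And>z. norm z \<le> real k \<Longrightarrow> dist (g z) (f z) \<le> 1 / (real k + 1)"
  shows "entire_dist f g \<le> 1 / (real k + 1)"
proof (rule entire_dist_le)
  fix z :: complex
  show "min (1 / (1 + norm z)) (dist (f z) (g z)) \<le> 1 / (real k + 1)"
  proof (cases "norm z \<le> k")
    case True with assms[of z] show ?thesis by (auto simp: dist_commute)
  next
    case False
    then have "1 / (1 + norm z) \<le> 1 / (real k + 1)" by (intro frac_le) auto
    then show ?thesis by auto
  qed
qed

interpretation entire_metric: Metric_space "{f. f holomorphic_on UNIV}" entire_dist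
proof
  fix f g h :: "complex \<Rightarrow> complex"
  show "0 \<le> entire_dist f g"
    by (rule order_trans[OF _ entire_dist_ge[of 0]]) simp
  show "entire_dist f g = entire_dist g f"
    by (simp add: entire_dist_def dist_commute)
  show "entire_dist f g = 0 \<longleftrightarrow> f = g"
  proof
    assume "entire_dist f g = 0"
    have "dist (f z) (g z) \<le> 0" for z
    proof -
      have "0 < 1 / (1 + norm z)" by (simp add: add_pos_nonneg)
      then show ?thesis using entire_dist_ge[of z f g] \<open>entire_dist f g = 0\<close> by linarith
    qed
    then show "f = g" by auto
  qed (simp add: entire_dist_def)
  show "entire_dist f h \<le> entire_dist f g + entire_dist g h"
  proof (rule entire_dist_le)
    fix z
    have "dist (f z) (h z) \<le> dist (f z) (g z) + dist (g z) (h z)" by (rule dist_triangle)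
    moreover have "0 < 1 / (1 + norm z)" by (simp add: add_pos_nonneg)
    moreover have "0 \<le> dist (f z) (g z)" "0 \<le> dist (g z) (h z)" by auto
    moreover have "min c a \<le> min c b + min c d" if "a \<le> b + d" "0 < c" "0 \<le> b" "0 \<le> d" for a b c d :: real
      using that unfolding min_def by (auto split: if_splits)
    ultimately have "min (1 / (1 + norm z)) (dist (f z) (h z)) \<le>
      min (1 / (1 + norm z)) (dist (f z) (g z)) + min (1 / (1 + norm z)) (dist (g z) (h z))"
      by blast
    with entire_dist_ge[of z f g] entire_dist_ge[of z g h]
    show "min (1 / (1 + norm z)) (dist (f z) (h z)) \<le> entire_dist f g + entire_dist g h" by linarith
  qed
qed

lemma ex_nat_inverse_less: "e > 0 \<Longrightarrow> \<exists>k\<ge>K. 1 / (real k + 1) < e"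
proof -
  assume "e > 0"
  then obtain n where n: "1 / real (Suc n) < e" using nat_approx_posE by blast
  have "1 / (real (max n K) + 1) \<le> 1 / real (Suc n)" by (intro frac_le) auto
  then show ?thesis using n by (intro exI[of _ "max n K"]) auto
qed

text \<open>
  The difference of two entire functions attains its maximum on a closed disc, so a strict bound
  there leaves room for a further perturbation.
\<close>

lemma near_absorbs:
  assumes "g \<in> near f k" "f holomorphic_on UNIV"
  shows "\<exists>l. near g l \<subseteq> near f k"
proof -
  have "compact ((\<lambda>z. dist (g z) (f z)) ` cball 0 (real k))"
    using assms by (intro compact_continuous_image continuous_intros entire_cont) (auto simp: near_def)
  moreover have "(\<lambda>z. dist (g z) (f z)) ` cball 0 (real k) \<noteq> {}" by simp
  ultimately obtain w where w: "w \<in> cball 0 (real k)"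
    "\<And>z. z \<in> cball 0 (real k) \<Longrightarrow> dist (g z) (f z) \<le> dist (g w) (f w)"
    using compact_attains_sup[of "(\<lambda>z. dist (g z) (f z)) ` cball 0 (real k)"] by blast
  have "dist (g w) (f w) < 1 / (real k + 1)" using assms w by (auto simp: near_def)
  then obtain l where l: "l \<ge> k" "1 / (real l + 1) < 1 / (real k + 1) - dist (g w) (f w)"
    using ex_nat_inverse_less[of "1 / (real k + 1) - dist (g w) (f w)" k] by auto
  have "h \<in> near f k" if "h \<in> near g l" for h
  proof -
    have "dist (h z) (f z) < 1 / (real k + 1)" if "z \<in> cball 0 (real k)" for z
    proof -
      have "dist (h z) (g z) < 1 / (real l + 1)"
        using \<open>h \<in> near g l\<close> that l by (auto simp: near_def)
      then show ?thesis using dist_triangle[of "h z" "f z" "g z"] w(2)[OF that] l by linarith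
    qed
    then show ?thesis using that by (auto simp: near_def)
  qed
  then show ?thesis by blast
qed

text \<open>
  The image of a compact set under a continuous function has positive distance to the complement
  of an open set that contains it.
\<close>

lemma compact_open_imp_near:
  assumes "generate_topology_on {{f. f ` K \<subseteq> U} | K U. compact K \<and> open (U :: complex set)} S"
    "f \<in> S" "f holomorphic_on UNIV"
  shows "\<exists>k. near f k \<subseteq> S"
  using assms
proof induction
  case (Int a b)
  then obtain k l where "near f k \<subseteq> a" "near f l \<subseteq> b" by auto
  then have "near f (max k l) \<subseteq> a \<inter> b"
    using near_antimono[of k "max k l" f] near_antimono[of l "max k l" f] by auto
  then show ?case by blast
next
  case (Basis s)
  then obtain K U where s: "s = {f. f ` K \<subseteq> U}" and K: "compact K" "open U" by blast
  have "compact (f ` K)" using K Basis by (intro compact_continuous_image entire_cont)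
  then obtain e where e: "e > 0" "(\<Union>x\<in>f ` K. ball x e) \<subseteq> U"
    using compact_subset_open_imp_ball_epsilon_subset[of "f ` K" U] K(2) Basis(2) unfolding s by blast
  obtain r where r: "\<And>z. z \<in> K \<Longrightarrow> norm z \<le> r" using compact_imp_bounded[OF K(1)] bounded_iff by blast
  obtain k where k: "k \<ge> nat \<lceil>r\<rceil>" "1 / (real k + 1) < e" using ex_nat_inverse_less[OF e(1)] by blast
  have "near f k \<subseteq> s"
  proof
    fix g assume g: "g \<in> near f k"
    have "g z \<in> U" if "z \<in> K" for z
    proof -
      have "norm z \<le> real k" using r[OF that] k by linarith
      then have "dist (f z) (g z) < e" using g k by (force simp: near_def dist_commute)
      then have "g z \<in> (\<Union>x\<in>f ` K. ball x e)" using that by auto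
      then show ?thesis using e by blast
    qed
    then show "g \<in> s" by (auto simp: s)
  qed
  then show ?case ..
next
  case (UN S)
  then obtain s where "s \<in> S" "f \<in> s" by blast
  with UN obtain k where "near f k \<subseteq> s" by blast
  with \<open>s \<in> S\<close> show ?case by blast
qed simp

text \<open>
  On a finite net of the disc that is fine with respect to the modulus of continuity of \<open>f\<close>, uniform
  closeness follows from finitely many conditions that map a compact piece into a small ball.
\<close>

lemma near_contains_open:
  assumes f: "f holomorphic_on UNIV"
  shows "\<exists>W. openin entire_top W \<and> f \<in> W \<and> W \<subseteq> near f k"
proof -
  define K where "K = cball (0::complex) (real k)"
  define e where "e = 1 / (real k + 1) / 2"
  have e: "e > 0" and e2: "e + e = 1 / (real k + 1)" by (simp_all add: e_def field_simps)
  have "compact K" by (simp add: K_def)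
  have "uniformly_continuous_on K f"
    using f \<open>compact K\<close> by (intro compact_uniformly_continuous entire_cont)
  then obtain d where d: "d > 0" "\<And>z w. z \<in> K \<Longrightarrow> w \<in> K \<Longrightarrow> dist w z < d \<Longrightarrow> dist (f w) (f z) < e"
    unfolding uniformly_continuous_on_def using e by metis
  obtain Z where Z: "finite Z" "Z \<subseteq> K" "K \<subseteq> (\<Union>z\<in>Z. ball z (d/2))"
    using \<open>compact K\<close> d(1) seq_compact_imp_totally_bounded[of K] compact_eq_seq_compact_metric
    by (metis half_gt_zero)
  define W where "W = {f. f holomorphic_on UNIV} \<inter> (\<Inter>z\<in>Z. {g. g ` (K \<inter> cball z (d/2)) \<subseteq> ball (f z) e})"
  have "openin (topology_generated_by {{f :: complex \<Rightarrow> complex. f ` K \<subseteq> U} | K U. compact K \<and> open U})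
     {g. g ` (K \<inter> cball z (d/2)) \<subseteq> ball (f z) e}" for z
    by (rule topology_generated_by_Basis) (use \<open>compact K\<close> in blast)
  then have "openin entire_top ({f. f holomorphic_on UNIV} \<inter> {g. g ` (K \<inter> cball z (d/2)) \<subseteq> ball (f z) e})" for z
    unfolding entire_top_def by (meson openin_subtopology_Int2)
  then have "openin entire_top (\<Inter>z\<in>Z. {f. f holomorphic_on UNIV} \<inter> {g. g ` (K \<inter> cball z (d/2)) \<subseteq> ball (f z) e})"
    if "Z \<noteq> {}" using that Z(1) by (intro openin_Inter) auto
  moreover have "Z \<noteq> {}" using Z(3) by (auto simp: K_def)
  ultimately have "openin entire_top W" by (simp add: W_def)
  moreover have "f \<in> W" using f d Z by (force simp: W_def dist_commute)
  moreover have "W \<subseteq> near f k"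
  proof
    fix g assume g: "g \<in> W"
    have "dist (g w) (f w) < 1 / (real k + 1)" if "w \<in> K" for w
    proof -
      obtain z where z: "z \<in> Z" "w \<in> ball z (d/2)" using Z(3) \<open>w \<in> K\<close> by blast
      then have "dist (f z) (g w) < e" using g that by (force simp: W_def)
      moreover have "dist (f w) (f z) < e" using d z that Z by (force simp: dist_commute)
      ultimately show ?thesis using dist_triangle[of "g w" "f w" "f z"]
        unfolding e2[symmetric] dist_commute[of "f z" "g w"] dist_commute[of "f w" "f z"] by linarith
    qed
    then show "g \<in> near f k" using g by (auto simp: near_def K_def W_def)
  qed
  ultimately show ?thesis by blast
qed

lemma openin_entire_top_iff:
  "openin entire_top U \<longleftrightarrow> U \<subseteq> {f. f holomorphic_on UNIV} \<and> (\<forall>f\<in>U. \<exists>k. near f k \<subseteq> U)"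
proof
  assume U: "openin entire_top U"
  then have 1: "U \<subseteq> {f. f holomorphic_on UNIV}"
    using openin_subset[OF U] by (simp add: topspace_entire_top)
  have "\<exists>S. generate_topology_on {{f. f ` K \<subseteq> U} | K U. compact K \<and> open (U :: complex set)} S
    \<and> U = S \<inter> {f. f holomorphic_on UNIV}"
    using U unfolding entire_top_def openin_subtopology openin_topology_generated_by_iff .
  then obtain S where S: "generate_topology_on {{f. f ` K \<subseteq> U} | K U. compact K \<and> open (U :: complex set)} S"
    "U = S \<inter> {f. f holomorphic_on UNIV}"
    by (elim exE conjE) (rule that)
  have "\<exists>k. near f k \<subseteq> U" if "f \<in> U" for f
  proof -
    have "f \<in> S" "f holomorphic_on UNIV" using S(2) that by auto
    then obtain k where "near f k \<subseteq> S" using compact_open_imp_near[OF S(1)] by auto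
    moreover have "near f k \<subseteq> {f. f holomorphic_on UNIV}" by (auto simp: near_def)
    ultimately show ?thesis unfolding S(2) by (intro exI[of _ k]) auto
  qed
  with 1 show "U \<subseteq> {f. f holomorphic_on UNIV} \<and> (\<forall>f\<in>U. \<exists>k. near f k \<subseteq> U)" by simp
next
  assume U: "U \<subseteq> {f. f holomorphic_on UNIV} \<and> (\<forall>f\<in>U. \<exists>k. near f k \<subseteq> U)"
  have "\<exists>W. openin entire_top W \<and> f \<in> W \<and> W \<subseteq> U" if "f \<in> U" for f
  proof -
    obtain k where k: "near f k \<subseteq> U" using U \<open>f \<in> U\<close> by blast
    have "f holomorphic_on UNIV" using U that by blast
    then obtain W where "openin entire_top W" "f \<in> W" "W \<subseteq> near f k"
      using near_contains_open by blast
    with k show ?thesis by (intro exI[of _ W]) auto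
  qed
  then show "openin entire_top U"
    by (subst openin_subopen) auto
qed

lemma openin_near: "f holomorphic_on UNIV \<Longrightarrow> openin entire_top (near f k)"
  using near_absorbs by (auto simp: openin_entire_top_iff) (auto simp: near_def)

lemma entire_top_eq_mtopology: "entire_top = entire_metric.mtopology"
proof (rule topology_eq[THEN iffD2], intro allI)
  fix U
  have 1: "\<exists>r>0. entire_metric.mball f r \<subseteq> near f k" if "f holomorphic_on UNIV" for f k
  proof (intro exI conjI subsetI)
    fix g assume "g \<in> entire_metric.mball f (1 / (real k + 1))"
    then have g: "g holomorphic_on UNIV" "entire_dist f g < 1 / (real k + 1)"
      by (auto simp: entire_metric.mball_def)
    then show "g \<in> near f k" using near_if_entire_dist[OF g(2)] by (force simp: near_def)
  qed simp
  have 2: "\<exists>k. near f k \<subseteq> entire_metric.mball f r" if "r > 0" "f holomorphic_on UNIV" for f r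
  proof -
    obtain k where k: "1 / (real k + 1) < r" using ex_nat_inverse_less[OF \<open>r > 0\<close>] by blast
    have "entire_dist f g < r" if "g \<in> near f k" for g
      using that k entire_dist_if_near[of k g f] by (force simp: near_def)
    then have "near f k \<subseteq> entire_metric.mball f r" using that by (auto simp: near_def)
    then show ?thesis ..
  qed
  show "openin entire_top U = openin entire_metric.mtopology U"
  proof
    assume U: "openin entire_top U"
    have "\<exists>r>0. entire_metric.mball f r \<subseteq> U" if "f \<in> U" for f
    proof -
      obtain k where k: "near f k \<subseteq> U" and f: "f holomorphic_on UNIV"
        using U \<open>f \<in> U\<close> unfolding openin_entire_top_iff by blast
      obtain r where "r > 0" "entire_metric.mball f r \<subseteq> near f k" using 1[OF f] by blast
      with k show ?thesis by (intro exI[of _ r]) auto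
    qed
    then show "openin entire_metric.mtopology U"
      using U unfolding openin_entire_top_iff entire_metric.openin_mtopology by simp
  next
    assume U: "openin entire_metric.mtopology U"
    have "\<exists>k. near f k \<subseteq> U" if "f \<in> U" for f
    proof -
      obtain r where r: "r > 0" "entire_metric.mball f r \<subseteq> U" and f: "f holomorphic_on UNIV"
        using U \<open>f \<in> U\<close> unfolding entire_metric.openin_mtopology by blast
      obtain k where "near f k \<subseteq> entire_metric.mball f r" using 2[OF r(1) f] by blast
      with r show ?thesis by (intro exI[of _ k]) auto
    qed
    then show "openin entire_top U"
      using U unfolding openin_entire_top_iff entire_metric.openin_mtopology by simp
  qed
qed

lemma entire_limit_entire:
  assumes hol: "\<And>n. h n holomorphic_on UNIV"
    and lim: "\<And>k::nat. uniform_limit (cball 0 (real k)) h g sequentially"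
  shows "g holomorphic_on UNIV"
proof (rule holomorphic_uniform_sequence[where f = h])
  fix z :: complex
  have "cball z 1 \<subseteq> cball 0 (real (nat \<lceil>norm z + 1\<rceil>))"
  proof
    fix w assume "w \<in> cball z 1"
    then have "norm w \<le> norm z + 1"
      using norm_triangle_ineq2[of w z] by (simp add: dist_norm norm_minus_commute)
    then show "w \<in> cball 0 (real (nat \<lceil>norm z + 1\<rceil>))" by simp linarith
  qed
  then show "\<exists>d>0. cball z d \<subseteq> UNIV \<and> uniform_limit (cball z d) h g sequentially"
    using uniform_limit_on_subset[OF lim] by (intro exI[of _ 1]) auto
qed (use hol in auto)

lemma mcomplete_entire: "entire_metric.mcomplete"
  unfolding entire_metric.mcomplete_def
proof (intro allI impI)
  fix h :: "nat \<Rightarrow> complex \<Rightarrow> complex"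
  assume h: "entire_metric.MCauchy h"
  then have hol: "\<And>n. h n holomorphic_on UNIV" by (auto simp: entire_metric.MCauchy_def)
  have cau: "uniformly_Cauchy_on (cball 0 (real k)) h" for k
    unfolding uniformly_Cauchy_on_def
  proof (intro allI impI)
    fix e :: real assume "e > 0"
    obtain N where N: "\<And>m n. N \<le> m \<Longrightarrow> N \<le> n \<Longrightarrow> entire_dist (h m) (h n) < min e (1 / (real k + 1))"
      using h \<open>e > 0\<close> unfolding entire_metric.MCauchy_def
      by (elim conjE allE[of _ "min e (1 / (real k + 1))"]) (auto simp: add_nonneg_pos)
    have "dist (h m z) (h n z) < e" if "N \<le> m" "N \<le> n" "z \<in> cball 0 (real k)" for m n z
      using near_if_entire_dist[of "h n" "h m" k z] N[OF that(2,1)] that(3) by auto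
    then show "\<exists>M. \<forall>x\<in>cball 0 (real k). \<forall>m\<ge>M. \<forall>n\<ge>M. dist (h m x) (h n x) < e" by blast
  qed
  define g where "g = (\<lambda>z. lim (\<lambda>n. h n z))"
  have lim: "uniform_limit (cball 0 (real k)) h g sequentially" for k
    using Cauchy_uniformly_convergent[OF cau] unfolding uniformly_convergent_uniform_limit_iff g_def .
  have g: "g holomorphic_on UNIV" by (rule entire_limit_entire[OF hol lim])
  have "\<exists>N. \<forall>n\<ge>N. entire_dist (h n) g < e" if "e > 0" for e
  proof -
    obtain k where k: "1 / (real k + 1) < e" using ex_nat_inverse_less[OF \<open>e > 0\<close>] by blast
    have "\<forall>\<^sub>F n in sequentially. \<forall>z\<in>cball 0 (real k). dist (h n z) (g z) < 1 / (real k + 1)"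
      by (rule uniform_limitD[OF lim]) simp
    then obtain N where N: "\<And>n z. n \<ge> N \<Longrightarrow> z \<in> cball 0 (real k) \<Longrightarrow> dist (h n z) (g z) < 1 / (real k + 1)"
      unfolding eventually_sequentially by blast
    have "entire_dist (h n) g < e" if "n \<ge> N" for n
      using entire_dist_if_near[of k g "h n"] N[OF that] k by (force simp: dist_commute)
    then show ?thesis by blast
  qed
  then show "\<exists>x. limitin entire_metric.mtopology h x sequentially"
    using g hol by (intro exI[of _ g]) (auto simp: entire_metric.limit_metric_sequentially)
qed

text \<open>
  Baire's theorem: a countable power of a completely metrizable space is completely metrizable.
\<close>

lemma residual_power_nonempty:
  assumes "residual_in_top (entire_power_top I) S"
  shows "S \<noteq> {}"
proof -
  obtain \<G> where G: "countable \<G>" "\<And>G. G \<in> \<G> \<Longrightarrow> openin (entire_power_top I) G"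
    "\<And>G. G \<in> \<G> \<Longrightarrow> dense_in_top (entire_power_top I) G" "topspace (entire_power_top I) \<inter> \<Inter>\<G> \<subseteq> S"
    using assms unfolding residual_in_top_def by blast
  have "completely_metrizable_space entire_top"
    unfolding entire_top_eq_mtopology
    by (rule entire_metric.completely_metrizable_space_mtopology[OF mcomplete_entire])
  moreover have "countable {i \<in> I. \<not> (\<exists>a. topspace entire_top \<subseteq> {a})}" by (rule countableI_type)
  ultimately have "completely_metrizable_space (entire_power_top I)"
    unfolding completely_metrizable_space_product_topology by blast
  moreover have "openin (entire_power_top I) G \<and> entire_power_top I closure_of G = topspace (entire_power_top I)"
    if "G \<in> \<G>" for G
    using G(2,3)[OF that] unfolding dense_in_top_def by blast
  ultimately have cl: "entire_power_top I closure_of \<Inter>\<G> = topspace (entire_power_top I)"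
    using Baire_category[of "entire_power_top I" \<G>] G(1) by blast
  have ne: "(\<lambda>i\<in>I. \<lambda>z. 0) \<in> topspace (entire_power_top I)"
    by (simp add: topspace_entire_top)
  have "topspace (entire_power_top I) \<inter> \<Inter>\<G> \<noteq> {}"
    by (metis cl ne closure_of_eq_empty_gen disjnt_def empty_iff)
  then show ?thesis using G(4) by blast
qed

section \<open>Convolution operators\<close>

text \<open>
  These are the only properties of convolution operators that the argument uses. They are stable
  under iteration, with \<open>\<Phi> ^ n\<close> in place of \<open>\<Phi>\<close>, so that an iterate can be treated like the
  operator itself.
\<close>

locale exp_diagonal_operator =
  fixes T :: operator and \<Phi> :: "complex \<Rightarrow> complex"
  assumes op_entire: "f holomorphic_on UNIV \<Longrightarrow> T f holomorphic_on UNIV"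
    and op_near: "f holomorphic_on UNIV \<Longrightarrow> \<exists>l. \<forall>g\<in>near f l. T g \<in> near (T f) k"
    and op_add: "f holomorphic_on UNIV \<Longrightarrow> g holomorphic_on UNIV \<Longrightarrow>
      T (\<lambda>z. f z + g z) = (\<lambda>z. T f z + T g z)"
    and op_cmult: "f holomorphic_on UNIV \<Longrightarrow> T (\<lambda>z. c * f z) = (\<lambda>z. c * T f z)"
    and op_exp: "T (\<lambda>z. exp (\<mu> * z)) = (\<lambda>z. \<Phi> \<mu> * exp (\<mu> * z))"

lemma exp_diagonal_operator_funpow:
  assumes "exp_diagonal_operator T \<Phi>"
  shows "exp_diagonal_operator (T ^^ n) (\<lambda>\<mu>. \<Phi> \<mu> ^ n)"
proof (induction n)
  case 0
  show ?case by unfold_locales auto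
next
  case (Suc n)
  interpret A: exp_diagonal_operator T \<Phi> by fact
  interpret B: exp_diagonal_operator "T ^^ n" "\<lambda>\<mu>. \<Phi> \<mu> ^ n" by fact
  show ?case
  proof
    fix f :: "complex \<Rightarrow> complex" and k
    assume f: "f holomorphic_on UNIV"
    show "(T ^^ Suc n) f holomorphic_on UNIV"
      using A.op_entire B.op_entire f by simp
    obtain l where l: "\<And>g. g \<in> near ((T ^^ n) f) l \<Longrightarrow> T g \<in> near (T ((T ^^ n) f)) k"
      using A.op_near[OF B.op_entire[OF f]] by blast
    obtain m where m: "\<And>g. g \<in> near f m \<Longrightarrow> (T ^^ n) g \<in> near ((T ^^ n) f) l"
      using B.op_near[OF f] by blast
    show "\<exists>l. \<forall>g\<in>near f l. (T ^^ Suc n) g \<in> near ((T ^^ Suc n) f) k"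
      using l m by (intro exI[of _ m]) auto
    show "(T ^^ Suc n) (\<lambda>z. c * f z) = (\<lambda>z. c * (T ^^ Suc n) f z)" for c
      using f by (simp add: A.op_cmult B.op_cmult B.op_entire)
    show "(T ^^ Suc n) (\<lambda>z. f z + g z) = (\<lambda>z. (T ^^ Suc n) f z + (T ^^ Suc n) g z)"
      if "g holomorphic_on UNIV" for g
      using f that by (simp add: A.op_add B.op_add B.op_entire)
  next
    show "(T ^^ Suc n) (\<lambda>z. exp (\<mu> * z)) = (\<lambda>z. \<Phi> \<mu> ^ Suc n * exp (\<mu> * z))" for \<mu>
    proof -
      have "(\<lambda>z. exp (\<mu> * z)) holomorphic_on UNIV" by (intro holomorphic_intros)
      then show ?thesis by (simp add: B.op_exp A.op_cmult A.op_exp mult.assoc mult.left_commute)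
    qed
  qed
qed

context exp_diagonal_operator
begin

lemma op_zero: "T (\<lambda>z. 0) = (\<lambda>z. 0)"
  using op_cmult[of "\<lambda>z. 0" 0] by simp

lemma op_sum:
  assumes "finite A" "\<And>i. i \<in> A \<Longrightarrow> f i holomorphic_on UNIV"
  shows "T (\<lambda>z. \<Sum>i\<in>A. f i z) = (\<lambda>z. \<Sum>i\<in>A. T (f i) z)"
  using assms
proof (induction A rule: finite_induct)
  case empty
  then show ?case by (simp add: op_zero)
next
  case (insert i A)
  then have "(\<lambda>z. \<Sum>i\<in>A. f i z) holomorphic_on UNIV" by (intro holomorphic_on_sum) auto
  with insert show ?case by (simp add: op_add)
qed

lemma op_exp_sum:
  assumes "finite A"
  shows "T (\<lambda>z. \<Sum>i\<in>A. c i * exp (\<mu> i * z)) = (\<lambda>z. \<Sum>i\<in>A. c i * \<Phi> (\<mu> i) * exp (\<mu> i * z))"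
proof -
  have hol: "(\<lambda>z. exp (m * z)) holomorphic_on UNIV" for m :: complex
    by (intro holomorphic_intros)
  then have "T (\<lambda>z. c i * exp (\<mu> i * z)) = (\<lambda>z. c i * \<Phi> (\<mu> i) * exp (\<mu> i * z))" for i
    by (simp add: op_cmult op_exp mult.assoc)
  moreover have "(\<lambda>z. c i * exp (\<mu> i * z)) holomorphic_on UNIV" for i
    by (intro holomorphic_intros)
  ultimately show ?thesis using op_sum[OF assms, of "\<lambda>i z. c i * exp (\<mu> i * z)"] by simp
qed

end

text \<open>
  Cauchy's inequality on discs of radius \<open>2 * R\<close>, where \<open>R\<close> bounds the type of \<open>\<Phi>\<close>: the
  factorials cancel and a geometric series with ratio one half remains.
\<close>

lemma convolution_terms_bound:
  assumes "finite_exponential_type \<Phi>"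
  obtains M R where "M > 0" "R > 0"
    "\<And>f z B n. f holomorphic_on UNIV \<Longrightarrow> (\<And>w. w \<in> cball z R \<Longrightarrow> norm (f w) \<le> B) \<Longrightarrow>
       norm (taylor_coeff \<Phi> n * (deriv ^^ n) f z) \<le> M * B * (1/2) ^ n"
proof -
  obtain M R where MR: "M > 0" "R > 0" "\<And>n. norm (taylor_coeff \<Phi> n) \<le> M * R ^ n / fact n"
    using assms unfolding finite_exponential_type_def by auto
  show thesis
  proof (rule that[of M "2 * R"])
    fix f :: "complex \<Rightarrow> complex" and z B n
    assume f: "f holomorphic_on UNIV" and B: "\<And>w. w \<in> cball z (2 * R) \<Longrightarrow> norm (f w) \<le> B"
    have "norm ((deriv ^^ n) f z) \<le> fact n * B / (2 * R) ^ n"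
      using MR(2) B by (intro Cauchy_inequality entire_on[OF f] entire_cont[OF f]) (auto simp: dist_norm)
    then have "norm (taylor_coeff \<Phi> n) * norm ((deriv ^^ n) f z) \<le> (M * R ^ n / fact n) * (fact n * B / (2 * R) ^ n)"
      using MR by (intro mult_mono) auto
    also have "\<dots> = M * B * (1/2) ^ n"
      using MR by (simp add: power_mult_distrib power_one_over divide_simps)
    finally show "norm (taylor_coeff \<Phi> n * (deriv ^^ n) f z) \<le> M * B * (1/2) ^ n"
      by (simp add: norm_mult)
  qed (use MR in auto)
qed

lemma entire_bounded_cball:
  assumes "f holomorphic_on UNIV"
  obtains B where "\<And>w. w \<in> cball (0::complex) r \<Longrightarrow> norm (f w) \<le> B"
proof -
  have "compact (f ` cball 0 r)"
    using assms by (intro compact_continuous_image entire_cont) auto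
  then have "bounded (f ` cball 0 r)" by (rule compact_imp_bounded)
  then obtain B where "\<forall>x\<in>f ` cball 0 r. norm x \<le> B" unfolding bounded_iff by blast
  then show thesis by (intro that[of B]) auto
qed

lemma cball_subset_cball0: "norm z \<le> k \<Longrightarrow> cball z r \<subseteq> cball 0 (k + r)" for z :: complex
proof
  fix w assume "norm z \<le> k" "w \<in> cball z r"
  then show "w \<in> cball 0 (k + r)"
    using norm_triangle_ineq2[of w z] by (simp add: dist_norm norm_minus_commute)
qed

proposition exp_diagonal_convolution_operator:
  assumes \<Phi>: "\<Phi> holomorphic_on UNIV" "finite_exponential_type \<Phi>"
  shows "exp_diagonal_operator (convolution_operator \<Phi>) \<Phi>"
proof -
  define t where "t = (\<lambda>f n z. taylor_coeff \<Phi> n * (deriv ^^ n) f z)"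
  define T where "T = convolution_operator \<Phi>"
  have T: "T f = (\<lambda>z. suminf (\<lambda>n. t f n z))" for f by (simp add: T_def t_def convolution_operator_def)
  obtain M R where MR: "M > 0" "R > 0" and
    tb: "\<And>f z B n. f holomorphic_on UNIV \<Longrightarrow> (\<And>w. w \<in> cball z R \<Longrightarrow> norm (f w) \<le> B) \<Longrightarrow>
       norm (t f n z) \<le> M * B * (1/2) ^ n"
    using convolution_terms_bound[OF \<Phi>(2)] unfolding t_def by metis
  have geo: "summable (\<lambda>n. M * B * (1/2::real) ^ n)" for B
    by (intro summable_mult summable_geometric) auto
  have summ: "summable (\<lambda>n. norm (t f n z))" if f: "f holomorphic_on UNIV" for f z
  proof -
    obtain B where B: "\<And>w. w \<in> cball 0 (norm z + R) \<Longrightarrow> norm (f w) \<le> B"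
      using entire_bounded_cball[OF f] by blast
    have "norm (t f n z) \<le> M * B * (1/2) ^ n" for n
      using B cball_subset_cball0[of z "norm z" R] by (intro tb f) auto
    then show ?thesis by (intro summable_comparison_test'[OF geo[of B]]) auto
  qed
  have bound: "norm (T f z) \<le> 2 * M * B"
    if f: "f holomorphic_on UNIV" and B: "\<And>w. w \<in> cball z R \<Longrightarrow> norm (f w) \<le> B" for f z B
  proof -
    have "norm (T f z) \<le> suminf (\<lambda>n. norm (t f n z))" unfolding T by (rule summable_norm[OF summ[OF f]])
    also have "\<dots> \<le> suminf (\<lambda>n. M * B * (1/2) ^ n)" by (intro suminf_le summ f geo tb B)
    also have "\<dots> = M * B * 2" by (subst suminf_mult) (auto simp: suminf_geometric)
    finally show ?thesis by simp
  qed
  have ent: "T f holomorphic_on UNIV" if f: "f holomorphic_on UNIV" for f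
  proof (rule entire_limit_entire)
    show "(\<lambda>z. \<Sum>i<n. t f i z) holomorphic_on UNIV" for n
      unfolding t_def using f by (intro holomorphic_intros) auto
    fix k :: nat
    obtain B where B: "\<And>w. w \<in> cball 0 (real k + R) \<Longrightarrow> norm (f w) \<le> B"
      using entire_bounded_cball[OF f] by blast
    show "uniform_limit (cball 0 (real k)) (\<lambda>n z. \<Sum>i<n. t f i z) (T f) sequentially"
      unfolding T
    proof (rule Weierstrass_m_test)
      fix n and z :: complex assume "z \<in> cball 0 (real k)"
      then have "cball z R \<subseteq> cball 0 (real k + R)" by (intro cball_subset_cball0) auto
      then show "norm (t f n z) \<le> M * B * (1/2) ^ n" using B by (intro tb f) auto
    qed (rule geo)
  qed
  have add: "T (\<lambda>z. f z + g z) = (\<lambda>z. T f z + T g z)"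
    if f: "f holomorphic_on UNIV" and g: "g holomorphic_on UNIV" for f g
  proof
    fix z
    have "t (\<lambda>z. f z + g z) n z = t f n z + t g n z" for n
      unfolding t_def using higher_deriv_add[OF f g, of z n] by (simp add: algebra_simps)
    then show "T (\<lambda>z. f z + g z) z = T f z + T g z"
      unfolding T by (simp add: suminf_add[OF summable_norm_cancel summable_norm_cancel, OF summ[OF f] summ[OF g]])
  qed
  have cm: "T (\<lambda>z. c * f z) = (\<lambda>z. c * T f z)" if f: "f holomorphic_on UNIV" for f c
  proof
    fix z
    have "t (\<lambda>z. c * f z) n z = c * t f n z" for n
      unfolding t_def using higher_deriv_cmult[OF f, of z n c] by (simp add: algebra_simps)
    then show "T (\<lambda>z. c * f z) z = c * T f z"
      unfolding T by (simp add: suminf_mult[OF summable_norm_cancel, OF summ[OF f]])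
  qed
  have "exp_diagonal_operator T \<Phi>"
  proof
    fix f :: "complex \<Rightarrow> complex" and k :: nat
    assume f: "f holomorphic_on UNIV"
    obtain l where l: "l \<ge> nat \<lceil>real k + R\<rceil>" "1 / (real l + 1) < 1 / (real k + 1) / (2 * M)"
      using ex_nat_inverse_less[of "1 / (real k + 1) / (2 * M)" "nat \<lceil>real k + R\<rceil>"] MR by auto
    have "T g \<in> near (T f) k" if g: "g \<in> near f l" for g
    proof -
      have gh: "g holomorphic_on UNIV" using g by (simp add: near_def)
      have d: "(\<lambda>z. g z - f z) holomorphic_on UNIV" using gh f by (intro holomorphic_intros)
      have "dist (T g z) (T f z) < 1 / (real k + 1)" if z: "z \<in> cball 0 (real k)" for z
      proof -
        have "T g = T (\<lambda>z. f z + (g z - f z))" by simp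
        also have "\<dots> = (\<lambda>z. T f z + T (\<lambda>z. g z - f z) z)" by (rule add[OF f d])
        finally have "dist (T g z) (T f z) = norm (T (\<lambda>z. g z - f z) z)" by (simp add: dist_norm)
        also have "\<dots> \<le> 2 * M * (1 / (real l + 1))"
        proof (rule bound[OF d])
          fix w assume "w \<in> cball z R"
          then have "w \<in> cball 0 (real k + R)" using cball_subset_cball0[of z k R] z by auto
          moreover have "real k + R \<le> real l" using l(1) by linarith
          ultimately have "w \<in> cball 0 (real l)" by simp
          then show "norm (g w - f w) \<le> 1 / (real l + 1)"
            using g by (simp add: near_def dist_norm less_imp_le)
        qed
        also have "\<dots> < 1 / (real k + 1)" using mult_strict_left_mono[OF l(2), of "2 * M"] MR by simp
        finally show ?thesis .
      qed
      then show ?thesis using ent[OF gh] by (simp add: near_def)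
    qed
    then show "\<exists>l. \<forall>g\<in>near f l. T g \<in> near (T f) k" by blast
  next
    fix \<mu> :: complex
    have der: "(deriv ^^ n) (\<lambda>z. exp (\<mu> * z)) = (\<lambda>z. \<mu> ^ n * exp (\<mu> * z))" for n
    proof (induction n)
      case (Suc n)
      have "deriv (\<lambda>z. \<mu> ^ n * exp (\<mu> * z)) z = \<mu> ^ n * (\<mu> * exp (\<mu> * z))" for z
        by (rule DERIV_imp_deriv) (auto intro!: derivative_eq_intros)
      then show ?case using Suc by (simp add: algebra_simps)
    qed simp
    show "T (\<lambda>z. exp (\<mu> * z)) = (\<lambda>z. \<Phi> \<mu> * exp (\<mu> * z))"
    proof
      fix z
      have "(\<lambda>n. (deriv ^^ n) \<Phi> 0 / fact n * (\<mu> - 0) ^ n) sums \<Phi> \<mu>"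
        by (rule holomorphic_power_series[of _ _ "norm \<mu> + 1"]) (use entire_on[OF \<Phi>(1)] in auto)
      then have "(\<lambda>n. taylor_coeff \<Phi> n * \<mu> ^ n * exp (\<mu> * z)) sums (\<Phi> \<mu> * exp (\<mu> * z))"
        unfolding taylor_coeff_def by (intro sums_mult2) simp
      then show "T (\<lambda>z. exp (\<mu> * z)) z = \<Phi> \<mu> * exp (\<mu> * z)"
        unfolding T t_def der by (simp add: sums_iff mult.assoc)
    qed
  qed (use ent add cm in auto)
  then show ?thesis unfolding T_def .
qed

section \<open>Approximation by exponentials\<close>

definition exp_span :: "complex set \<Rightarrow> (complex \<Rightarrow> complex) set" where
  "exp_span L = {(\<lambda>z. \<Sum>\<mu>\<in>K. c \<mu> * exp (\<mu> * z)) | K c. finite K \<and> K \<subseteq> L}"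

definition exp_span_closure :: "complex set \<Rightarrow> (complex \<Rightarrow> complex) set" where
  "exp_span_closure L = {f. f holomorphic_on UNIV \<and> (\<forall>k. near f k \<inter> exp_span L \<noteq> {})}"

lemma exp_span_entire: "f \<in> exp_span L \<Longrightarrow> f holomorphic_on UNIV"
  by (auto simp: exp_span_def intro!: holomorphic_intros)

lemma exp_span_add:
  assumes "f \<in> exp_span L" "g \<in> exp_span L"
  shows "(\<lambda>z. f z + g z) \<in> exp_span L"
proof -
  obtain K c where f: "f = (\<lambda>z. \<Sum>\<mu>\<in>K. c \<mu> * exp (\<mu> * z))" "finite K" "K \<subseteq> L"
    using assms(1) unfolding exp_span_def by auto
  obtain K' c' where g: "g = (\<lambda>z. \<Sum>\<mu>\<in>K'. c' \<mu> * exp (\<mu> * z))" "finite K'" "K' \<subseteq> L"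
    using assms(2) unfolding exp_span_def by auto
  define d where "d = (\<lambda>\<mu>. (if \<mu> \<in> K then c \<mu> else 0) + (if \<mu> \<in> K' then c' \<mu> else 0))"
  have "f z + g z = (\<Sum>\<mu>\<in>K \<union> K'. d \<mu> * exp (\<mu> * z))" for z
  proof -
    have "(\<Sum>\<mu>\<in>K \<union> K'. d \<mu> * exp (\<mu> * z)) =
      (\<Sum>\<mu>\<in>K \<union> K'. if \<mu> \<in> K then c \<mu> * exp (\<mu> * z) else 0) +
      (\<Sum>\<mu>\<in>K \<union> K'. if \<mu> \<in> K' then c' \<mu> * exp (\<mu> * z) else 0)"
      unfolding sum.distrib[symmetric] by (intro sum.cong) (auto simp: d_def algebra_simps)
    moreover have "(\<Sum>\<mu>\<in>K \<union> K'. if \<mu> \<in> K then c \<mu> * exp (\<mu> * z) else 0) = f z"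
      unfolding f(1) using f(2) g(2) by (intro sum.mono_neutral_cong_right) auto
    moreover have "(\<Sum>\<mu>\<in>K \<union> K'. if \<mu> \<in> K' then c' \<mu> * exp (\<mu> * z) else 0) = g z"
      unfolding g(1) using f(2) g(2) by (intro sum.mono_neutral_cong_right) auto
    ultimately show ?thesis by simp
  qed
  then show ?thesis
    unfolding exp_span_def using f g by (intro CollectI exI[of _ "K \<union> K'"] exI[of _ d]) auto
qed

lemma exp_span_cmult:
  assumes "f \<in> exp_span L"
  shows "(\<lambda>z. a * f z) \<in> exp_span L"
proof -
  obtain K c where f: "f = (\<lambda>z. \<Sum>\<mu>\<in>K. c \<mu> * exp (\<mu> * z))" "finite K" "K \<subseteq> L"
    using assms unfolding exp_span_def by auto
  have "(\<lambda>z. a * f z) = (\<lambda>z. \<Sum>\<mu>\<in>K. (a * c \<mu>) * exp (\<mu> * z))"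
    unfolding f(1) by (simp add: sum_distrib_left mult.assoc)
  then show ?thesis
    unfolding exp_span_def using f by (intro CollectI exI[of _ K] exI[of _ "\<lambda>\<mu>. a * c \<mu>"]) auto
qed

lemma exp_span_closure_entire: "f \<in> exp_span_closure L \<Longrightarrow> f holomorphic_on UNIV"
  by (simp add: exp_span_closure_def)

lemma exp_span_closure_closed:
  assumes "f holomorphic_on UNIV" "\<And>k. near f k \<inter> exp_span_closure L \<noteq> {}"
  shows "f \<in> exp_span_closure L"
proof -
  have "near f k \<inter> exp_span L \<noteq> {}" for k
  proof -
    obtain g where g: "g \<in> near f k" "g \<in> exp_span_closure L" using assms(2)[of k] by blast
    obtain l where "near g l \<subseteq> near f k" using near_absorbs[OF g(1) assms(1)] by blast
    moreover have "near g l \<inter> exp_span L \<noteq> {}" using g(2) by (simp add: exp_span_closure_def)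
    ultimately show ?thesis by blast
  qed
  with assms(1) show ?thesis by (simp add: exp_span_closure_def)
qed

lemma exp_span_closure_add:
  assumes "f \<in> exp_span_closure L" "g \<in> exp_span_closure L"
  shows "(\<lambda>z. f z + g z) \<in> exp_span_closure L"
proof -
  have hol: "(\<lambda>z. f z + g z) holomorphic_on UNIV"
    using assms by (intro holomorphic_intros exp_span_closure_entire) auto
  have "near (\<lambda>z. f z + g z) k \<inter> exp_span L \<noteq> {}" for k
  proof -
    define e where "e = 1 / (real k + 1) / 2"
    have e: "e > 0" "e + e = 1 / (real k + 1)" by (auto simp: e_def field_simps)
    obtain l where l: "l \<ge> k" "1 / (real l + 1) < e"
      using ex_nat_inverse_less[OF e(1)] by blast
    obtain u where u: "u \<in> near f l" "u \<in> exp_span L" using assms(1) unfolding exp_span_closure_def by blast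
    obtain v where v: "v \<in> near g l" "v \<in> exp_span L" using assms(2) unfolding exp_span_closure_def by blast
    have "dist (u z + v z) (f z + g z) < 1 / (real k + 1)" if "z \<in> cball 0 (real k)" for z
    proof -
      have "z \<in> cball 0 (real l)" using that l by simp
      then have "dist (u z) (f z) < 1 / (real l + 1)" "dist (v z) (g z) < 1 / (real l + 1)"
        using u v by (auto simp: near_def)
      then show ?thesis using dist_triangle_add[of "u z" "v z" "f z" "g z"] l(2) e(2) by linarith
    qed
    moreover have "(\<lambda>z. u z + v z) holomorphic_on UNIV"
      using u v by (intro holomorphic_intros exp_span_entire) auto
    ultimately have "(\<lambda>z. u z + v z) \<in> near (\<lambda>z. f z + g z) k" by (simp add: near_def)
    then show ?thesis using exp_span_add[OF u(2) v(2)] by blast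
  qed
  with hol show ?thesis by (simp add: exp_span_closure_def)
qed

lemma exp_span_closure_cmult:
  assumes "f \<in> exp_span_closure L"
  shows "(\<lambda>z. a * f z) \<in> exp_span_closure L"
proof -
  have hol: "(\<lambda>z. a * f z) holomorphic_on UNIV"
    using assms by (intro holomorphic_intros exp_span_closure_entire) auto
  have "near (\<lambda>z. a * f z) k \<inter> exp_span L \<noteq> {}" for k
  proof -
    obtain l where l: "l \<ge> k" "1 / (real l + 1) < 1 / (real k + 1) / (norm a + 1)"
      using ex_nat_inverse_less[of "1 / (real k + 1) / (norm a + 1)" k] by (auto simp: add_nonneg_pos)
    obtain u where u: "u \<in> near f l" "u \<in> exp_span L" using assms unfolding exp_span_closure_def by blast
    have "dist (a * u z) (a * f z) < 1 / (real k + 1)" if "z \<in> cball 0 (real k)" for z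
    proof -
      have "z \<in> cball 0 (real l)" using that l by simp
      then have "dist (u z) (f z) < 1 / (real l + 1)" using u by (auto simp: near_def)
      moreover have "0 < norm a + 1" by (simp add: add_nonneg_pos)
      ultimately have "(norm a + 1) * dist (u z) (f z) < (norm a + 1) * (1 / (real k + 1) / (norm a + 1))"
        using l(2) by (intro mult_strict_left_mono) linarith+
      also have "\<dots> = 1 / (real k + 1)" using \<open>0 < norm a + 1\<close> by simp
      finally have "norm a * dist (u z) (f z) + dist (u z) (f z) < 1 / (real k + 1)" by (simp add: distrib_right)
      moreover have "dist (a * u z) (a * f z) = norm a * dist (u z) (f z)"
        by (simp add: dist_norm right_diff_distrib[symmetric] norm_mult)
      ultimately show ?thesis using zero_le_dist[of "u z" "f z"] by linarith
    qed
    moreover have "(\<lambda>z. a * u z) holomorphic_on UNIV"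
      using u by (intro holomorphic_intros exp_span_entire) auto
    ultimately have "(\<lambda>z. a * u z) \<in> near (\<lambda>z. a * f z) k" by (simp add: near_def)
    then show ?thesis using exp_span_cmult[OF u(2)] by blast
  qed
  with hol show ?thesis by (simp add: exp_span_closure_def)
qed

lemma exp_span_subset_closure: "f \<in> exp_span L \<Longrightarrow> f \<in> exp_span_closure L"
  using near_self exp_span_entire unfolding exp_span_closure_def by blast

lemma exp_span_closure_sum:
  assumes "finite A" "\<And>i. i \<in> A \<Longrightarrow> f i \<in> exp_span_closure L"
  shows "(\<lambda>z. \<Sum>i\<in>A. a i * f i z) \<in> exp_span_closure L"
  using assms
proof (induction A rule: finite_induct)
  case empty
  have "(\<lambda>z. 0) \<in> exp_span L"
    unfolding exp_span_def by (rule CollectI, rule exI[of _ "{}"]) auto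
  then show ?case by (simp add: exp_span_subset_closure)
next
  case (insert i A)
  have "(\<lambda>z. a i * f i z + (\<Sum>i\<in>A. a i * f i z)) \<in> exp_span_closure L"
    using insert by (intro exp_span_closure_add exp_span_closure_cmult) auto
  with insert show ?case by simp
qed

lemma exp_mem_exp_span:
  assumes "\<mu> \<in> L"
  shows "(\<lambda>z. exp (\<mu> * z)) \<in> exp_span L"
  unfolding exp_span_def
  by (rule CollectI, rule exI[of _ "{\<mu>}"], rule exI[of _ "\<lambda>_. 1"]) (use assms in auto)

text \<open>
  The bracket is the exponential with frequency \<open>p + u\<close> minus the first \<open>j\<close> terms of its expansion
  in \<open>u\<close>. Dividing by the next coefficient \<open>u ^ j / fact j\<close> leaves \<open>z ^ j * exp (p * z)\<close> up to an
  error of order \<open>u\<close>.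
\<close>

lemma exp_remainder_bound:
  fixes p u z :: complex
  assumes "u \<noteq> 0" "norm u \<le> 1" "norm z \<le> R"
  shows "norm (fact j / u ^ j * (exp ((p + u) * z) - (\<Sum>i<j. u ^ i / fact i * (z ^ i * exp (p * z)))) - z ^ j * exp (p * z))
     \<le> norm u * (exp (norm p * R) * (exp R * R ^ Suc j))"
proof -
  let ?L = "fact j / u ^ j * (exp ((p + u) * z) - (\<Sum>i<j. u ^ i / fact i * (z ^ i * exp (p * z)))) - z ^ j * exp (p * z)"
  have R: "0 \<le> R" using assms(3) norm_ge_zero[of z] by linarith
  have uz: "norm (u * z) \<le> R"
    using mult_mono[OF assms(2,3)] by (simp add: norm_mult)
  have "exp ((p + u) * z) = exp (p * z) * exp (u * z)" by (simp add: distrib_right exp_add)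
  moreover have "(\<Sum>i<j. u ^ i / fact i * (z ^ i * exp (p * z))) = exp (p * z) * (\<Sum>i<j. (u * z) ^ i / fact i)"
    unfolding sum_distrib_left by (intro sum.cong) (auto simp: power_mult_distrib)
  moreover have "z ^ j * exp (p * z) = fact j / u ^ j * (exp (p * z) * ((u * z) ^ j / fact j))"
    using assms(1) by (simp add: power_mult_distrib)
  ultimately have "?L
     = fact j / u ^ j * (exp (p * z) * (exp (u * z) - ((\<Sum>i<j. (u * z) ^ i / fact i) + (u * z) ^ j / fact j)))"
    by (simp add: right_diff_distrib distrib_left)
  also have "(\<Sum>i<j. (u * z) ^ i / fact i) + (u * z) ^ j / fact j = (\<Sum>i\<le>j. (u * z) ^ i / fact i)"
    by (simp add: lessThan_Suc_atMost[symmetric])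
  finally have "norm (?L)
    = fact j / norm u ^ j * (norm (exp (p * z)) * norm (exp (u * z) - (\<Sum>i\<le>j. (u * z) ^ i / fact i)))"
    by (simp add: norm_mult norm_divide norm_power)
  also have "\<dots> \<le> fact j / norm u ^ j * (exp (norm p * R) * (exp R * (norm u * R) ^ Suc j / fact j))"
  proof (intro mult_left_mono mult_mono)
    have "norm (p * z) \<le> norm p * R" using assms(3) by (simp add: norm_mult mult_left_mono)
    then show "norm (exp (p * z)) \<le> exp (norm p * R)"
      by (meson norm_exp exp_le_cancel_iff order_trans)
    have "exp (norm (u * z)) * norm (u * z) ^ Suc j / fact j \<le> exp R * (norm u * R) ^ Suc j / fact j"
      using uz R assms(3) by (intro divide_right_mono mult_mono power_mono) (auto simp: norm_mult mult_left_mono)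
    then show "norm (exp (u * z) - (\<Sum>i\<le>j. (u * z) ^ i / fact i)) \<le> exp R * (norm u * R) ^ Suc j / fact j"
      using Taylor_exp_field[of "u * z" j] by linarith
  qed auto
  also have "\<dots> = norm u * (exp (norm p * R) * (exp R * R ^ Suc j))"
    using assms(1) by (simp add: power_mult_distrib)
  finally show ?thesis .
qed

text \<open>
  Divided differences: the lower terms of the expansion lie in the closed span by induction, and
  frequencies of \<open>L\<close> that tend to \<open>p\<close> produce the next one as a limit.
\<close>

lemma monomial_exp_mem_closure:
  assumes p: "p islimpt L"
  shows "(\<lambda>z. z ^ j * exp (p * z)) \<in> exp_span_closure L"
proof (induction j rule: less_induct)
  case (less j)
  show ?case
  proof (rule exp_span_closure_closed)
    show "(\<lambda>z. z ^ j * exp (p * z)) holomorphic_on UNIV" by (intro holomorphic_intros)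
    fix k :: nat
    define C where "C = exp (norm p * real k) * (exp (real k) * real k ^ Suc j)"
    have C: "C \<ge> 0" by (simp add: C_def)
    \<comment> \<open>the cap at one makes \<open>C\<close> a bound that is uniform in the frequency shift \<open>u\<close>\<close>
    define e where "e = min 1 (1 / (real k + 1) / (C + 1))"
    have e: "e > 0" using C by (simp add: e_def)
    obtain \<mu> where \<mu>: "\<mu> \<in> L" "\<mu> \<noteq> p" "dist \<mu> p < e"
      using p e unfolding islimpt_approachable by blast
    define u where "u = \<mu> - p"
    have u: "u \<noteq> 0" "norm u < e" using \<mu> by (auto simp: u_def dist_norm)
    define h where "h = (\<lambda>z. fact j / u ^ j * (exp ((p + u) * z) - (\<Sum>i<j. u ^ i / fact i * (z ^ i * exp (p * z)))))"
    have "(\<lambda>z. (fact j / u ^ j) * (exp (\<mu> * z) + (-1) * (\<Sum>i<j. u ^ i / fact i * (z ^ i * exp (p * z)))))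
       \<in> exp_span_closure L"
      using less.IH \<mu>(1)
      by (intro exp_span_closure_cmult exp_span_closure_add exp_span_closure_sum
          exp_span_subset_closure[OF exp_mem_exp_span]) auto
    then have h: "h \<in> exp_span_closure L" by (simp add: h_def u_def)
    have "dist (h z) (z ^ j * exp (p * z)) < 1 / (real k + 1)" if "z \<in> cball 0 (real k)" for z
    proof -
      have "norm u * (C + 1) < 1 / (real k + 1) / (C + 1) * (C + 1)"
        using C u(2) by (intro mult_strict_right_mono) (auto simp: e_def)
      also have "\<dots> = 1 / (real k + 1)" using C by simp
      finally have "norm u * C + norm u < 1 / (real k + 1)" by (simp add: distrib_left)
      moreover have "dist (h z) (z ^ j * exp (p * z)) \<le> norm u * C"
        unfolding dist_norm h_def C_def
        by (rule exp_remainder_bound) (use u that in \<open>auto simp: e_def\<close>)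
      ultimately show ?thesis using norm_ge_zero[of u] by linarith
    qed
    then have "h \<in> near (\<lambda>z. z ^ j * exp (p * z)) k"
      using exp_span_closure_entire[OF h] by (simp add: near_def)
    with h show "near (\<lambda>z. z ^ j * exp (p * z)) k \<inter> exp_span_closure L \<noteq> {}" by blast
  qed
qed

lemma entire_taylor_uniform_limit:
  assumes f: "f holomorphic_on UNIV"
  shows "uniform_limit (cball 0 (real k)) (\<lambda>n z. \<Sum>i<n. taylor_coeff f i * z ^ i) f sequentially"
proof -
  define r where "r = real k + 1"
  have r: "r > 0" "real k / r < 1" by (auto simp: r_def)
  obtain B where B: "\<And>w. w \<in> cball 0 r \<Longrightarrow> norm (f w) \<le> B"
    using entire_bounded_cball[OF f] by blast
  have "norm ((deriv ^^ n) f 0) \<le> fact n * B / r ^ n" for n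
    using r B by (intro Cauchy_inequality entire_on[OF f] entire_cont[OF f]) auto
  then have tc: "norm (taylor_coeff f n) \<le> B / r ^ n" for n
    by (simp add: taylor_coeff_def norm_divide field_simps)
  have "uniform_limit (cball 0 (real k)) (\<lambda>n z. \<Sum>i<n. taylor_coeff f i * z ^ i)
     (\<lambda>z. suminf (\<lambda>i. taylor_coeff f i * z ^ i)) sequentially"
  proof (rule Weierstrass_m_test)
    fix n and z :: complex assume z: "z \<in> cball 0 (real k)"
    have "norm (taylor_coeff f n) * norm z ^ n \<le> B / r ^ n * real k ^ n"
      using tc[of n] z order_trans[OF norm_ge_zero tc[of n]] by (intro mult_mono power_mono) auto
    then show "norm (taylor_coeff f n * z ^ n) \<le> B * (real k / r) ^ n"
      by (simp add: norm_mult norm_power power_divide)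
  next
    show "summable (\<lambda>n. B * (real k / r) ^ n)"
      using r by (intro summable_mult summable_geometric) auto
  qed
  moreover have "suminf (\<lambda>i. taylor_coeff f i * z ^ i) = f z" for z
  proof -
    have "(\<lambda>n. (deriv ^^ n) f 0 / fact n * (z - 0) ^ n) sums f z"
      by (rule holomorphic_power_series[of _ _ "norm z + 1"]) (use entire_on[OF f] in auto)
    then show ?thesis by (simp add: taylor_coeff_def sums_iff)
  qed
  ultimately show ?thesis by simp
qed

text \<open>
  Multiplication by \<open>exp (p * z)\<close> turns the Taylor polynomials of \<open>f z * exp (- p * z)\<close> into
  approximations of \<open>f\<close>, and they are combinations of the functions \<open>z ^ j * exp (p * z)\<close>.
\<close>

proposition exp_span_dense:
  assumes p: "p islimpt L" and f: "f holomorphic_on UNIV"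
  shows "near f k \<inter> exp_span L \<noteq> {}"
proof -
  define g where "g = (\<lambda>z. f z * exp (- p * z))"
  have g: "g holomorphic_on UNIV" unfolding g_def by (intro holomorphic_intros f)
  have "f \<in> exp_span_closure L"
  proof (rule exp_span_closure_closed[OF f])
    fix k :: nat
    define C where "C = exp (norm p * real k)"
    have C: "C > 0" by (simp add: C_def)
    have "\<forall>\<^sub>F n in sequentially. \<forall>z\<in>cball 0 (real k). dist (\<Sum>i<n. taylor_coeff g i * z ^ i) (g z) < 1 / (real k + 1) / C"
      using entire_taylor_uniform_limit[OF g, of k] C by (intro uniform_limitD) auto
    then obtain n where n: "\<And>z. z \<in> cball 0 (real k) \<Longrightarrow> dist (\<Sum>i<n. taylor_coeff g i * z ^ i) (g z) < 1 / (real k + 1) / C"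
      unfolding eventually_sequentially by blast
    define h where "h = (\<lambda>z. \<Sum>i<n. taylor_coeff g i * (z ^ i * exp (p * z)))"
    have h: "h \<in> exp_span_closure L"
      unfolding h_def by (intro exp_span_closure_sum monomial_exp_mem_closure p) auto
    have "dist (h z) (f z) < 1 / (real k + 1)" if "z \<in> cball 0 (real k)" for z
    proof -
      have "h z = exp (p * z) * (\<Sum>i<n. taylor_coeff g i * z ^ i)"
        unfolding h_def sum_distrib_left by (intro sum.cong) auto
      moreover have "f z = exp (p * z) * g z" by (simp add: g_def exp_minus)
      ultimately have "dist (h z) (f z) = norm (exp (p * z)) * dist (\<Sum>i<n. taylor_coeff g i * z ^ i) (g z)"
        by (simp add: dist_norm norm_mult right_diff_distrib[symmetric] del: norm_exp_eq_Re)
      also have "\<dots> \<le> C * dist (\<Sum>i<n. taylor_coeff g i * z ^ i) (g z)"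
      proof (rule mult_right_mono)
        have "norm (p * z) \<le> norm p * real k" using that by (simp add: norm_mult mult_left_mono)
        then show "norm (exp (p * z)) \<le> C"
          unfolding C_def by (meson norm_exp exp_le_cancel_iff order_trans)
      qed auto
      also have "\<dots> < C * (1 / (real k + 1) / C)"
        using n[OF that] C by (intro mult_strict_left_mono) auto
      also have "\<dots> = 1 / (real k + 1)" using C by simp
      finally show ?thesis .
    qed
    then have "h \<in> near f k" using exp_span_closure_entire[OF h] by (simp add: near_def)
    with h show "near f k \<inter> exp_span_closure L \<noteq> {}" by blast
  qed
  then show ?thesis by (simp add: exp_span_closure_def)
qed

text \<open>
  The set consists of the polynomials whose coefficients lie in a countable dense set of numbers.
\<close>

lemma entire_separable:
  obtains D :: "(complex \<Rightarrow> complex) set" where "countable D" "\<And>d. d \<in> D \<Longrightarrow> d holomorphic_on UNIV"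
    "\<And>f k. f holomorphic_on UNIV \<Longrightarrow> near f k \<inter> D \<noteq> {}"
proof -
  obtain Q :: "complex set" where Q: "countable Q" "\<And>X. open X \<Longrightarrow> X \<noteq> {} \<Longrightarrow> \<exists>d\<in>Q. d \<in> X"
    using countable_dense_setE by blast
  define ev where "ev = (\<lambda>xs. \<lambda>z::complex. \<Sum>i<length xs. xs ! i * z ^ i)"
  show thesis
  proof (rule that[of "ev ` lists Q"])
    show "countable (ev ` lists Q)" using Q(1) by auto
    show "d holomorphic_on UNIV" if "d \<in> ev ` lists Q" for d
      using that by (auto simp: ev_def intro!: holomorphic_intros)
    fix f :: "complex \<Rightarrow> complex" and k
    assume f: "f holomorphic_on UNIV"
    define e where "e = 1 / (real k + 1) / 2"
    have e: "e > 0" "e + e = 1 / (real k + 1)" by (auto simp: e_def field_simps)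
    have "\<forall>\<^sub>F n in sequentially. \<forall>z\<in>cball 0 (real k). dist (\<Sum>i<n. taylor_coeff f i * z ^ i) (f z) < e"
      using entire_taylor_uniform_limit[OF f, of k] e by (intro uniform_limitD) auto
    then obtain n where n: "\<And>z. z \<in> cball 0 (real k) \<Longrightarrow> dist (\<Sum>i<n. taylor_coeff f i * z ^ i) (f z) < e"
      unfolding eventually_sequentially by blast
    \<comment> \<open>coefficients within \<open>r\<close> change the polynomial by at most \<open>e\<close> on the disc\<close>
    define r where "r = e / ((\<Sum>i<n. real k ^ i) + 1)"
    have S: "0 \<le> (\<Sum>i<n. real k ^ i)" by (intro sum_nonneg) auto
    have r: "r > 0" using e S by (simp add: r_def)
    have "\<exists>q\<in>Q. q \<in> ball (taylor_coeff f i) r" for i by (rule Q(2)) (use r in auto)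
    then obtain q where q: "\<And>i. q i \<in> Q" "\<And>i. q i \<in> ball (taylor_coeff f i) r" by metis
    have "dist (\<Sum>i<n. q i * z ^ i) (f z) < 1 / (real k + 1)" if z: "z \<in> cball 0 (real k)" for z
    proof -
      have "dist (\<Sum>i<n. q i * z ^ i) (\<Sum>i<n. taylor_coeff f i * z ^ i) = norm (\<Sum>i<n. (q i - taylor_coeff f i) * z ^ i)"
        by (simp add: dist_norm sum_subtractf[symmetric] left_diff_distrib)
      also have "\<dots> \<le> (\<Sum>i<n. r * real k ^ i)"
      proof (rule sum_norm_le)
        fix i
        have "norm (q i - taylor_coeff f i) < r" using q(2)[of i] by (simp add: dist_norm norm_minus_commute)
        then show "norm ((q i - taylor_coeff f i) * z ^ i) \<le> r * real k ^ i"
          using z r unfolding norm_mult norm_power by (intro mult_mono power_mono) auto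
      qed
      also have "\<dots> = r * (\<Sum>i<n. real k ^ i)" by (simp add: sum_distrib_left)
      also have "\<dots> \<le> r * ((\<Sum>i<n. real k ^ i) + 1)" using r by simp
      also have "\<dots> = e" using S by (simp add: r_def)
      finally show ?thesis
        using n[OF z] e(2) dist_triangle[of "\<Sum>i<n. q i * z ^ i" "f z" "\<Sum>i<n. taylor_coeff f i * z ^ i"] by linarith
    qed
    moreover have "ev (map q [0..<n]) = (\<lambda>z. \<Sum>i<n. q i * z ^ i)" by (simp add: ev_def)
    moreover have "(\<lambda>z. \<Sum>i<n. q i * z ^ i) holomorphic_on UNIV" by (intro holomorphic_intros)
    ultimately have "ev (map q [0..<n]) \<in> near f k" by (simp add: near_def)
    moreover have "ev (map q [0..<n]) \<in> ev ` lists Q" using q(1) by (intro imageI) auto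
    ultimately show "near f k \<inter> ev ` lists Q \<noteq> {}" by blast
  qed
qed

section \<open>Geometry of the level arc\<close>

text \<open>
  The maximum principle in the form in which it is used: \<open>\<Phi>\<close> is open.
\<close>

lemma entire_modulus_exceeds:
  assumes "\<Phi> holomorphic_on UNIV" "\<not> \<Phi> constant_on UNIV" "open U" "q \<in> U" "\<Phi> q \<noteq> 0"
  shows "\<exists>z\<in>U. norm (\<Phi> z) > norm (\<Phi> q)"
proof -
  have "open (\<Phi> ` U)"
    by (rule open_mapping_thm[OF assms(1)]) (use assms in auto)
  then obtain e where e: "e > 0" "ball (\<Phi> q) e \<subseteq> \<Phi> ` U"
    using assms(4) open_contains_ball by blast
  define s where "s = e / (2 * norm (\<Phi> q))"
  have s: "s > 0" using e(1) assms(5) by (simp add: s_def)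
  have "dist (\<Phi> q) (\<Phi> q + of_real s * \<Phi> q) = e / 2"
    using s assms(5) unfolding dist_norm by (simp add: norm_mult) (simp add: s_def)
  then have "\<Phi> q + of_real s * \<Phi> q \<in> \<Phi> ` U" using e by auto
  then obtain z where z: "z \<in> U" "\<Phi> z = \<Phi> q + of_real s * \<Phi> q" by auto
  have "\<Phi> z = of_real (1 + s) * \<Phi> q" by (simp add: z(2) algebra_simps)
  then have "norm (\<Phi> z) = (1 + s) * norm (\<Phi> q)"
    using s by (simp only: norm_mult norm_of_real)
  also have "\<dots> > norm (\<Phi> q)" using s assms(5) by (simp add: algebra_simps)
  finally show ?thesis using z(1) by blast
qed

text \<open>
  If the interior is empty then \<open>K\<close> lies in a hyperplane, whose normal vector is the functional.
\<close>

lemma supporting_functional: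
  fixes K :: "'a::euclidean_space set"
  assumes "convex K" "q \<in> K" "q \<notin> interior K"
  obtains a where "a \<noteq> 0" "\<And>y. y \<in> K \<Longrightarrow> a \<bullet> y \<le> a \<bullet> q"
proof (cases "interior K = {}")
  case True
  obtain a b where "a \<noteq> 0" "K \<subseteq> {x. a \<bullet> x = b}"
    by (rule empty_interior_subset_hyperplane[OF assms(1) True])
  then have "a \<bullet> y = b" if "y \<in> K" for y using that by auto
  then show thesis using \<open>a \<noteq> 0\<close> assms(2) by (intro that[of a]) auto
next
  case False
  then have "q \<notin> rel_interior K" using assms(3) by (simp add: rel_interior_nonempty_interior)
  moreover have "q \<in> closure K" using assms(2) closure_subset[of K] by auto
  ultimately obtain a where a: "a \<noteq> 0" "\<And>y. y \<in> closure K \<Longrightarrow> a \<bullet> q \<le> a \<bullet> y"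
    using supporting_hyperplane_relative_frontier[OF assms(1), of q thesis] by metis
  have "(- a) \<bullet> y \<le> (- a) \<bullet> q" if "y \<in> K" for y
    using a(2)[of y] that closure_subset[of K] by auto
  then show thesis using a(1) by (intro that[of "- a"]) auto
qed

lemma strictly_convex_arc_no_three_on_line:
  assumes "strictly_convex_arc \<Gamma>" "a \<noteq> 0" "x \<in> \<Gamma>" "y \<in> \<Gamma>" "z \<in> \<Gamma>"
    "a \<bullet> x = b" "a \<bullet> y = b" "a \<bullet> z = b"
  shows "x = y \<or> y = z \<or> z = x"
proof -
  have "aff_dim {u. a \<bullet> u = b} \<le> 1" using assms(2) by simp
  then have "collinear {u. a \<bullet> u = b}" by (simp only: collinear_aff_dim)
  then have "collinear {x, y, z}" by (rule collinear_subset) (use assms in auto)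
  then have "x \<in> closed_segment y z \<or> y \<in> closed_segment z x \<or> z \<in> closed_segment x y"
    by (simp add: collinear_between_cases between_mem_segment)
  moreover have "u = v \<or> u = w" if "u \<in> closed_segment v w" "u \<in> \<Gamma>" "v \<in> \<Gamma>" "w \<in> \<Gamma>" for u v w
    using assms(1) that unfolding strictly_convex_arc_def by blast
  ultimately show ?thesis using assms(3-5) by blast
qed

lemma inner_rotated_decomposition:
  fixes a u y :: complex
  assumes "a \<bullet> y = 0"
  shows "(norm y)\<^sup>2 * (a \<bullet> u) = (a \<bullet> (\<i> * y)) * ((\<i> * y) \<bullet> u)"
proof -
  have "(norm y)\<^sup>2 * (a \<bullet> u) = (a \<bullet> (\<i> * y)) * ((\<i> * y) \<bullet> u) + (a \<bullet> y) * (y \<bullet> u)"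
    unfolding cmod_power2 by (simp add: inner_complex_def power2_eq_square algebra_simps)
  with assms show ?thesis by simp
qed

text \<open>
  A point of the arc that has another point of the arc strictly between itself and the origin. These
  are the only points that spoil the rigidity of convex combinations, because that other point is a
  convex combination of the origin and the outer one. There are finitely many of them, so they can be
  discarded.
\<close>

definition radially_doubled :: "complex set \<Rightarrow> complex set" where
  "radially_doubled \<Gamma> = {y \<in> \<Gamma>. \<exists>t>0. t < 1 \<and> t *\<^sub>R y \<in> \<Gamma>}"

locale convex_level_arc =
  fixes \<Phi> :: "complex \<Rightarrow> complex" and \<Gamma> :: "complex set"
  assumes entire: "\<Phi> holomorphic_on UNIV"
    and at_zero: "norm (\<Phi> 0) < 1"
    and strictly_convex: "strictly_convex_arc \<Gamma>"
    and level: "\<Gamma> \<subseteq> {z. norm (\<Phi> z) = 1}"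
    and hull: "convex hull (\<Gamma> \<union> {0}) - \<Gamma> \<subseteq> \<Phi> -` ball 0 1"
begin

lemma zero_notin: "0 \<notin> \<Gamma>"
  using at_zero level by auto

lemma modulus_exceeds:
  assumes "q \<in> \<Gamma>" "open U" "q \<in> U"
  shows "\<exists>z\<in>U. norm (\<Phi> z) > 1"
proof -
  have q: "norm (\<Phi> q) = 1" using level assms(1) by auto
  have "\<not> \<Phi> constant_on UNIV"
    using q at_zero unfolding constant_on_def by force
  from entire_modulus_exceeds[OF entire this assms(2,3)] q show ?thesis by force
qed

text \<open>
  On the convex hull of the arc and the origin the modulus of \<open>\<Phi>\<close> is at most one, and it equals one
  on the arc. By the maximum principle the arc lies in the boundary of that hull. The last inequality
  says that the origin lies on the same side of the line.
\<close>

lemma supporting_line: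
  assumes "q \<in> \<Gamma>"
  obtains a where "a \<noteq> 0" "\<And>y. y \<in> \<Gamma> \<Longrightarrow> a \<bullet> y \<le> a \<bullet> q" "0 \<le> a \<bullet> q"
proof -
  let ?K = "convex hull (\<Gamma> \<union> {0})"
  have sub: "\<Gamma> \<union> {0} \<subseteq> ?K" by (rule hull_subset)
  have le: "norm (\<Phi> z) \<le> 1" if "z \<in> ?K" for z
  proof (cases "z \<in> \<Gamma>")
    case True then show ?thesis using level by auto
  next
    case False then show ?thesis using hull that by (force intro: less_imp_le)
  qed
  have "q \<notin> interior ?K"
  proof
    assume "q \<in> interior ?K"
    then obtain z where "z \<in> interior ?K" "norm (\<Phi> z) > 1"
      using modulus_exceeds[OF assms open_interior] by blast
    then show False using le[of z] interior_subset[of ?K] by auto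
  qed
  moreover have "q \<in> ?K" using sub assms by blast
  ultimately obtain a where a: "a \<noteq> 0" "\<And>y. y \<in> ?K \<Longrightarrow> a \<bullet> y \<le> a \<bullet> q"
    using supporting_functional[OF convex_convex_hull] by blast
  then show thesis
    using sub a(2)[of 0] by (intro that[of a]) auto
qed

text \<open>
  The supporting line at the inner point has both the origin and the outer point \<open>y\<close> on it, so it is
  the line through \<open>y\<close> and the origin, and \<open>\<Gamma>\<close> lies on one side of it. If two such points \<open>y\<close> and \<open>y'\<close>
  had the arc on the same side, left or right as seen from the origin, then each would lie on the line of the other, and the arc would have
  three points on one line. Hence the side determines the point.
\<close>

lemma finite_radially_doubled: "finite (radially_doubled \<Gamma>)"
proof -
  have "\<exists>a. a \<noteq> 0 \<and> a \<bullet> y = 0 \<and> (\<forall>u\<in>\<Gamma>. a \<bullet> u \<le> 0)" if "y \<in> radially_doubled \<Gamma>" for y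
  proof -
    obtain t where t: "0 < t" "t < 1" "t *\<^sub>R y \<in> \<Gamma>" and y: "y \<in> \<Gamma>"
      using \<open>y \<in> radially_doubled \<Gamma>\<close> unfolding radially_doubled_def by auto
    obtain a where a: "a \<noteq> 0" "\<And>u. u \<in> \<Gamma> \<Longrightarrow> a \<bullet> u \<le> a \<bullet> (t *\<^sub>R y)" "0 \<le> a \<bullet> (t *\<^sub>R y)"
      using supporting_line[OF t(3)] by blast
    have "0 \<le> a \<bullet> y" using a(3) t(1) by (simp add: zero_le_mult_iff)
    moreover have "(1 - t) * (a \<bullet> y) \<le> 0" using a(2)[OF y] by (simp add: algebra_simps)
    then have "a \<bullet> y \<le> 0" using t(2) by (simp add: mult_le_0_iff)
    ultimately have "a \<bullet> y = 0" by simp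
    then show ?thesis using a by (intro exI[of _ a]) auto
  qed
  then obtain A where A: "\<And>y. y \<in> radially_doubled \<Gamma> \<Longrightarrow> A y \<noteq> 0"
    "\<And>y. y \<in> radially_doubled \<Gamma> \<Longrightarrow> A y \<bullet> y = 0"
    "\<And>y u. y \<in> radially_doubled \<Gamma> \<Longrightarrow> u \<in> \<Gamma> \<Longrightarrow> A y \<bullet> u \<le> 0"
    by metis
  \<comment> \<open>since \<open>A y\<close> is orthogonal to \<open>y\<close>, the sign of \<open>\<sigma> y\<close> tells on which side of the line the arc lies\<close>
  define \<sigma> where "\<sigma> = (\<lambda>y. A y \<bullet> (\<i> * y))"
  have nz: "y \<noteq> 0" if "y \<in> radially_doubled \<Gamma>" for y
    using that zero_notin by (auto simp: radially_doubled_def)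
  have same_line: "y = y'" if "y \<in> radially_doubled \<Gamma>" "y' \<in> radially_doubled \<Gamma>" "A y \<bullet> y' = 0" for y y'
  proof -
    obtain t where t: "0 < t" "t < 1" "t *\<^sub>R y \<in> \<Gamma>" "y \<in> \<Gamma>"
      using \<open>y \<in> radially_doubled \<Gamma>\<close> unfolding radially_doubled_def by auto
    obtain t' where t': "0 < t'" "t' < 1" "t' *\<^sub>R y' \<in> \<Gamma>" "y' \<in> \<Gamma>"
      using \<open>y' \<in> radially_doubled \<Gamma>\<close> unfolding radially_doubled_def by auto
    have ne: "t *\<^sub>R y \<noteq> y" "t' *\<^sub>R y' \<noteq> y'"
      using t(2) t'(2) nz[OF that(1)] nz[OF that(2)] scaleR_cancel_right[of t y 1] scaleR_cancel_right[of t' y' 1] by auto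
    have "y = y' \<or> t *\<^sub>R y = y'"
      using strictly_convex_arc_no_three_on_line[OF strictly_convex A(1)[OF that(1)] t(4) t(3) t'(4), of 0]
        A(2)[OF that(1)] that(3) ne by auto
    moreover have "y = y' \<or> t' *\<^sub>R y' = y"
      using strictly_convex_arc_no_three_on_line[OF strictly_convex A(1)[OF that(1)] t'(4) t'(3) t(4), of 0]
        A(2)[OF that(1)] that(3) ne by auto
    moreover have False if "t *\<^sub>R y = y'" "t' *\<^sub>R y' = y"
    proof -
      have "(t' * t) *\<^sub>R y = 1 *\<^sub>R y" using that by (metis scaleR_scaleR scaleR_one)
      then have "t' * t = 1" using nz[OF \<open>y \<in> radially_doubled \<Gamma>\<close>] by (simp only: scaleR_cancel_right) simp
      moreover have "t' * t < 1 * 1" using t t' by (intro mult_strict_mono) auto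
      ultimately show False by simp
    qed
    ultimately show ?thesis by blast
  qed
  have "inj_on (\<lambda>y. sgn (\<sigma> y)) (radially_doubled \<Gamma>)"
  proof (rule inj_onI)
    fix y y' assume y: "y \<in> radially_doubled \<Gamma>" and y': "y' \<in> radially_doubled \<Gamma>"
      and eq: "sgn (\<sigma> y) = sgn (\<sigma> y')"
    have mem: "y \<in> \<Gamma>" "y' \<in> \<Gamma>" using y y' by (auto simp: radially_doubled_def)
    define c where "c = (\<i> * y) \<bullet> y'"
    have c': "(\<i> * y') \<bullet> y = - c" by (simp add: c_def inner_complex_def)
    have d: "(norm y)\<^sup>2 * (A y \<bullet> y') = \<sigma> y * c"
      unfolding \<sigma>_def c_def by (rule inner_rotated_decomposition[OF A(2)[OF y]])
    have d': "(norm y')\<^sup>2 * (A y' \<bullet> y) = \<sigma> y' * - c"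
      unfolding \<sigma>_def c'[symmetric] by (rule inner_rotated_decomposition[OF A(2)[OF y']])
    have s: "\<sigma> y * c \<le> 0" unfolding d[symmetric] using A(3)[OF y mem(2)] by (intro mult_nonneg_nonpos) auto
    have s': "\<sigma> y' * - c \<le> 0" unfolding d'[symmetric] using A(3)[OF y' mem(1)] by (intro mult_nonneg_nonpos) auto
    have "\<sigma> y * c = 0"
      using s s' eq by (auto simp: mult_le_0_iff zero_le_mult_iff sgn_if split: if_splits)
    with d have "(norm y)\<^sup>2 * (A y \<bullet> y') = 0" by (simp only:)
    then have "A y \<bullet> y' = 0" using nz[OF y] by simp
    then show "y = y'" using same_line y y' by blast
  qed
  moreover have "(\<lambda>y. sgn (\<sigma> y)) ` radially_doubled \<Gamma> \<subseteq> {-1, 0, 1}" by (auto simp: sgn_if)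
  ultimately show ?thesis by (rule inj_on_finite) simp
qed

text \<open>
  A convex combination that lands on the arc lives on the supporting line at that point, which meets
  the arc in at most one further point. If that further point \<open>r\<close> occurs, then \<open>q\<close> is a multiple of \<open>r\<close>
  by a factor smaller than one, so that \<open>r\<close> is radially doubled. The missing weight
  \<open>1 - sum w X\<close> sits at the origin.
\<close>

lemma convex_combination_on_arc:
  fixes w :: "'x \<Rightarrow> real"
  assumes X: "finite X" and w: "\<And>x. x \<in> X \<Longrightarrow> w x > 0" "sum w X \<le> 1"
    and p: "\<And>x. x \<in> X \<Longrightarrow> p x \<in> insert 0 (\<Gamma> - radially_doubled \<Gamma>)"
    and q: "(\<Sum>x\<in>X. w x *\<^sub>R p x) \<in> \<Gamma>"
  shows "sum w X = 1 \<and> (\<exists>c\<in>\<Gamma>. \<forall>x\<in>X. p x = c)"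
proof -
  define q where "q = (\<Sum>x\<in>X. w x *\<^sub>R p x)"
  have qG: "q \<in> \<Gamma>" using assms(5) by (simp add: q_def)
  then have q0: "q \<noteq> 0" using zero_notin by auto
  obtain a where a: "a \<noteq> 0" "\<And>y. y \<in> \<Gamma> \<Longrightarrow> a \<bullet> y \<le> a \<bullet> q" "0 \<le> a \<bullet> q"
    using supporting_line[OF qG] by blast
  have le: "a \<bullet> p x \<le> a \<bullet> q" if "x \<in> X" for x using a(2,3) p[OF that] by auto
  have nonneg: "0 \<le> w x * (a \<bullet> q - a \<bullet> p x)" if "x \<in> X" for x
    using w(1)[OF that] le[OF that] by (intro mult_nonneg_nonneg) auto
  have "(\<Sum>x\<in>X. w x * (a \<bullet> q - a \<bullet> p x)) = sum w X * (a \<bullet> q) - a \<bullet> q"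
    by (simp add: right_diff_distrib sum_subtractf sum_distrib_right q_def inner_sum_right)
  moreover have "sum w X * (a \<bullet> q) \<le> 1 * (a \<bullet> q)" using w(2) a(3) by (rule mult_right_mono)
  moreover have "(\<Sum>x\<in>X. w x * (a \<bullet> q - a \<bullet> p x)) \<ge> 0"
    using nonneg by (intro sum_nonneg) auto
  ultimately have "(\<Sum>x\<in>X. w x * (a \<bullet> q - a \<bullet> p x)) = 0" by linarith
  then have "\<forall>x\<in>X. w x * (a \<bullet> q - a \<bullet> p x) = 0"
    using sum_nonneg_eq_0_iff[OF X, of "\<lambda>x. w x * (a \<bullet> q - a \<bullet> p x)"] nonneg by blast
  then have on_line: "a \<bullet> p x = a \<bullet> q" if "x \<in> X" for x using w(1)[OF that] that by fastforce
  \<comment> \<open>the total weight that the combination puts on the point \<open>c\<close>\<close>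
  define S where "S = (\<lambda>c. sum w {x \<in> X. p x = c})"
  have S_nonneg: "S c \<ge> 0" for c unfolding S_def using w(1) by (intro sum_nonneg) (auto intro: less_imp_le)
  have S_pos: "S (p x) > 0" if "x \<in> X" for x
    unfolding S_def using w(1) X that by (intro sum_pos) auto
  have collect: "S c + S d \<le> 1" if "c \<noteq> d" for c d
  proof -
    have "S c + S d = sum w ({x \<in> X. p x = c} \<union> {x \<in> X. p x = d})"
      unfolding S_def using X that by (intro sum.union_disjoint[symmetric]) auto
    also have "\<dots> \<le> sum w X" using X w(1) by (intro sum_mono2) (auto intro: less_imp_le)
    finally show ?thesis using w(2) by linarith
  qed
  have split: "q = S q *\<^sub>R q + S r *\<^sub>R r" if r: "r \<noteq> q" "\<And>x. x \<in> X \<Longrightarrow> p x \<in> {0, q, r}" for r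
  proof -
    have "(\<Sum>x\<in>X. w x *\<^sub>R p x) = (\<Sum>x\<in>{x \<in> X. p x = q} \<union> {x \<in> X. p x = r}. w x *\<^sub>R p x)"
      using X r(2) by (intro sum.mono_neutral_right) auto
    also have "\<dots> = (\<Sum>x\<in>{x \<in> X. p x = q}. w x *\<^sub>R p x) + (\<Sum>x\<in>{x \<in> X. p x = r}. w x *\<^sub>R p x)"
      using X r(1) by (intro sum.union_disjoint) auto
    also have "\<dots> = S q *\<^sub>R q + S r *\<^sub>R r" by (simp add: S_def scaleR_left.sum)
    finally show ?thesis by (simp add: q_def)
  qed
  have no_other: "r = q" if x: "x \<in> X" "p x = r" "r \<noteq> 0" for x r
  proof (rule ccontr)
    assume rq: "r \<noteq> q"
    have rG: "r \<in> \<Gamma>" "r \<notin> radially_doubled \<Gamma>" using p[OF x(1)] x(2,3) by auto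
    have "p x' \<in> {0, q, r}" if "x' \<in> X" for x'
    proof (cases "p x' = 0")
      case False
      then have "p x' \<in> \<Gamma>" using p[OF that] by auto
      from strictly_convex_arc_no_three_on_line[OF strictly_convex a(1) this qG rG(1)
          on_line[OF that] refl] on_line[OF x(1)] x(2) rq show ?thesis by auto
    qed auto
    from split[OF rq this] have "(1 - S q) *\<^sub>R q = S r *\<^sub>R r" by (simp add: algebra_simps)
    moreover have Sr: "S r > 0" using S_pos[OF x(1)] x(2) by simp
    moreover have c: "S q + S r \<le> 1" using collect[of q r] rq by auto
    ultimately have qr: "q = (S r / (1 - S q)) *\<^sub>R r"
      by (smt (verit, best) divide_inverse_commute scaleR_scaleR scaleR_one left_inverse)
    moreover have "S r / (1 - S q) > 0" using Sr c by simp
    moreover have "S r / (1 - S q) < 1"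
    proof -
      have "S r / (1 - S q) \<le> 1" using Sr c by simp
      moreover have "S r / (1 - S q) \<noteq> 1" using qr rq by auto
      ultimately show ?thesis by (simp only: less_le simp_thms)
    qed
    ultimately have "r \<in> radially_doubled \<Gamma>"
      unfolding radially_doubled_def using rG(1) qG by (intro CollectI conjI exI[of _ "S r / (1 - S q)"]) auto
    with rG(2) show False by simp
  qed
  have "p x \<in> {0, q, 0}" if "x \<in> X" for x using no_other[OF that] by auto
  from split[OF _ this] q0 have "q = S q *\<^sub>R q" by simp
  then have Sq: "S q = 1" using q0 by (metis scaleR_cancel_right scaleR_one)
  have "p x = q" if "x \<in> X" for x
  proof (rule ccontr)
    assume "p x \<noteq> q"
    then have "S q + S (p x) \<le> 1" using collect[of q "p x"] by auto
    with S_pos[OF that] Sq show False by simp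
  qed
  moreover from this have "S q = sum w X" unfolding S_def by (intro sum.cong) auto
  ultimately show ?thesis using Sq qG by auto
qed

lemma modulus_convex_combination:
  fixes w :: "'x \<Rightarrow> real"
  assumes X: "finite X" and w: "\<And>x. x \<in> X \<Longrightarrow> w x > 0" "sum w X \<le> 1"
    and p: "\<And>x. x \<in> X \<Longrightarrow> p x \<in> insert 0 (\<Gamma> - radially_doubled \<Gamma>)"
    and not_pure: "\<not> (sum w X = 1 \<and> (\<exists>c\<in>\<Gamma>. \<forall>x\<in>X. p x = c))"
  shows "norm (\<Phi> (\<Sum>x\<in>X. w x *\<^sub>R p x)) < 1"
proof -
  let ?q = "\<Sum>x\<in>X. w x *\<^sub>R p x"
  let ?K = "convex hull (\<Gamma> \<union> {0})"
  have "?q \<notin> \<Gamma>" using convex_combination_on_arc[of X w p] X w p not_pure by blast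
  moreover have "?q \<in> ?K"
  proof -
    have sub: "\<Gamma> \<union> {0} \<subseteq> ?K" by (rule hull_subset)
    have pK: "p x \<in> ?K" if "x \<in> X" for x using p[OF that] sub by auto
    \<comment> \<open>the index \<open>None\<close> carries the remaining weight at the origin\<close>
    define w' where "w' = (\<lambda>y. case y of None \<Rightarrow> 1 - sum w X | Some x \<Rightarrow> w x)"
    define p' where "p' = (\<lambda>y. case y of None \<Rightarrow> 0 | Some x \<Rightarrow> p x)"
    have "(\<Sum>y\<in>insert None (Some ` X). w' y *\<^sub>R p' y) \<in> ?K"
    proof (rule convex_sum)
      show "sum w' (insert None (Some ` X)) = 1"
        using X by (simp add: w'_def sum.reindex)
      show "w' i \<ge> 0" if "i \<in> insert None (Some ` X)" for i
        using that w by (auto simp: w'_def intro: less_imp_le)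
      show "p' i \<in> ?K" if "i \<in> insert None (Some ` X)" for i
        using that pK sub by (auto simp: p'_def)
    qed (use X in \<open>auto simp: convex_convex_hull\<close>)
    moreover have "(\<Sum>y\<in>insert None (Some ` X). w' y *\<^sub>R p' y) = ?q"
      using X by (simp add: w'_def p'_def sum.reindex)
    ultimately show ?thesis by simp
  qed
  ultimately show ?thesis using hull by auto
qed

lemma limit_point:
  assumes "nontrivial_compact_arc \<Gamma>"
  shows "\<exists>p. p islimpt (\<Gamma> - radially_doubled \<Gamma>)"
proof -
  obtain g where g: "arc g" "path_image g = \<Gamma>" using assms unfolding nontrivial_compact_arc_def by blast
  have "infinite {0..1::real}" by (rule infinite_Icc) simp
  then have "infinite \<Gamma>"
    using g finite_imageD[of g "{0..1}"] unfolding arc_def path_image_def by blast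
  then have "infinite (\<Gamma> - radially_doubled \<Gamma>)" using finite_radially_doubled by simp
  moreover have "compact \<Gamma>" using g compact_arc_image by blast
  ultimately show ?thesis
    using Heine_Borel_imp_Bolzano_Weierstrass[of \<Gamma> "\<Gamma> - radially_doubled \<Gamma>"] by blast
qed

end

section \<open>Leading exponents and limits of exponential sums\<close>

text \<open>
  A lexicographically largest exponent, encoded by weights: each new coordinate receives a weight that
  exceeds the total contribution of all previous ones. All weights are positive, which is needed to
  make every correction term of the construction tend to zero.
\<close>

lemma leading_exponent:
  fixes A :: "('i \<Rightarrow> nat) set"
  assumes "finite J" "finite A" "A \<noteq> {}" "\<And>e i. e \<in> A \<Longrightarrow> i \<notin> J \<Longrightarrow> e i = 0"
  shows "\<exists>w :: 'i \<Rightarrow> real. (\<forall>i. w i > 0) \<and> (\<exists>\<alpha>\<in>A. \<forall>\<beta>\<in>A - {\<alpha>}.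
    (\<Sum>i\<in>J. w i * real (\<beta> i)) < (\<Sum>i\<in>J. w i * real (\<alpha> i)))"
  using assms
proof (induction J arbitrary: A rule: finite_induct)
  case empty
  then obtain \<alpha> where "\<alpha> \<in> A" by blast
  moreover have "\<beta> = \<alpha>" if "\<beta> \<in> A" for \<beta>
    using empty(3)[OF that] empty(3)[OF \<open>\<alpha> \<in> A\<close>] by (intro ext) simp
  ultimately show ?case by (intro exI[of _ "\<lambda>_. 1"]) auto
next
  case (insert j J)
  define d where "d = Max ((\<lambda>e. e j) ` A)"
  have fin: "finite ((\<lambda>e. e j) ` A)" "(\<lambda>e. e j) ` A \<noteq> {}" using insert.prems by auto
  have d_ge: "e j \<le> d" if "e \<in> A" for e unfolding d_def using fin that by (intro Max_ge) auto
  have d_att: "\<exists>e\<in>A. e j = d" using Max_in[OF fin] unfolding d_def[symmetric] by auto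
  define A' where "A' = (\<lambda>e. e(j := 0)) ` {e \<in> A. e j = d}"
  have "\<exists>w :: 'i \<Rightarrow> real. (\<forall>i. w i > 0) \<and> (\<exists>\<alpha>\<in>A'. \<forall>\<beta>\<in>A' - {\<alpha>}.
    (\<Sum>i\<in>J. w i * real (\<beta> i)) < (\<Sum>i\<in>J. w i * real (\<alpha> i)))"
  proof (rule insert.IH)
    show "finite A'" using insert.prems by (simp add: A'_def)
    show "A' \<noteq> {}" using d_att by (auto simp: A'_def)
    show "e i = 0" if "e \<in> A'" "i \<notin> J" for e i
      using that insert.prems(3) by (auto simp: A'_def)
  qed
  then obtain w :: "'i \<Rightarrow> real" and \<alpha>' where w: "\<And>i. w i > 0" and \<alpha>': "\<alpha>' \<in> A'"
    "\<And>\<beta>. \<beta> \<in> A' \<Longrightarrow> \<beta> \<noteq> \<alpha>' \<Longrightarrow> (\<Sum>i\<in>J. w i * real (\<beta> i)) < (\<Sum>i\<in>J. w i * real (\<alpha>' i))"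
    by blast
  obtain \<alpha> where \<alpha>: "\<alpha> \<in> A" "\<alpha> j = d" "\<alpha>' = \<alpha>(j := 0)" using \<alpha>'(1) by (auto simp: A'_def)
  define W where "W = (\<lambda>e :: 'i \<Rightarrow> nat. \<Sum>i\<in>J. w i * real (e i))"
  have W0: "W e \<ge> 0" for e unfolding W_def using w by (intro sum_nonneg mult_nonneg_nonneg) (auto intro: less_imp_le)
  have Wupd: "W (e(j := a)) = W e" for e a unfolding W_def using insert.hyps by (intro sum.cong) auto
  \<comment> \<open>one unit in the new coordinate outweighs everything that the old coordinates can contribute\<close>
  define M where "M = 1 + (\<Sum>e\<in>A. W e)"
  have M: "W e + 1 \<le> M" if "e \<in> A" for e
    unfolding M_def using member_le_sum[OF that, of W] W0 insert.prems by auto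
  have M0: "M > 0" using M[OF \<alpha>(1)] W0[of \<alpha>] by linarith
  define w' where "w' = w(j := M)"
  have tot: "(\<Sum>i\<in>insert j J. w' i * real (e i)) = M * real (e j) + W e" for e
  proof -
    have "(\<Sum>i\<in>J. w' i * real (e i)) = W e"
      unfolding W_def using insert.hyps by (intro sum.cong) (auto simp: w'_def)
    then show ?thesis using insert.hyps by (simp add: w'_def)
  qed
  have "M * real (\<beta> j) + W \<beta> < M * real (\<alpha> j) + W \<alpha>" if \<beta>: "\<beta> \<in> A" "\<beta> \<noteq> \<alpha>" for \<beta>
  proof (cases "\<beta> j = d")
    case True
    have "\<beta>(j := 0) \<noteq> \<alpha>'"
    proof
      assume "\<beta>(j := 0) = \<alpha>'"
      then have "\<beta> i = \<alpha> i" for i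
        using True \<alpha>(2,3) by (cases "i = j") (auto dest: fun_cong[of _ _ i])
      with \<beta>(2) show False by auto
    qed
    moreover have "\<beta>(j := 0) \<in> A'" using \<beta>(1) True by (auto simp: A'_def)
    ultimately have "W (\<beta>(j := 0)) < W \<alpha>'" using \<alpha>'(2) by (simp only: W_def)
    then show ?thesis using True \<alpha>(2) by (simp add: Wupd \<alpha>(3))
  next
    case False
    then have "real (\<beta> j) + 1 \<le> real d" using d_ge[OF \<beta>(1)] by linarith
    then have "M * (real (\<beta> j) + 1) \<le> M * real d" using M0 by (intro mult_left_mono) auto
    then show ?thesis using M[OF \<beta>(1)] W0[of \<alpha>] by (simp add: \<alpha>(2) distrib_left)
  qed
  then have "\<forall>\<beta>\<in>A - {\<alpha>}. (\<Sum>i\<in>insert j J. w' i * real (\<beta> i)) < (\<Sum>i\<in>insert j J. w' i * real (\<alpha> i))"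
    by (simp only: tot) blast
  moreover have "\<forall>i. w' i > 0" using w M0 by (simp add: w'_def)
  ultimately show ?case using \<alpha>(1) by (intro exI[of _ w']) blast
qed

lemma exp_sum_perturbation:
  assumes "finite K" "(\<lambda>z. \<Sum>\<mu>\<in>K. c \<mu> * exp (\<mu> * z)) \<in> near v k" "v holomorphic_on UNIV"
  shows "\<exists>\<delta>>0. \<forall>\<kappa>. (\<forall>\<mu>\<in>K. dist (\<kappa> \<mu>) \<mu> < \<delta>) \<longrightarrow> (\<lambda>z. \<Sum>\<mu>\<in>K. c \<mu> * exp (\<kappa> \<mu> * z)) \<in> near v k"
proof -
  obtain l where l: "near (\<lambda>z. \<Sum>\<mu>\<in>K. c \<mu> * exp (\<mu> * z)) l \<subseteq> near v k"
    using near_absorbs[OF assms(2,3)] by blast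
  define C where "C = (\<lambda>\<mu>::complex. exp (norm \<mu> * real l) * (exp (real l) * real l ^ Suc 0))"
  define S where "S = (\<Sum>\<mu>\<in>K. norm (c \<mu>) * C \<mu>)"
  have S: "S \<ge> 0" unfolding S_def C_def by (intro sum_nonneg) auto
  define \<delta> where "\<delta> = min 1 (1 / (real l + 1) / (S + 1))"
  have \<delta>: "\<delta> > 0" using S by (simp add: \<delta>_def)
  have "(\<lambda>z. \<Sum>\<mu>\<in>K. c \<mu> * exp (\<kappa> \<mu> * z)) \<in> near v k" if \<kappa>: "\<forall>\<mu>\<in>K. dist (\<kappa> \<mu>) \<mu> < \<delta>" for \<kappa>
  proof -
    have e: "norm (exp (\<kappa> \<mu> * z) - exp (\<mu> * z)) \<le> \<delta> * C \<mu>" if "\<mu> \<in> K" "norm z \<le> real l" for \<mu> z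
    proof (cases "\<kappa> \<mu> = \<mu>")
      case False
      have u: "norm (\<kappa> \<mu> - \<mu>) < \<delta>" using \<kappa> that(1) by (simp add: dist_norm)
      have "norm (exp (\<kappa> \<mu> * z) - exp (\<mu> * z)) \<le> norm (\<kappa> \<mu> - \<mu>) * C \<mu>"
        using exp_remainder_bound[of "\<kappa> \<mu> - \<mu>" z "real l" 0 \<mu>] False u that(2) by (simp add: C_def \<delta>_def)
      also have "\<dots> \<le> \<delta> * C \<mu>" using u by (intro mult_right_mono) (auto simp: C_def)
      finally show ?thesis .
    qed (use \<delta> in \<open>simp add: C_def\<close>)
    have "dist (\<Sum>\<mu>\<in>K. c \<mu> * exp (\<kappa> \<mu> * z)) (\<Sum>\<mu>\<in>K. c \<mu> * exp (\<mu> * z)) < 1 / (real l + 1)"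
      if z: "z \<in> cball 0 (real l)" for z
    proof -
      have "dist (\<Sum>\<mu>\<in>K. c \<mu> * exp (\<kappa> \<mu> * z)) (\<Sum>\<mu>\<in>K. c \<mu> * exp (\<mu> * z))
        = norm (\<Sum>\<mu>\<in>K. c \<mu> * (exp (\<kappa> \<mu> * z) - exp (\<mu> * z)))"
        by (simp add: dist_norm sum_subtractf[symmetric] right_diff_distrib)
      also have "\<dots> \<le> (\<Sum>\<mu>\<in>K. norm (c \<mu>) * (\<delta> * C \<mu>))"
        using e z by (intro sum_norm_le) (auto simp: norm_mult intro!: mult_left_mono)
      also have "\<dots> = \<delta> * S" by (simp add: S_def sum_distrib_left algebra_simps)
      also have "\<dots> < \<delta> * (S + 1)" using \<delta> by simp
      also have "\<dots> \<le> 1 / (real l + 1) / (S + 1) * (S + 1)"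
        using S by (intro mult_right_mono) (auto simp: \<delta>_def)
      also have "\<dots> = 1 / (real l + 1)" using S by simp
      finally show ?thesis .
    qed
    moreover have "(\<lambda>z. \<Sum>\<mu>\<in>K. c \<mu> * exp (\<kappa> \<mu> * z)) holomorphic_on UNIV"
      by (intro holomorphic_intros)
    ultimately have "(\<lambda>z. \<Sum>\<mu>\<in>K. c \<mu> * exp (\<kappa> \<mu> * z)) \<in> near (\<lambda>z. \<Sum>\<mu>\<in>K. c \<mu> * exp (\<mu> * z)) l"
      by (simp add: near_def)
    with l show ?thesis by blast
  qed
  with \<delta> show ?thesis by blast
qed

lemma small_exp_sum_near:
  assumes "r > 0" "\<delta> > 0" "f holomorphic_on UNIV"
  shows "\<exists>G c. finite G \<and> G \<subseteq> ball 0 \<delta> \<and> (\<lambda>z. \<Sum>\<gamma>\<in>G. c \<gamma> * exp (of_real r * \<gamma> * z)) \<in> near f k"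
proof -
  have "0 islimpt ball (0::complex) (r * \<delta>)"
    using assms by (intro interior_limit_point) auto
  from exp_span_dense[OF this assms(3), of k] obtain K c where
    K: "finite K" "K \<subseteq> ball 0 (r * \<delta>)" "(\<lambda>z. \<Sum>\<mu>\<in>K. c \<mu> * exp (\<mu> * z)) \<in> near f k"
    unfolding exp_span_def by blast
  define G where "G = (\<lambda>\<mu>. \<mu> / of_real r) ` K"
  have inj: "inj_on (\<lambda>\<mu>. \<mu> / of_real r) K" using assms(1) by (auto simp: inj_on_def)
  have "(\<Sum>\<gamma>\<in>G. c (of_real r * \<gamma>) * exp (of_real r * \<gamma> * z)) = (\<Sum>\<mu>\<in>K. c \<mu> * exp (\<mu> * z))" for z
    unfolding G_def using assms(1) by (subst sum.reindex[OF inj]) (auto intro!: sum.cong)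
  moreover have "G \<subseteq> ball 0 \<delta>"
    using K(2) assms(1) by (auto simp: G_def norm_divide divide_less_eq mult.commute dest!: subsetD)
  ultimately show ?thesis using K(1,3) by (intro exI[of _ G] exI[of _ "\<lambda>\<gamma>. c (of_real r * \<gamma>)"]) (auto simp: G_def)
qed

text \<open>
  The shape of each term that disappears in the limit.
\<close>

lemma uniform_limit_geometric_exp:
  assumes a: "\<And>n. norm (a n) \<le> D" and \<phi>: "norm (\<phi> :: complex) < 1"
  shows "uniform_limit (cball 0 R) (\<lambda>n z. a n * \<phi> ^ n * exp (\<nu> * z)) (\<lambda>z. 0) sequentially"
proof (rule uniform_limitI)
  fix e :: real assume e: "e > 0"
  define E where "E = \<bar>D\<bar> * exp (norm \<nu> * R)"
  have "(\<lambda>n. norm \<phi> ^ n * E) \<longlonglongrightarrow> 0 * E" using \<phi> by (intro tendsto_intros LIMSEQ_power_zero) auto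
  then have "\<forall>\<^sub>F n in sequentially. norm \<phi> ^ n * E < e" using e by (intro order_tendstoD(2)) auto
  then show "\<forall>\<^sub>F n in sequentially. \<forall>z\<in>cball 0 R. dist (a n * \<phi> ^ n * exp (\<nu> * z)) 0 < e"
  proof (rule eventually_mono, intro ballI)
    fix n z assume n: "norm \<phi> ^ n * E < e" and z: "z \<in> cball (0::complex) R"
    have "norm (\<nu> * z) \<le> norm \<nu> * R" using z by (simp add: norm_mult mult_left_mono)
    then have ex: "norm (exp (\<nu> * z)) \<le> exp (norm \<nu> * R)" by (meson norm_exp exp_le_cancel_iff order_trans)
    have "norm (a n * \<phi> ^ n * exp (\<nu> * z)) = norm \<phi> ^ n * (norm (a n) * norm (exp (\<nu> * z)))"
      by (simp only: norm_mult norm_power ac_simps)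
    also have "\<dots> \<le> norm \<phi> ^ n * E"
      unfolding E_def using a[of n] ex by (intro mult_left_mono mult_mono) auto
    finally show "dist (a n * \<phi> ^ n * exp (\<nu> * z)) 0 < e" using n by simp
  qed
qed

lemma uniform_limit_sum_null:
  assumes "finite S" "\<And>s. s \<in> S \<Longrightarrow> uniform_limit X (h s) (\<lambda>_. 0 :: complex) F"
  shows "uniform_limit X (\<lambda>n z. \<Sum>s\<in>S. h s n z) (\<lambda>_. 0) F"
  using assms
proof (induction S rule: finite_induct)
  case empty
  show ?case by (auto intro!: uniform_limitI)
next
  case (insert s S)
  have "uniform_limit X (\<lambda>n z. h s n z + (\<Sum>s\<in>S. h s n z)) (\<lambda>_. 0 + 0) F"
    using insert by (intro uniform_limit_add) auto
  with insert.hyps show ?case by simp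
qed

lemma eventually_near:
  assumes "uniform_limit (cball 0 (real k)) h f F" "\<And>n. h n holomorphic_on UNIV"
  shows "\<forall>\<^sub>F n in F. h n \<in> near f k"
proof -
  have "\<forall>\<^sub>F n in F. \<forall>z\<in>cball 0 (real k). dist (h n z) (f z) < 1 / (real k + 1)"
    using assms(1) by (rule uniform_limitD) simp
  then show ?thesis by (rule eventually_mono) (simp add: near_def assms(2))
qed

text \<open>
  A pair \<open>(i, m)\<close> with \<open>m < \<beta> i\<close> names one of the \<open>\<beta> i\<close> copies of the \<open>i\<close>-th factor, and \<open>\<sigma>\<close> chooses
  a summand for each copy.
\<close>

lemma power_product_expansion:
  fixes a :: "'i \<Rightarrow> 'y \<Rightarrow> 'b::comm_semiring_1"
  assumes "finite J" "\<And>i. i \<in> J \<Longrightarrow> finite (Y i)"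
  shows "(\<Prod>i\<in>J. (\<Sum>y\<in>Y i. a i y) ^ \<beta> i) =
    (\<Sum>\<sigma>\<in>PiE (SIGMA i:J. {..<\<beta> i}) (\<lambda>x. Y (fst x)). \<Prod>x\<in>(SIGMA i:J. {..<\<beta> i}). a (fst x) (\<sigma> x))"
proof -
  have "(\<Prod>i\<in>J. (\<Sum>y\<in>Y i. a i y) ^ \<beta> i) = (\<Prod>i\<in>J. \<Prod>m\<in>{..<\<beta> i}. \<Sum>y\<in>Y i. a i y)" by simp
  also have "\<dots> = (\<Prod>x\<in>(SIGMA i:J. {..<\<beta> i}). \<Sum>y\<in>Y (fst x). a (fst x) y)"
    using assms(1) by (subst prod.Sigma) (auto simp: case_prod_unfold)
  also have "\<dots> = (\<Sum>\<sigma>\<in>PiE (SIGMA i:J. {..<\<beta> i}) (\<lambda>x. Y (fst x)). \<Prod>x\<in>(SIGMA i:J. {..<\<beta> i}). a (fst x) (\<sigma> x))"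
    using assms by (intro prod_sum_PiE) auto
  finally show ?thesis .
qed

lemma finite_common_delta:
  assumes "finite S" "\<And>s. s \<in> S \<Longrightarrow> \<exists>d>0::real. P s d"
    "\<And>s d e. P s d \<Longrightarrow> 0 < e \<Longrightarrow> e \<le> d \<Longrightarrow> P s e"
  shows "\<exists>d>0. \<forall>s\<in>S. P s d"
  using assms(1,2)
proof (induction S rule: finite_induct)
  case empty
  show ?case by (intro exI[of _ 1]) simp
next
  case (insert s S)
  then obtain d where d: "d > 0" "\<forall>s\<in>S. P s d" by blast
  obtain d' where d': "d' > 0" "P s d'" using insert.prems by blast
  have "P t (min d d')" if "t \<in> insert s S" for t
    using that d d' assms(3)[of t d "min d d'"] assms(3)[of s d' "min d d'"] by auto
  then show ?case using d(1) d'(1) by (intro exI[of _ "min d d'"]) simp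
qed

text \<open>
  The estimate survives a small perturbation of all points. It is used twice over: to push
  frequencies off the arc to where \<open>\<Phi>\<close> has modulus greater than one, and to replace the origin by
  small frequencies.
\<close>

lemma (in convex_level_arc) modulus_stable:
  fixes w :: "'x \<Rightarrow> real"
  assumes X: "finite X" and w: "\<And>x. x \<in> X \<Longrightarrow> w x > 0" "sum w X \<le> 1"
    and p: "\<And>x. x \<in> X \<Longrightarrow> p x \<in> insert 0 (\<Gamma> - radially_doubled \<Gamma>)"
    and not_pure: "\<not> (sum w X = 1 \<and> (\<exists>c\<in>\<Gamma>. \<forall>x\<in>X. p x = c))"
  shows "\<exists>\<delta>>0. \<forall>p'. (\<forall>x\<in>X. dist (p' x) (p x) < \<delta>) \<longrightarrow> norm (\<Phi> (\<Sum>x\<in>X. of_real (w x) * p' x)) < 1"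
proof -
  let ?q = "\<Sum>x\<in>X. w x *\<^sub>R p x"
  have "norm (\<Phi> ?q) < 1"
    using modulus_convex_combination[of X w p] X w p not_pure by blast
  moreover have "open (\<Phi> -` ball 0 1)"
    using holomorphic_on_imp_continuous_on[OF entire] by (intro open_vimage) auto
  ultimately obtain d where d: "d > 0" "ball ?q d \<subseteq> \<Phi> -` ball 0 1"
    using open_contains_ball[of "\<Phi> -` ball 0 1"] by (auto simp del: vimage_eq simp: vimage_def)
  have "norm (\<Phi> (\<Sum>x\<in>X. of_real (w x) * p' x)) < 1" if p': "\<forall>x\<in>X. dist (p' x) (p x) < d / 2" for p'
  proof -
    have "dist ?q (\<Sum>x\<in>X. of_real (w x) * p' x) = norm (\<Sum>x\<in>X. w x *\<^sub>R (p x - p' x))"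
      by (simp add: dist_norm sum_subtractf[symmetric] scaleR_conv_of_real right_diff_distrib)
    also have "\<dots> \<le> (\<Sum>x\<in>X. w x * (d / 2))"
    proof (rule sum_norm_le)
      fix x assume x: "x \<in> X"
      have "norm (p x - p' x) < d / 2" using p' x by (simp add: dist_norm norm_minus_commute)
      then show "norm (w x *\<^sub>R (p x - p' x)) \<le> w x * (d / 2)"
        using w(1)[OF x] by (simp add: mult_left_mono)
    qed
    also have "\<dots> = sum w X * (d / 2)" by (simp add: sum_distrib_right)
    also have "\<dots> \<le> 1 * (d / 2)" using w(2) d(1) by (intro mult_right_mono) auto
    also have "\<dots> < d" using d(1) by simp
    finally have "(\<Sum>x\<in>X. of_real (w x) * p' x) \<in> \<Phi> -` ball 0 1" using d(2) by auto
    then show ?thesis by simp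
  qed
  then show ?thesis using d(1) by (intro exI[of _ "d / 2"]) auto
qed

section \<open>Steering power products\<close>

locale arc_operator = convex_level_arc \<Phi> \<Gamma> + exp_diagonal_operator T \<Phi> for \<Phi> \<Gamma> T +
  assumes nontrivial: "nontrivial_compact_arc \<Gamma>"
begin

text \<open>
  The core of the proof. With logarithms of the \<open>c \<mu>\<close> and of \<open>\<Phi> (\<kappa> \<mu>)\<close>, put
  \<open>f n i = g i + (\<Sum>\<mu>. exp (w i * (Ln (c \<mu>) - n * Ln (\<Phi> (\<kappa> \<mu>)) + \<kappa> \<mu> * z)))\<close>,
  where the sum of the \<open>c \<mu> * exp (\<kappa> \<mu> * z)\<close> approximates \<open>v\<close>, the \<open>\<kappa> \<mu>\<close> are close to the arc and
  \<open>\<Phi>\<close> has modulus greater than one there, and \<open>g i\<close> approximates \<open>u i\<close> by exponentials with small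
  frequencies. In the \<open>\<alpha>\<close>-th power product the weights add up to one, so that choosing the same \<open>\<mu>\<close> in
  every factor gives \<open>c \<mu> / \<Phi> (\<kappa> \<mu>) ^ n * exp (\<kappa> \<mu> * z)\<close>, which the \<open>n\<close>-th iterate maps to
  \<open>c \<mu> * exp (\<kappa> \<mu> * z)\<close>. Every other choice has a frequency at which \<open>\<Phi>\<close> has modulus below one and a
  bounded coefficient, so it tends to zero.
\<close>

lemma power_product_transitivity:
  fixes A :: "('i \<Rightarrow> nat) set" and w :: "'i \<Rightarrow> real"
  assumes J: "finite J" and A: "finite A" "\<alpha> \<in> A"
    and w: "\<And>i. w i > 0" "(\<Sum>i\<in>J. w i * real (\<alpha> i)) = 1"
      "\<And>\<beta>. \<beta> \<in> A \<Longrightarrow> \<beta> \<noteq> \<alpha> \<Longrightarrow> (\<Sum>i\<in>J. w i * real (\<beta> i)) < 1"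
    and u: "\<And>i. i \<in> J \<Longrightarrow> u i holomorphic_on UNIV" and v: "v holomorphic_on UNIV"
  shows "\<exists>f n. (\<forall>i\<in>J. f i \<in> near (u i) k) \<and>
    (T ^^ n) (\<lambda>z. \<Prod>i\<in>J. f i z ^ \<alpha> i) \<in> near v k \<and>
    (\<forall>\<beta>\<in>A - {\<alpha>}. (T ^^ n) (\<lambda>z. \<Prod>i\<in>J. f i z ^ \<beta> i) \<in> near (\<lambda>z. 0) k)"
proof -
  \<comment> \<open>the copies of the factors in the \<open>\<beta>\<close>-th power product\<close>
  define X where "X = (\<lambda>\<beta>. SIGMA i:J. {..<\<beta> i :: nat})"
  define wx where "wx = (\<lambda>x :: 'i \<times> nat. w (fst x))"
  have X: "finite (X \<beta>)" for \<beta> using J by (auto simp: X_def)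
  have wX: "sum wx (X \<beta>) = (\<Sum>i\<in>J. w i * real (\<beta> i))" for \<beta>
  proof -
    have "(\<Sum>i\<in>J. w i * real (\<beta> i)) = (\<Sum>i\<in>J. \<Sum>m\<in>{..<\<beta> i}. w i)" by (simp add: mult.commute)
    also have "\<dots> = sum wx (X \<beta>)"
      unfolding X_def wx_def using J by (subst sum.Sigma) (auto simp: case_prod_unfold)
    finally show ?thesis by simp
  qed
  have wX1: "sum wx (X \<beta>) \<le> 1" if "\<beta> \<in> A" for \<beta>
    using w(2) w(3)[OF that] by (cases "\<beta> = \<alpha>") (auto simp: wX)
  have Xne: "X \<alpha> \<noteq> {}" using w(2) wX[of \<alpha>] by auto

  \<comment> \<open>the target is replaced by a combination of exponentials with frequencies on the arc\<close>
  obtain p where "p islimpt (\<Gamma> - radially_doubled \<Gamma>)" using limit_point[OF nontrivial] by blast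
  from exp_span_dense[OF this v, of k] obtain K0 c where
    K0: "finite K0" "K0 \<subseteq> \<Gamma> - radially_doubled \<Gamma>" "(\<lambda>z. \<Sum>\<mu>\<in>K0. c \<mu> * exp (\<mu> * z)) \<in> near v k"
    unfolding exp_span_def by blast
  define K where "K = {\<mu> \<in> K0. c \<mu> \<noteq> 0}"
  have K: "finite K" "K \<subseteq> \<Gamma> - radially_doubled \<Gamma>" "\<And>\<mu>. \<mu> \<in> K \<Longrightarrow> c \<mu> \<noteq> 0"
    using K0 by (auto simp: K_def)
  have "(\<lambda>z. \<Sum>\<mu>\<in>K. c \<mu> * exp (\<mu> * z)) = (\<lambda>z. \<Sum>\<mu>\<in>K0. c \<mu> * exp (\<mu> * z))"
    using K0(1) by (intro ext sum.mono_neutral_left) (auto simp: K_def)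
  with K0(3) have "(\<lambda>z. \<Sum>\<mu>\<in>K. c \<mu> * exp (\<mu> * z)) \<in> near v k" by simp
  from exp_sum_perturbation[OF K(1) this v] obtain \<delta>1 where \<delta>1: "\<delta>1 > 0"
    "\<And>\<kappa>. (\<forall>\<mu>\<in>K. dist (\<kappa> \<mu>) \<mu> < \<delta>1) \<Longrightarrow> (\<lambda>z. \<Sum>\<mu>\<in>K. c \<mu> * exp (\<kappa> \<mu> * z)) \<in> near v k"
    by blast

  \<comment> \<open>a base point on the arc stands for the frequency \<open>\<kappa> \<mu>\<close> near it, and the base point zero for any of
    the small frequencies; only finitely many assignments of base points have to be kept stable, and
    their number does not depend on the approximation of the \<open>u i\<close> chosen later\<close>
  define pure where "pure = (\<lambda>\<beta> q. sum wx (X \<beta>) = 1 \<and> (\<exists>\<mu>\<in>\<Gamma>. \<forall>x\<in>X \<beta>. q x = \<mu>))"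
  define stable where "stable = (\<lambda>s \<delta>. \<forall>p'. (\<forall>x\<in>X (fst s). dist (p' x) (snd s x) < \<delta>) \<longrightarrow>
    norm (\<Phi> (\<Sum>x\<in>X (fst s). of_real (wx x) * p' x)) < 1)"
  define S where "S = (SIGMA \<beta>:A. {q \<in> PiE (X \<beta>) (\<lambda>_. insert 0 K). \<not> pure \<beta> q})"
  have "\<exists>\<delta>>0. \<forall>s\<in>S. stable s \<delta>"
  proof (rule finite_common_delta)
    have "finite (PiE (X \<beta>) (\<lambda>_. insert 0 K))" for \<beta> using X K(1) by (intro finite_PiE) auto
    then show "finite S"
      unfolding S_def using A(1) by (intro finite_SigmaI) auto
    show "\<exists>\<delta>>0. stable s \<delta>" if s: "s \<in> S" for s
      unfolding stable_def
    proof (rule modulus_stable)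
      show "snd s x \<in> insert 0 (\<Gamma> - radially_doubled \<Gamma>)" if "x \<in> X (fst s)" for x
        using s that K(2) by (fastforce simp: S_def PiE_iff)
      show "\<not> (sum wx (X (fst s)) = 1 \<and> (\<exists>c\<in>\<Gamma>. \<forall>x\<in>X (fst s). snd s x = c))"
        using s by (auto simp: S_def pure_def)
    qed (use s X w(1) wX1 in \<open>auto simp: S_def wx_def\<close>)
    show "stable s e" if "stable s d" "e \<le> d" for s and d e :: real
      using that unfolding stable_def by (meson less_le_trans)
  qed
  then obtain \<delta>2 where \<delta>2: "\<delta>2 > 0" "\<And>s. s \<in> S \<Longrightarrow> stable s \<delta>2" by blast
  define \<delta> where "\<delta> = min \<delta>1 \<delta>2"
  have \<delta>: "\<delta> > 0" "\<delta> \<le> \<delta>1" "\<delta> \<le> \<delta>2" using \<delta>1 \<delta>2 by (auto simp: \<delta>_def)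

  have "\<exists>\<mu>'. dist \<mu>' \<mu> < \<delta> \<and> norm (\<Phi> \<mu>') > 1" if "\<mu> \<in> K" for \<mu>
  proof -
    have "\<mu> \<in> \<Gamma>" "\<mu> \<in> ball \<mu> \<delta>" using K(2) that \<delta>(1) by auto
    from modulus_exceeds[OF this(1) open_ball this(2)] show ?thesis by (auto simp: dist_commute)
  qed
  then obtain \<kappa> where \<kappa>: "\<And>\<mu>. \<mu> \<in> K \<Longrightarrow> dist (\<kappa> \<mu>) \<mu> < \<delta>" "\<And>\<mu>. \<mu> \<in> K \<Longrightarrow> norm (\<Phi> (\<kappa> \<mu>)) > 1"
    by metis
  have target: "(\<lambda>z. \<Sum>\<mu>\<in>K. c \<mu> * exp (\<kappa> \<mu> * z)) \<in> near v k"
    using \<delta>1(2)[of \<kappa>] \<kappa>(1) \<delta>(2) by fastforce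
  define small where "small = (\<lambda>i Gb. finite (fst Gb) \<and> fst Gb \<subseteq> ball 0 \<delta> \<and>
    (\<lambda>z. \<Sum>\<gamma>\<in>fst Gb. snd Gb \<gamma> * exp (of_real (w i) * \<gamma> * z)) \<in> near (u i) k)"
  have "\<forall>i\<in>J. \<exists>Gb. small i Gb"
  proof
    fix i assume "i \<in> J"
    from small_exp_sum_near[OF w(1) \<delta>(1) u[OF this], of i k]
    obtain G b where "finite G" "G \<subseteq> ball 0 \<delta>"
      "(\<lambda>z. \<Sum>\<gamma>\<in>G. b \<gamma> * exp (of_real (w i) * \<gamma> * z)) \<in> near (u i) k" by blast
    then show "\<exists>Gb. small i Gb" by (intro exI[of _ "(G, b)"]) (simp add: small_def)
  qed
  then obtain Gb where Gb: "\<forall>i\<in>J. small i (Gb i)" using bchoice[of J small] by blast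
  define G where "G = (\<lambda>i. fst (Gb i))"
  define b where "b = (\<lambda>i. snd (Gb i))"
  have G: "finite (G i)" "G i \<subseteq> ball 0 \<delta>"
    "(\<lambda>z. \<Sum>\<gamma>\<in>G i. b i \<gamma> * exp (of_real (w i) * \<gamma> * z)) \<in> near (u i) k" if "i \<in> J" for i
    using Gb that by (simp_all add: small_def G_def b_def)

  \<comment> \<open>the summands of the \<open>i\<close>-th generator: small frequencies on the left, frequencies near the arc on the
    right\<close>
  define Y where "Y = (\<lambda>i. G i <+> K)"
  define base where "base = case_sum (\<lambda>_ :: complex. 0) (\<lambda>\<mu> :: complex. \<mu>)"
  define freq where "freq = case_sum (\<lambda>\<gamma>. \<gamma>) \<kappa>"
  define C where "C = (\<lambda>n i. case_sum (b i)
    (\<lambda>\<mu>. exp (of_real (w i) * (Ln (c \<mu>) - of_nat n * Ln (\<Phi> (\<kappa> \<mu>))))))"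
  define f where "f = (\<lambda>n i z. \<Sum>y\<in>Y i. C n i y * exp (of_real (w i) * freq y * z))"
  define P where "P = (\<lambda>\<beta>. PiE (X \<beta>) (\<lambda>x. Y (fst x)))"
  define coef where "coef = (\<lambda>n \<beta> \<sigma>. \<Prod>x\<in>X \<beta>. C n (fst x) (\<sigma> x))"
  define fr where "fr = (\<lambda>\<beta> \<sigma>. \<Sum>x\<in>X \<beta>. of_real (wx x) * freq (\<sigma> x))"
  define summand where "summand = (\<lambda>\<beta> \<sigma> n z. coef n \<beta> \<sigma> * \<Phi> (fr \<beta> \<sigma>) ^ n * exp (fr \<beta> \<sigma> * z))"
  have Y: "finite (Y i)" if "i \<in> J" for i using G(1)[OF that] K(1) by (simp add: Y_def)
  have P: "finite (P \<beta>)" for \<beta>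
    unfolding P_def using X Y by (intro finite_PiE) (auto simp: X_def)

  have power_product: "(\<lambda>z. \<Prod>i\<in>J. f n i z ^ \<beta> i) = (\<lambda>z. \<Sum>\<sigma>\<in>P \<beta>. coef n \<beta> \<sigma> * exp (fr \<beta> \<sigma> * z))" for n \<beta>
  proof
    fix z
    have "(\<Prod>i\<in>J. f n i z ^ \<beta> i) =
      (\<Sum>\<sigma>\<in>P \<beta>. \<Prod>x\<in>X \<beta>. C n (fst x) (\<sigma> x) * exp (of_real (w (fst x)) * freq (\<sigma> x) * z))"
      unfolding f_def P_def X_def using J Y by (rule power_product_expansion)
    also have "\<dots> = (\<Sum>\<sigma>\<in>P \<beta>. coef n \<beta> \<sigma> * exp (fr \<beta> \<sigma> * z))"
      unfolding coef_def fr_def wx_def prod.distrib sum_distrib_right using X by (simp add: exp_sum)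
    finally show "(\<Prod>i\<in>J. f n i z ^ \<beta> i) = (\<Sum>\<sigma>\<in>P \<beta>. coef n \<beta> \<sigma> * exp (fr \<beta> \<sigma> * z))" .
  qed
  have iterate: "(T ^^ n) (\<lambda>z. \<Prod>i\<in>J. f n i z ^ \<beta> i) = (\<lambda>z. \<Sum>\<sigma>\<in>P \<beta>. summand \<beta> \<sigma> n z)" for n \<beta>
  proof -
    interpret Tn: exp_diagonal_operator "T ^^ n" "\<lambda>\<mu>. \<Phi> \<mu> ^ n"
      by (rule exp_diagonal_operator_funpow) unfold_locales
    show ?thesis unfolding power_product summand_def by (rule Tn.op_exp_sum[OF P])
  qed

  have null: "uniform_limit (cball 0 R) (summand \<beta> \<sigma>) (\<lambda>z. 0) sequentially"
    if \<beta>: "\<beta> \<in> A" and \<sigma>: "\<sigma> \<in> P \<beta>" and np: "\<not> pure \<beta> (\<lambda>x. base (\<sigma> x))" for \<beta> \<sigma> R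
  proof -
    have \<sigma>Y: "\<sigma> x \<in> Y (fst x)" "fst x \<in> J" if "x \<in> X \<beta>" for x
      using \<sigma> that by (auto simp: P_def X_def PiE_iff)
    define D where "D = (\<lambda>i. case_sum (\<lambda>\<gamma>. norm (b i \<gamma>)) (\<lambda>\<mu>. exp (w i * Re (Ln (c \<mu>)))))"
    \<comment> \<open>the coefficients stay bounded in \<open>n\<close> because \<open>\<Phi> (\<kappa> \<mu>)\<close> has modulus greater than one\<close>
    have CD: "norm (C n i y) \<le> D i y" if "y \<in> Y i" for n i y
    proof (cases y)
      case (Inr \<mu>)
      then have "\<mu> \<in> K" using that by (auto simp: Y_def)
      then have nz: "norm (\<Phi> (\<kappa> \<mu>)) > 1" using \<kappa>(2) by blast
      then have "Re (Ln (\<Phi> (\<kappa> \<mu>))) \<ge> 0" by (subst Re_Ln) auto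
      then have "w i * (Re (Ln (c \<mu>)) - real n * Re (Ln (\<Phi> (\<kappa> \<mu>)))) \<le> w i * Re (Ln (c \<mu>))"
        using w(1)[of i] by (intro mult_left_mono) auto
      then show ?thesis by (simp add: Inr C_def D_def)
    qed (simp add: C_def D_def)
    have coef: "norm (coef n \<beta> \<sigma>) \<le> (\<Prod>x\<in>X \<beta>. D (fst x) (\<sigma> x))" for n
      unfolding coef_def prod_norm[symmetric] using CD \<sigma>Y by (intro prod_mono) auto
    define q where "q = restrict (\<lambda>x. base (\<sigma> x)) (X \<beta>)"
    have "q \<in> PiE (X \<beta>) (\<lambda>_. insert 0 K)"
      using \<sigma>Y(1) by (fastforce simp: q_def base_def Y_def)
    moreover have "\<not> pure \<beta> q" using np by (simp add: pure_def q_def)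
    ultimately have "stable (\<beta>, q) \<delta>2" using \<beta> by (intro \<delta>2(2)) (simp add: S_def)
    moreover have "dist (freq (\<sigma> x)) (q x) < \<delta>2" if "x \<in> X \<beta>" for x
    proof -
      have "dist (freq (\<sigma> x)) (base (\<sigma> x)) < \<delta>"
      proof (cases "\<sigma> x")
        case (Inl \<gamma>)
        then have "\<gamma> \<in> ball 0 \<delta>" using \<sigma>Y[OF that] G(2)[of "fst x"] by (auto simp: Y_def)
        then show ?thesis by (simp add: Inl freq_def base_def)
      next
        case (Inr \<mu>)
        then have "\<mu> \<in> K" using \<sigma>Y[OF that] by (auto simp: Y_def)
        then show ?thesis using \<kappa>(1) by (simp add: Inr freq_def base_def)
      qed
      then show ?thesis using that \<delta>(3) by (simp add: q_def)
    qed
    ultimately have "norm (\<Phi> (fr \<beta> \<sigma>)) < 1" by (simp add: stable_def fr_def)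
    then show ?thesis
      unfolding summand_def by (rule uniform_limit_geometric_exp[OF coef])
  qed

  \<comment> \<open>the generators converge to combinations of exponentials close to the prescribed functions\<close>
  define g where "g = (\<lambda>i z. \<Sum>\<gamma>\<in>G i. b i \<gamma> * exp (of_real (w i) * \<gamma> * z))"
  have f_entire: "f n i holomorphic_on UNIV" for n i
    unfolding f_def by (intro holomorphic_intros)
  have f_lim: "uniform_limit (cball 0 R) (\<lambda>n. f n i) (g i) sequentially" if i: "i \<in> J" for i R
  proof -
    define \<phi> where "\<phi> = (\<lambda>\<mu>. exp (- (of_real (w i) * Ln (\<Phi> (\<kappa> \<mu>)))))"
    have f_eq: "(\<lambda>n. f n i) = (\<lambda>n z. g i z +
      (\<Sum>\<mu>\<in>K. exp (of_real (w i) * Ln (c \<mu>)) * \<phi> \<mu> ^ n * exp (of_real (w i) * \<kappa> \<mu> * z)))"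
    proof (intro ext)
      fix n z
      have "exp (of_real (w i) * (Ln (c \<mu>) - of_nat n * Ln (\<Phi> (\<kappa> \<mu>)))) = exp (of_real (w i) * Ln (c \<mu>)) * \<phi> \<mu> ^ n" for \<mu>
        unfolding \<phi>_def exp_of_nat_mult[symmetric] exp_add[symmetric] by (simp add: algebra_simps)
      then show "f n i z = g i z +
        (\<Sum>\<mu>\<in>K. exp (of_real (w i) * Ln (c \<mu>)) * \<phi> \<mu> ^ n * exp (of_real (w i) * \<kappa> \<mu> * z))"
        using G(1)[OF i] K(1) by (simp add: f_def g_def Y_def sum.Plus C_def freq_def)
    qed
    have "uniform_limit (cball 0 R)
      (\<lambda>n z. g i z + (\<Sum>\<mu>\<in>K. exp (of_real (w i) * Ln (c \<mu>)) * \<phi> \<mu> ^ n * exp (of_real (w i) * \<kappa> \<mu> * z)))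
      (\<lambda>z. g i z + 0) sequentially"
    proof (intro uniform_limit_add uniform_limit_sum_null K(1))
      fix \<mu> assume \<mu>: "\<mu> \<in> K"
      have "Re (Ln (\<Phi> (\<kappa> \<mu>))) > 0" using \<kappa>(2)[OF \<mu>] by (subst Re_Ln) (auto intro: ln_gt_zero)
      then have "norm (\<phi> \<mu>) < 1" using w(1)[of i] by (simp add: \<phi>_def)
      then show "uniform_limit (cball 0 R)
        (\<lambda>n z. exp (of_real (w i) * Ln (c \<mu>)) * \<phi> \<mu> ^ n * exp (of_real (w i) * \<kappa> \<mu> * z)) (\<lambda>_. 0) sequentially"
        by (intro uniform_limit_geometric_exp[where D = "norm (exp (of_real (w i) * Ln (c \<mu>)))"] order_refl)
    qed (auto intro!: uniform_limitI)
    then show ?thesis unfolding f_eq by (simp only: add_0_right)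
  qed
  have f_near: "\<forall>\<^sub>F n in sequentially. f n i \<in> near (u i) k" if i: "i \<in> J" for i
  proof -
    have "g i \<in> near (u i) k" using G(3)[OF i] by (simp add: g_def)
    then obtain l where l: "near (g i) l \<subseteq> near (u i) k" using near_absorbs u[OF i] by blast
    have "\<forall>\<^sub>F n in sequentially. f n i \<in> near (g i) l"
      by (rule eventually_near[OF f_lim[OF i] f_entire])
    then show ?thesis by (rule eventually_mono) (use l in blast)
  qed

  have summand_entire: "(\<lambda>z. \<Sum>\<sigma>\<in>Q. summand \<beta> \<sigma> n z) holomorphic_on UNIV" for Q \<beta> n
    unfolding summand_def by (intro holomorphic_intros)
  have low: "\<forall>\<^sub>F n in sequentially. (T ^^ n) (\<lambda>z. \<Prod>i\<in>J. f n i z ^ \<beta> i) \<in> near (\<lambda>z. 0) k"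
    if \<beta>: "\<beta> \<in> A - {\<alpha>}" for \<beta>
    unfolding iterate
  proof (rule eventually_near[OF uniform_limit_sum_null[OF P] summand_entire])
    fix \<sigma> assume "\<sigma> \<in> P \<beta>"
    moreover have "\<not> pure \<beta> q" for q using w(3)[of \<beta>] \<beta> by (auto simp: pure_def wX)
    ultimately show "uniform_limit (cball 0 (real k)) (summand \<beta> \<sigma>) (\<lambda>_. 0) sequentially"
      using \<beta> by (intro null) auto
  qed

  \<comment> \<open>in the leading power product only the pure choices survive, and they add up to the target\<close>
  define \<tau> where "\<tau> = (\<lambda>\<mu>. restrict (\<lambda>_. Inr \<mu> :: complex + complex) (X \<alpha>))"
  have \<tau>P: "\<tau> ` K \<subseteq> P \<alpha>" by (auto simp: \<tau>_def P_def Y_def)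
  obtain x0 where x0: "x0 \<in> X \<alpha>" using Xne by blast
  have inj: "inj_on \<tau> K"
  proof (rule inj_onI)
    fix \<mu> \<mu>' assume "\<tau> \<mu> = \<tau> \<mu>'"
    then have "\<tau> \<mu> x0 = \<tau> \<mu>' x0" by simp
    then show "\<mu> = \<mu>'" using x0 by (simp add: \<tau>_def)
  qed
  have pure_\<tau>: "\<sigma> \<in> \<tau> ` K" if \<sigma>: "\<sigma> \<in> P \<alpha>" and pu: "pure \<alpha> (\<lambda>x. base (\<sigma> x))" for \<sigma>
  proof -
    obtain \<mu> where \<mu>: "\<mu> \<in> \<Gamma>" "\<And>x. x \<in> X \<alpha> \<Longrightarrow> base (\<sigma> x) = \<mu>" using pu by (auto simp: pure_def)
    have "\<mu> \<noteq> 0" using \<mu>(1) zero_notin by auto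
    have s: "\<sigma> x = Inr \<mu>" if "x \<in> X \<alpha>" for x
      using \<mu>(2)[OF that] \<open>\<mu> \<noteq> 0\<close> by (cases "\<sigma> x") (auto simp: base_def)
    have "\<sigma> x0 \<in> Y (fst x0)" using \<sigma> x0 by (auto simp: P_def PiE_iff)
    then have "\<mu> \<in> K" using s[OF x0] by (auto simp: Y_def)
    moreover have "\<sigma> = \<tau> \<mu>"
    proof
      fix x show "\<sigma> x = \<tau> \<mu> x"
        using s PiE_arb[OF \<sigma>[unfolded P_def], of x] by (cases "x \<in> X \<alpha>") (simp_all add: \<tau>_def)
    qed
    ultimately show ?thesis by blast
  qed
  have summand_\<tau>: "summand \<alpha> (\<tau> \<mu>) n z = c \<mu> * exp (\<kappa> \<mu> * z)" if \<mu>: "\<mu> \<in> K" for \<mu> n z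
  proof -
    have \<Phi>0: "\<Phi> (\<kappa> \<mu>) \<noteq> 0" using \<kappa>(2)[OF \<mu>] by auto
    have w1: "(\<Sum>x\<in>X \<alpha>. complex_of_real (wx x)) = 1"
      using wX[of \<alpha>] w(2) by (simp flip: of_real_sum)
    have "fr \<alpha> (\<tau> \<mu>) = (\<Sum>x\<in>X \<alpha>. of_real (wx x) * \<kappa> \<mu>)"
      unfolding fr_def by (intro sum.cong) (auto simp: \<tau>_def freq_def)
    also have "\<dots> = \<kappa> \<mu>" by (simp add: sum_distrib_right[symmetric] w1)
    finally have fr: "fr \<alpha> (\<tau> \<mu>) = \<kappa> \<mu>" .
    have "coef n \<alpha> (\<tau> \<mu>) = (\<Prod>x\<in>X \<alpha>. exp (of_real (wx x) * (Ln (c \<mu>) - of_nat n * Ln (\<Phi> (\<kappa> \<mu>)))))"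
      unfolding coef_def by (intro prod.cong) (auto simp: \<tau>_def C_def wx_def)
    also have "\<dots> = exp (Ln (c \<mu>) - of_nat n * Ln (\<Phi> (\<kappa> \<mu>)))"
      using X by (simp add: exp_sum[symmetric] sum_distrib_right[symmetric] w1)
    also have "\<dots> = c \<mu> / \<Phi> (\<kappa> \<mu>) ^ n"
      using K(3)[OF \<mu>] \<Phi>0 by (simp add: exp_diff exp_of_nat_mult)
    finally show ?thesis
      using \<Phi>0 unfolding summand_def fr by simp
  qed
  define V where "V = (\<lambda>z. \<Sum>\<mu>\<in>K. c \<mu> * exp (\<kappa> \<mu> * z))"
  obtain l where l: "near V l \<subseteq> near v k" using near_absorbs[OF target v] by (auto simp: V_def)
  have "uniform_limit (cball 0 (real l)) (\<lambda>n z. V z + (\<Sum>\<sigma>\<in>P \<alpha> - \<tau> ` K. summand \<alpha> \<sigma> n z)) (\<lambda>z. V z + 0) sequentially"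
  proof (intro uniform_limit_add uniform_limit_sum_null)
    fix \<sigma> assume \<sigma>: "\<sigma> \<in> P \<alpha> - \<tau> ` K"
    then have "\<not> pure \<alpha> (\<lambda>x. base (\<sigma> x))" using pure_\<tau> by blast
    with \<sigma> show "uniform_limit (cball 0 (real l)) (summand \<alpha> \<sigma>) (\<lambda>_. 0) sequentially"
      using A(2) by (intro null) auto
  qed (use P in \<open>auto intro!: uniform_limitI\<close>)
  moreover have "(\<Sum>\<sigma>\<in>P \<alpha>. summand \<alpha> \<sigma> n z) = V z + (\<Sum>\<sigma>\<in>P \<alpha> - \<tau> ` K. summand \<alpha> \<sigma> n z)" for n z
  proof -
    have "(\<Sum>\<sigma>\<in>\<tau> ` K. summand \<alpha> \<sigma> n z) = V z"
      unfolding V_def sum.reindex[OF inj] by (intro sum.cong) (auto simp: summand_\<tau>)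
    then show ?thesis using sum.subset_diff[OF \<tau>P P, of "\<lambda>\<sigma>. summand \<alpha> \<sigma> n z"] by simp
  qed
  ultimately have "uniform_limit (cball 0 (real l)) (\<lambda>n z. \<Sum>\<sigma>\<in>P \<alpha>. summand \<alpha> \<sigma> n z) V sequentially" by simp
  then have "\<forall>\<^sub>F n in sequentially. (\<lambda>z. \<Sum>\<sigma>\<in>P \<alpha>. summand \<alpha> \<sigma> n z) \<in> near V l"
    by (rule eventually_near) (rule summand_entire)
  then have lead: "\<forall>\<^sub>F n in sequentially. (T ^^ n) (\<lambda>z. \<Prod>i\<in>J. f n i z ^ \<alpha> i) \<in> near v k"
    unfolding iterate by (rule eventually_mono) (use l in blast)

  let ?goal = "\<lambda>n. (\<forall>i\<in>J. f n i \<in> near (u i) k) \<and>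
    (T ^^ n) (\<lambda>z. \<Prod>i\<in>J. f n i z ^ \<alpha> i) \<in> near v k \<and>
    (\<forall>\<beta>\<in>A - {\<alpha>}. (T ^^ n) (\<lambda>z. \<Prod>i\<in>J. f n i z ^ \<beta> i) \<in> near (\<lambda>z. 0) k)"
  have "\<forall>\<^sub>F n in sequentially. ?goal n"
    using f_near low lead J A(1) by (intro eventually_conj eventually_ball_finite ballI) auto
  then obtain n where "?goal n"
    unfolding eventually_sequentially by blast
  then show ?thesis by (intro exI[of _ "f n"] exI[of _ n])
qed

end

section \<open>Genericity of steered sequences\<close>

lemma continuous_map_entire_topI:
  assumes "\<And>x. x \<in> topspace X \<Longrightarrow> F x holomorphic_on UNIV"
    "\<And>x k. x \<in> topspace X \<Longrightarrow> \<exists>U. openin X U \<and> x \<in> U \<and> (\<forall>y\<in>U. F y \<in> near (F x) k)"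
  shows "continuous_map X entire_top F"
  unfolding continuous_map_def
proof (intro conjI allI impI)
  show "F \<in> topspace X \<rightarrow> topspace entire_top" using assms(1) by (simp add: topspace_entire_top)
  fix V assume V: "openin entire_top V"
  show "openin X {x \<in> topspace X. F x \<in> V}"
  proof (subst openin_subopen, intro ballI)
    fix x assume x: "x \<in> {x \<in> topspace X. F x \<in> V}"
    then obtain k where k: "near (F x) k \<subseteq> V" using V unfolding openin_entire_top_iff by blast
    from x have "x \<in> topspace X" by simp
    from assms(2)[OF this, of k] obtain U where U: "openin X U" "x \<in> U" "\<forall>y\<in>U. F y \<in> near (F x) k" by blast
    have "U \<subseteq> {x \<in> topspace X. F x \<in> V}" using U(3) k openin_subset[OF U(1)] by blast
    with U(1,2) show "\<exists>U. openin X U \<and> x \<in> U \<and> U \<subseteq> {x \<in> topspace X. F x \<in> V}" by blast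
  qed
qed

lemma continuous_map_entire_top_near:
  assumes "continuous_map X entire_top F" "x \<in> topspace X"
  obtains U where "openin X U" "x \<in> U" "\<And>y. y \<in> U \<Longrightarrow> F y \<in> near (F x) k"
proof -
  have hol: "F x holomorphic_on UNIV"
    using assms continuous_map_image_subset_topspace[OF assms(1)] by (auto simp: topspace_entire_top)
  have "openin X {y \<in> topspace X. F y \<in> near (F x) k}"
    using assms(1) by (rule openin_continuous_map_preimage) (rule openin_near[OF hol])
  then show thesis
    using assms(2) near_self[OF hol] by (intro that[of "{y \<in> topspace X. F y \<in> near (F x) k}"]) auto
qed

lemma mult_near:
  assumes f: "f holomorphic_on UNIV" and g: "g holomorphic_on UNIV"
  shows "\<exists>l. \<forall>f'\<in>near f l. \<forall>g'\<in>near g l. (\<lambda>z. f' z * g' z) \<in> near (\<lambda>z. f z * g z) k"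
proof -
  obtain A where A: "\<And>z. z \<in> cball 0 (real k) \<Longrightarrow> norm (f z) \<le> A" using entire_bounded_cball[OF f] by blast
  obtain B where B: "\<And>z. z \<in> cball 0 (real k) \<Longrightarrow> norm (g z) \<le> B" using entire_bounded_cball[OF g] by blast
  have AB: "A \<ge> 0" "B \<ge> 0" using order_trans[OF norm_ge_zero A[of 0]] order_trans[OF norm_ge_zero B[of 0]] by auto
  obtain l where l: "l \<ge> k" "1 / (real l + 1) < 1 / (real k + 1) / (A + B + 1)"
    using ex_nat_inverse_less[of "1 / (real k + 1) / (A + B + 1)" k] AB by auto
  have "(\<lambda>z. f' z * g' z) \<in> near (\<lambda>z. f z * g z) k" if f': "f' \<in> near f l" and g': "g' \<in> near g l" for f' g'
  proof -
    have hol: "(\<lambda>z. f' z * g' z) holomorphic_on UNIV"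
      using f' g' by (intro holomorphic_intros) (auto simp: near_def)
    have "dist (f' z * g' z) (f z * g z) < 1 / (real k + 1)" if z: "z \<in> cball 0 (real k)" for z
    proof -
      define e where "e = 1 / (real l + 1)"
      have e: "0 < e" "e \<le> 1" by (auto simp: e_def)
      have zl: "z \<in> cball 0 (real l)" using z l(1) by simp
      have df: "norm (f' z - f z) \<le> e" and dg: "norm (g' z - g z) \<le> e"
        using f' g' zl by (auto simp: near_def dist_norm e_def less_imp_le)
      have "norm (g' z) \<le> norm (g z) + norm (g' z - g z)" by (rule norm_triangle_sub)
      then have gB: "norm (g' z) \<le> B + 1" using B[OF z] dg e by linarith
      have "f' z * g' z - f z * g z = (f' z - f z) * g' z + f z * (g' z - g z)" by (simp add: algebra_simps)
      then have "dist (f' z * g' z) (f z * g z) \<le> norm (f' z - f z) * norm (g' z) + norm (f z) * norm (g' z - g z)"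
        unfolding dist_norm norm_mult[symmetric] by (simp only: norm_triangle_ineq)
      also have "\<dots> \<le> e * (B + 1) + A * e"
        using df dg gB A[OF z] e AB by (intro add_mono mult_mono) auto
      also have "\<dots> = e * (A + B + 1)" by (simp add: algebra_simps)
      also have "\<dots> < 1 / (real k + 1) / (A + B + 1) * (A + B + 1)"
        using l(2) AB by (intro mult_strict_right_mono) (auto simp: e_def)
      also have "\<dots> = 1 / (real k + 1)" using AB by simp
      finally show ?thesis .
    qed
    with hol show ?thesis by (simp add: near_def)
  qed
  then show ?thesis by blast
qed

lemma continuous_map_entire_mult:
  assumes F: "continuous_map X entire_top F" and G: "continuous_map X entire_top G"
  shows "continuous_map X entire_top (\<lambda>x z. F x z * G x z)"
proof (rule continuous_map_entire_topI)
  fix x k assume x: "x \<in> topspace X"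
  have hol: "F x holomorphic_on UNIV" "G x holomorphic_on UNIV"
    using x continuous_map_image_subset_topspace[OF F] continuous_map_image_subset_topspace[OF G]
    by (auto simp: topspace_entire_top)
  then show "(\<lambda>z. F x z * G x z) holomorphic_on UNIV" by (intro holomorphic_intros)
  obtain l where l: "\<forall>f'\<in>near (F x) l. \<forall>g'\<in>near (G x) l. (\<lambda>z. f' z * g' z) \<in> near (\<lambda>z. F x z * G x z) k"
    using mult_near[OF hol] by blast
  obtain U where U: "openin X U" "x \<in> U" "\<And>y. y \<in> U \<Longrightarrow> F y \<in> near (F x) l"
    using continuous_map_entire_top_near[OF F x] by blast
  obtain V where V: "openin X V" "x \<in> V" "\<And>y. y \<in> V \<Longrightarrow> G y \<in> near (G x) l"
    using continuous_map_entire_top_near[OF G x] by blast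
  have "openin X (U \<inter> V)" using U V by blast
  moreover have "\<forall>y\<in>U \<inter> V. (\<lambda>z. F y z * G y z) \<in> near (\<lambda>z. F x z * G x z) k" using l U(3) V(3) by blast
  ultimately show "\<exists>U. openin X U \<and> x \<in> U \<and> (\<forall>y\<in>U. (\<lambda>z. F y z * G y z) \<in> near (\<lambda>z. F x z * G x z) k)"
    using U(2) V(2) by (intro exI[of _ "U \<inter> V"]) auto
qed

lemma continuous_map_entire_power:
  assumes F: "continuous_map X entire_top F"
  shows "continuous_map X entire_top (\<lambda>x z. F x z ^ n)"
proof (induction n)
  case 0
  show ?case by (simp add: topspace_entire_top)
next
  case (Suc n)
  show ?case using continuous_map_entire_mult[OF F Suc] by simp
qed

definition power_product :: "('i \<Rightarrow> nat) \<Rightarrow> ('i \<Rightarrow> complex \<Rightarrow> complex) \<Rightarrow> complex \<Rightarrow> complex" where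
  "power_product e f = (\<lambda>z. \<Prod>i | e i \<noteq> 0. f i z ^ e i)"

lemma power_product_eq:
  assumes "finite J" "{i. e i \<noteq> 0} \<subseteq> J"
  shows "power_product e f = (\<lambda>z. \<Prod>i\<in>J. f i z ^ e i)"
  unfolding power_product_def using assms by (intro ext prod.mono_neutral_left) auto

lemma continuous_map_power_product:
  assumes "finite {i. e i \<noteq> 0}" "{i. e i \<noteq> 0} \<subseteq> I"
  shows "continuous_map (entire_power_top I) entire_top (power_product e)"
proof -
  have "continuous_map (entire_power_top I) entire_top (\<lambda>f z. \<Prod>i\<in>J. f i z ^ e i)" if "finite J" "J \<subseteq> I" for J
    using that
  proof (induction J rule: finite_induct)
    case empty
    show ?case by (simp add: topspace_entire_top)
  next
    case (insert j J)
    have "continuous_map (entire_power_top I) entire_top (\<lambda>f. f j)"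
      using insert.prems by (intro continuous_map_product_projection) auto
    then have "continuous_map (entire_power_top I) entire_top (\<lambda>f z. f j z ^ e j * (\<Prod>i\<in>J. f i z ^ e i))"
      using insert by (intro continuous_map_entire_mult continuous_map_entire_power) auto
    with insert.hyps show ?case by simp
  qed
  from this[OF assms] show ?thesis by (simp add: power_product_def[abs_def])
qed

text \<open>
  A basic open set restricts finitely many coordinates, so one precision \<open>k\<close> serves for all of them.
\<close>

lemma entire_power_box:
  assumes "openin (entire_power_top I) W" "x \<in> W"
  obtains J k where "finite J" "J \<subseteq> I"
    "\<And>f. f \<in> topspace (entire_power_top I) \<Longrightarrow> (\<And>i. i \<in> J \<Longrightarrow> f i \<in> near (x i) k) \<Longrightarrow> f \<in> W"
proof -
  from assms(1)[unfolded openin_product_topology_alt, THEN bspec, OF assms(2)]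
  obtain U where U: "finite {i \<in> I. U i \<noteq> topspace entire_top}" "\<forall>i\<in>I. openin entire_top (U i)"
    "x \<in> PiE I U" "PiE I U \<subseteq> W"
    by (elim exE conjE) (rule that)
  define J where "J = {i \<in> I. U i \<noteq> topspace entire_top}"
  have "\<forall>i\<in>I. \<exists>k. near (x i) k \<subseteq> U i"
  proof
    fix i assume "i \<in> I"
    then have "openin entire_top (U i)" "x i \<in> U i" using U(2,3) by (auto simp: PiE_iff)
    then show "\<exists>k. near (x i) k \<subseteq> U i" unfolding openin_entire_top_iff by blast
  qed
  then obtain \<kappa> where \<kappa>: "\<forall>i\<in>I. near (x i) (\<kappa> i) \<subseteq> U i"
    using bchoice[of I "\<lambda>i k. near (x i) k \<subseteq> U i"] by blast
  define k where "k = Max (insert 0 (\<kappa> ` J))"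
  have k: "\<kappa> i \<le> k" if "i \<in> J" for i
    unfolding k_def using U(1) that by (intro Max_ge) (auto simp: J_def)
  show thesis
  proof (rule that[of J k])
    fix f assume f: "f \<in> topspace (entire_power_top I)" "\<And>i. i \<in> J \<Longrightarrow> f i \<in> near (x i) k"
    have "f i \<in> U i" if "i \<in> I" for i
    proof (cases "i \<in> J")
      case True
      then show ?thesis using f(2) near_antimono[OF k] \<kappa> \<open>i \<in> I\<close> by blast
    next
      case False
      then show ?thesis using f(1) that by (auto simp: J_def PiE_iff)
    qed
    then have "f \<in> PiE I U" using f(1) by (auto simp: PiE_iff)
    then show "f \<in> W" using U(4) by blast
  qed (use U(1) in \<open>auto simp: J_def\<close>)
qed

lemma dense_in_topI:
  assumes "S \<subseteq> topspace X" "\<And>W x. openin X W \<Longrightarrow> x \<in> W \<Longrightarrow> S \<inter> W \<noteq> {}"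
  shows "dense_in_top X S"
  using assms unfolding dense_in_top_def dense_intersects_open by blast

text \<open>
  The zero exponent is excluded because the polynomials in question have no constant term.
\<close>

definition exponents :: "nat set \<Rightarrow> (nat \<Rightarrow> nat) set" where
  "exponents I = {e. finite {i. e i \<noteq> 0} \<and> {i. e i \<noteq> 0} \<subseteq> I \<and> e \<noteq> (\<lambda>_. 0)}"

lemma countable_exponents: "countable (exponents I)"
proof -
  define ev where "ev = (\<lambda>xs :: nat list. \<lambda>i. if i < length xs then xs ! i else 0)"
  have "exponents I \<subseteq> range ev"
  proof
    fix e assume "e \<in> exponents I"
    then have "finite {i. e i \<noteq> 0}" by (simp add: exponents_def)
    then obtain n where n: "\<And>i. e i \<noteq> 0 \<Longrightarrow> i < n"
      using finite_nat_set_iff_bounded[of "{i. e i \<noteq> 0}"] by auto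
    have "e = ev (map e [0..<n])"
      using n by (intro ext) (auto simp: ev_def)
    then show "e \<in> range ev" by blast
  qed
  moreover have "countable (range ev)" by simp
  ultimately show ?thesis by (rule countable_subset)
qed

text \<open>
  The sums extend over all variables that occur in \<open>A\<close>.
\<close>

definition leads :: "('i \<Rightarrow> nat) \<Rightarrow> ('i \<Rightarrow> nat) set \<Rightarrow> bool" where
  "leads \<alpha> A \<longleftrightarrow> \<alpha> \<in> A \<and> (\<exists>w :: 'i \<Rightarrow> real. (\<forall>i. w i > 0) \<and>
    (\<forall>\<beta>\<in>A - {\<alpha>}. (\<Sum>i\<in>(\<Union>e\<in>A. {i. e i \<noteq> 0}). w i * real (\<beta> i)) < (\<Sum>i\<in>(\<Union>e\<in>A. {i. e i \<noteq> 0}). w i * real (\<alpha> i))))"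

lemma ex_leads:
  assumes "finite A" "A \<noteq> {}" "\<And>e. e \<in> A \<Longrightarrow> finite {i. e i \<noteq> 0}"
  shows "\<exists>\<alpha>. leads \<alpha> A"
  using leading_exponent[of "\<Union>e\<in>A. {i. e i \<noteq> 0}" A] assms unfolding leads_def by blast

context arc_operator
begin

text \<open>
  The tuples for which one iterate moves the leading power product near \<open>d\<close> and all the others near
  zero, so that a polynomial with set of exponents \<open>A\<close> in such a tuple is moved near a multiple of \<open>d\<close>.
\<close>

definition steering_set :: "nat set \<Rightarrow> (nat \<Rightarrow> nat) set \<Rightarrow> (nat \<Rightarrow> nat) \<Rightarrow> (complex \<Rightarrow> complex) \<Rightarrow> nat
    \<Rightarrow> (nat \<Rightarrow> complex \<Rightarrow> complex) set" where
  "steering_set I A \<alpha> d k = {f \<in> topspace (entire_power_top I). \<exists>n.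
     (T ^^ n) (power_product \<alpha> f) \<in> near d k \<and>
     (\<forall>\<beta>\<in>A - {\<alpha>}. (T ^^ n) (power_product \<beta> f) \<in> near (\<lambda>z. 0) k)}"

definition steered :: "(complex \<Rightarrow> complex) set \<Rightarrow> nat set \<Rightarrow> (nat \<Rightarrow> complex \<Rightarrow> complex) \<Rightarrow> bool" where
  "steered D I f \<longleftrightarrow> (\<forall>A \<alpha> d k. finite A \<longrightarrow> A \<subseteq> exponents I \<longrightarrow> leads \<alpha> A \<longrightarrow> d \<in> D \<longrightarrow>
     f \<in> steering_set I A \<alpha> d k)"

lemma continuous_map_funpow: "continuous_map entire_top entire_top (T ^^ n)"
proof -
  interpret Tn: exp_diagonal_operator "T ^^ n" "\<lambda>\<mu>. \<Phi> \<mu> ^ n"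
    by (rule exp_diagonal_operator_funpow) unfold_locales
  show ?thesis
  proof (rule continuous_map_entire_topI)
    fix f k assume "f \<in> topspace entire_top"
    then have f: "f holomorphic_on UNIV" by (simp add: topspace_entire_top)
    show "(T ^^ n) f holomorphic_on UNIV" using Tn.op_entire[OF f] .
    obtain l where "\<forall>g\<in>near f l. (T ^^ n) g \<in> near ((T ^^ n) f) k" using Tn.op_near[OF f] by blast
    then show "\<exists>U. openin entire_top U \<and> f \<in> U \<and> (\<forall>y\<in>U. (T ^^ n) y \<in> near ((T ^^ n) f) k)"
      using openin_near[OF f] near_self[OF f] by (intro exI[of _ "near f l"]) auto
  qed
qed

lemma openin_steering_set:
  assumes A: "finite A" "A \<subseteq> exponents I" "\<alpha> \<in> A" and d: "d holomorphic_on UNIV"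
  shows "openin (entire_power_top I) (steering_set I A \<alpha> d k)"
proof -
  let ?X = "entire_power_top I"
  let ?U = "\<lambda>n \<beta> v. {f \<in> topspace ?X. (T ^^ n) (power_product \<beta> f) \<in> near v k}"
  have cont: "continuous_map ?X entire_top (\<lambda>f. (T ^^ n) (power_product e f))" if "e \<in> A" for n e
  proof -
    have "continuous_map ?X entire_top (power_product e)"
      using A(2) that by (intro continuous_map_power_product) (auto simp: exponents_def)
    from continuous_map_compose[OF this continuous_map_funpow[of n]] show ?thesis by (simp add: o_def)
  qed
  have pre: "openin ?X (?U n e v)"
    if "e \<in> A" "v holomorphic_on UNIV" for n e v
    using openin_continuous_map_preimage[OF cont[OF that(1)] openin_near[OF that(2)]] .
  have zero: "(\<lambda>z::complex. 0::complex) holomorphic_on UNIV" by simp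
  have "openin ?X (topspace ?X \<inter> (\<Inter>\<beta>\<in>A - {\<alpha>}. ?U n \<beta> (\<lambda>z. 0)))" for n
  proof (cases "A - {\<alpha>} = {}")
    case False
    then have "openin ?X (\<Inter>\<beta>\<in>A - {\<alpha>}. ?U n \<beta> (\<lambda>z. 0))"
      using A(1) pre zero by (intro openin_Inter) auto
    then show ?thesis by blast
  qed (simp only: INF_empty Int_UNIV_right image_empty Inter_empty openin_topspace)
  then have "openin ?X (\<Union>n. ?U n \<alpha> d \<inter>
      (topspace ?X \<inter> (\<Inter>\<beta>\<in>A - {\<alpha>}. ?U n \<beta> (\<lambda>z. 0))))"
    using pre[OF A(3) d] by (intro openin_Union) auto
  also have "(\<Union>n. ?U n \<alpha> d \<inter>
      (topspace ?X \<inter> (\<Inter>\<beta>\<in>A - {\<alpha>}. ?U n \<beta> (\<lambda>z. 0))))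
    = steering_set I A \<alpha> d k"
    unfolding steering_set_def by blast
  finally show ?thesis .
qed

text \<open>
  A basic open set constrains finitely many coordinates, and \<open>A\<close> involves finitely many. These
  coordinates are chosen by \<open>power_product_transitivity\<close>, with the weights rescaled to give \<open>\<alpha>\<close> total
  weight one, and all others stay as they are.
\<close>

lemma dense_steering_set:
  assumes A: "finite A" "A \<subseteq> exponents I" "leads \<alpha> A" and d: "d holomorphic_on UNIV"
  shows "dense_in_top (entire_power_top I) (steering_set I A \<alpha> d k)"
proof (rule dense_in_topI)
  show "steering_set I A \<alpha> d k \<subseteq> topspace (entire_power_top I)"
    unfolding steering_set_def by blast
  fix W x assume W: "openin (entire_power_top I) W" "x \<in> W"
  have xtop: "x \<in> topspace (entire_power_top I)" using openin_subset[OF W(1)] W(2) by blast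
  then have x_hol: "x i holomorphic_on UNIV" if "i \<in> I" for i
    using that by (auto simp: PiE_iff topspace_entire_top)
  obtain J0 k0 where J0: "finite J0" "J0 \<subseteq> I"
    "\<And>f. f \<in> topspace (entire_power_top I) \<Longrightarrow> (\<And>i. i \<in> J0 \<Longrightarrow> f i \<in> near (x i) k0) \<Longrightarrow> f \<in> W"
    using entire_power_box[OF W] by blast
  define S where "S = (\<Union>e\<in>A. {i. e i \<noteq> 0})"
  have S: "finite S" "S \<subseteq> I" using A(1,2) by (auto simp: S_def exponents_def)
  define J where "J = J0 \<union> S"
  have J: "finite J" "J \<subseteq> I" "S \<subseteq> J" "J0 \<subseteq> J" using J0 S by (auto simp: J_def)
  have \<alpha>A: "\<alpha> \<in> A" using A(3) by (simp add: leads_def)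
  obtain w where w: "\<And>i. w i > 0"
    "\<And>\<beta>. \<beta> \<in> A - {\<alpha>} \<Longrightarrow> (\<Sum>i\<in>S. w i * real (\<beta> i)) < (\<Sum>i\<in>S. w i * real (\<alpha> i))"
    using A(3) unfolding leads_def S_def by blast
  have toJ: "(\<Sum>i\<in>J. w i * real (e i)) = (\<Sum>i\<in>S. w i * real (e i))" if "e \<in> A" for e
    using J that by (intro sum.mono_neutral_right) (auto simp: S_def)
  \<comment> \<open>positive because \<open>\<alpha>\<close> is not the zero exponent\<close>
  define N where "N = (\<Sum>i\<in>J. w i * real (\<alpha> i))"
  have N: "N > 0"
  proof -
    have "\<alpha> \<noteq> (\<lambda>_. 0)" using A(2) \<alpha>A by (auto simp: exponents_def)
    then obtain i where i: "\<alpha> i \<noteq> 0" by (auto simp: fun_eq_iff)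
    then have "i \<in> J" using \<alpha>A J(3) by (auto simp: S_def)
    then show ?thesis
      unfolding N_def using J(1) w(1)[of i] i less_imp_le[OF w(1)]
      by (intro sum_pos2[of J i]) (simp_all add: mult_nonneg_nonneg)
  qed
  define w' where "w' = (\<lambda>i. w i / N)"
  have w'_sum: "(\<Sum>i\<in>J. w' i * real (e i)) = (\<Sum>i\<in>J. w i * real (e i)) / N" for e
    by (simp add: w'_def sum_divide_distrib)
  have "\<exists>f n. (\<forall>i\<in>J. f i \<in> near (x i) (max k0 k)) \<and>
    (T ^^ n) (\<lambda>z. \<Prod>i\<in>J. f i z ^ \<alpha> i) \<in> near d (max k0 k) \<and>
    (\<forall>\<beta>\<in>A - {\<alpha>}. (T ^^ n) (\<lambda>z. \<Prod>i\<in>J. f i z ^ \<beta> i) \<in> near (\<lambda>z. 0) (max k0 k))"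
  proof (rule power_product_transitivity[where w = w'])
    show "w' i > 0" for i using w(1) N by (simp add: w'_def)
    show "(\<Sum>i\<in>J. w' i * real (\<alpha> i)) = 1" unfolding w'_sum N_def[symmetric] using N by simp
    show "(\<Sum>i\<in>J. w' i * real (\<beta> i)) < 1" if "\<beta> \<in> A" "\<beta> \<noteq> \<alpha>" for \<beta>
      using w(2)[of \<beta>] that toJ[OF that(1)] toJ[OF \<alpha>A] N unfolding w'_sum by (simp add: N_def)
  qed (use J A \<alpha>A d x_hol in auto)
  then obtain f n where f: "\<And>i. i \<in> J \<Longrightarrow> f i \<in> near (x i) (max k0 k)"
    "(T ^^ n) (\<lambda>z. \<Prod>i\<in>J. f i z ^ \<alpha> i) \<in> near d (max k0 k)"
    "\<And>\<beta>. \<beta> \<in> A - {\<alpha>} \<Longrightarrow> (T ^^ n) (\<lambda>z. \<Prod>i\<in>J. f i z ^ \<beta> i) \<in> near (\<lambda>z. 0) (max k0 k)"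
    by blast
  define h where "h = (\<lambda>i. if i \<in> J then f i else x i)"
  have htop: "h \<in> topspace (entire_power_top I)"
    using xtop f(1) J(2) by (fastforce simp: h_def PiE_iff extensional_def topspace_entire_top near_def)
  have hp: "power_product e h = (\<lambda>z. \<Prod>i\<in>J. f i z ^ e i)" if "e \<in> A" for e
    using power_product_eq[of J e h] J that by (auto simp: S_def h_def)
  have mono: "near g (max k0 k) \<subseteq> near g k0" "near g (max k0 k) \<subseteq> near g k" for g
    by (auto intro!: near_antimono)
  have "h i \<in> near (x i) k0" if "i \<in> J0" for i
    using f(1)[of i] mono(1) that J(4) by (auto simp: h_def)
  then have "h \<in> W" by (rule J0(3)[OF htop])
  moreover have "(T ^^ n) (power_product \<alpha> h) \<in> near d k"
    unfolding hp[OF \<alpha>A] using f(2) mono(2) by blast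
  moreover have "(T ^^ n) (power_product \<beta> h) \<in> near (\<lambda>z. 0) k" if "\<beta> \<in> A - {\<alpha>}" for \<beta>
  proof -
    have "\<beta> \<in> A" using that by simp
    show ?thesis unfolding hp[OF \<open>\<beta> \<in> A\<close>] using f(3)[OF that] mono(2) by blast
  qed
  ultimately have "h \<in> steering_set I A \<alpha> d k \<inter> W"
    unfolding steering_set_def using htop by blast
  then show "steering_set I A \<alpha> d k \<inter> W \<noteq> {}" by blast
qed

text \<open>
  To approach \<open>v\<close>, steer the leading power product towards \<open>v\<close> divided by its coefficient. All other
  terms of the sum become small at the same time.
\<close>

lemma hypercyclic_if_steered:
  fixes c :: "'m \<Rightarrow> complex"
  assumes D: "\<And>d. d \<in> D \<Longrightarrow> d holomorphic_on UNIV"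
      "\<And>v k. v holomorphic_on UNIV \<Longrightarrow> near v k \<inter> D \<noteq> {}"
    and f: "f \<in> topspace (entire_power_top I)" "steered D I f"
    and M: "finite M" "M \<noteq> {}" "inj_on e M" "e ` M \<subseteq> exponents I" "\<And>m. m \<in> M \<Longrightarrow> c m \<noteq> 0"
  shows "hypercyclic_vector entire_top T (\<lambda>z. \<Sum>m\<in>M. c m * power_product (e m) f z)"
proof -
  define h where "h = (\<lambda>z. \<Sum>m\<in>M. c m * power_product (e m) f z)"
  have f_hol: "f i holomorphic_on UNIV" if "i \<in> I" for i
    using f(1) that by (auto simp: PiE_iff topspace_entire_top)
  have supp: "{i. e m i \<noteq> 0} \<subseteq> I" if "m \<in> M" for m using M(4) that by (auto simp: exponents_def)
  have pp_hol: "power_product (e m) f holomorphic_on UNIV" if "m \<in> M" for m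
    unfolding power_product_def using supp[OF that] f_hol by (intro holomorphic_intros) auto
  have h_hol: "h holomorphic_on UNIV"
    unfolding h_def using pp_hol by (intro holomorphic_intros) auto
  have iter_hol: "(T ^^ n) h holomorphic_on UNIV" for n
    using h_hol by (induction n) (auto intro: op_entire)
  obtain \<alpha> where \<alpha>: "leads \<alpha> (e ` M)"
    using ex_leads[of "e ` M"] M by (auto simp: exponents_def)
  then obtain m0 where m0: "m0 \<in> M" "\<alpha> = e m0" by (auto simp: leads_def)
  have reach: "\<exists>n. (T ^^ n) h \<in> near v k" if v: "v holomorphic_on UNIV" for v k
  proof -
    define S where "S = (\<Sum>m\<in>M. norm (c m))"
    have S: "S \<ge> 0" unfolding S_def by (intro sum_nonneg) auto
    obtain l where l: "l \<ge> k" "1 / (real l + 1) < 1 / (real k + 1) / (2 * S + 1)"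
      using ex_nat_inverse_less[of "1 / (real k + 1) / (2 * S + 1)" k] S by auto
    define r where "r = 1 / (real l + 1)"
    have r: "r > 0" by (simp add: r_def)
    have "(\<lambda>z. v z / c m0) holomorphic_on UNIV" using v M(5)[OF m0(1)] by (intro holomorphic_intros) auto
    then obtain d where d: "d \<in> D" "d \<in> near (\<lambda>z. v z / c m0) l" using D(2) by blast
    have "f \<in> steering_set I (e ` M) \<alpha> d l" using f(2) M \<alpha> d by (simp add: steered_def)
    then obtain n where n: "(T ^^ n) (power_product \<alpha> f) \<in> near d l"
      "\<forall>\<beta>\<in>e ` M - {\<alpha>}. (T ^^ n) (power_product \<beta> f) \<in> near (\<lambda>z. 0) l"
      unfolding steering_set_def by blast
    interpret Tn: exp_diagonal_operator "T ^^ n" "\<lambda>\<mu>. \<Phi> \<mu> ^ n"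
      by (rule exp_diagonal_operator_funpow) unfold_locales
    have Tnh: "(T ^^ n) h = (\<lambda>z. \<Sum>m\<in>M. c m * (T ^^ n) (power_product (e m) f) z)"
    proof -
      have "(T ^^ n) h = (\<lambda>z. \<Sum>m\<in>M. (T ^^ n) (\<lambda>z. c m * power_product (e m) f z) z)"
        unfolding h_def by (rule Tn.op_sum[OF M(1)]) (intro holomorphic_intros pp_hol)
      then show ?thesis using pp_hol by (simp add: Tn.op_cmult cong: sum.cong)
    qed
    have "dist ((T ^^ n) h z) (v z) < 1 / (real k + 1)" if z: "z \<in> cball 0 (real k)" for z
    proof -
      have zl: "z \<in> cball 0 (real l)" using z l(1) by simp
      \<comment> \<open>the approximate position of the \<open>m\<close>-th power product after \<open>n\<close> steps\<close>
      define t where "t = (\<lambda>m. if m = m0 then v z / c m0 else 0)"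
      have err: "dist ((T ^^ n) (power_product (e m) f) z) (t m) \<le> 2 * r" if "m \<in> M" for m
      proof (cases "m = m0")
        case True
        have "dist ((T ^^ n) (power_product \<alpha> f) z) (d z) < r" "dist (d z) (v z / c m0) < r"
          using n(1) d(2) zl by (auto simp: near_def r_def)
        then show ?thesis
          using dist_triangle[of "(T ^^ n) (power_product \<alpha> f) z" "v z / c m0" "d z"] True m0(2) by (simp add: t_def)
      next
        case False
        then have "e m \<in> e ` M - {\<alpha>}" using that m0 M(3) by (auto simp: inj_on_eq_iff)
        then have "(T ^^ n) (power_product (e m) f) \<in> near (\<lambda>z. 0) l" using n(2) by blast
        then have "dist ((T ^^ n) (power_product (e m) f) z) 0 < r"
          using zl unfolding near_def r_def by blast
        then show ?thesis using False r by (simp add: t_def)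
      qed
      have "v z = (\<Sum>m\<in>M. c m * t m)"
        using M(1,5) m0(1) by (simp add: t_def if_distrib[of "\<lambda>x. c _ * x"] cong: if_cong)
      then have "dist ((T ^^ n) h z) (v z) = norm (\<Sum>m\<in>M. c m * ((T ^^ n) (power_product (e m) f) z - t m))"
        by (simp add: Tnh dist_norm sum_subtractf[symmetric] right_diff_distrib)
      also have "\<dots> \<le> (\<Sum>m\<in>M. norm (c m) * (2 * r))"
        using err by (intro sum_norm_le) (auto simp: norm_mult dist_norm intro!: mult_left_mono)
      also have "\<dots> = r * (2 * S)" by (simp add: S_def sum_distrib_left sum_distrib_right algebra_simps)
      also have "\<dots> < r * (2 * S + 1)" using r by simp
      also have "\<dots> < 1 / (real k + 1) / (2 * S + 1) * (2 * S + 1)"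
        using l(2) S unfolding r_def by (intro mult_strict_right_mono) auto
      also have "\<dots> = 1 / (real k + 1)" using S by simp
      finally show ?thesis .
    qed
    then show ?thesis using iter_hol[of n] by (intro exI[of _ n]) (simp add: near_def)
  qed
  have "dense_in_top entire_top (range (\<lambda>n. (T ^^ n) h))"
  proof (rule dense_in_topI)
    show "range (\<lambda>n. (T ^^ n) h) \<subseteq> topspace entire_top" using iter_hol by (auto simp: topspace_entire_top)
    fix W v assume "openin entire_top W" "v \<in> W"
    then obtain k where k: "near v k \<subseteq> W" and v: "v holomorphic_on UNIV"
      unfolding openin_entire_top_iff by blast
    obtain n where "(T ^^ n) h \<in> near v k" using reach[OF v] by blast
    then show "range (\<lambda>n. (T ^^ n) h) \<inter> W \<noteq> {}" using k by blast
  qed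
  then show ?thesis unfolding hypercyclic_vector_def h_def[symmetric] using h_hol by (simp add: topspace_entire_top)
qed

lemma residual_steering:
  assumes D: "countable D" "\<And>d. d \<in> D \<Longrightarrow> d holomorphic_on UNIV"
  shows "\<exists>\<G>. countable \<G> \<and> (\<forall>G\<in>\<G>. openin (entire_power_top I) G \<and> dense_in_top (entire_power_top I) G) \<and>
    (\<forall>f\<in>\<Inter>\<G>. steered D I f)"
proof -
  define idx where "idx = {(A, \<alpha>, d, k :: nat). (A \<in> {A. finite A \<and> A \<subseteq> exponents I} \<and> \<alpha> \<in> exponents I \<and> d \<in> D) \<and> leads \<alpha> A}"
  define \<G> where "\<G> = (\<lambda>(A, \<alpha>, d, k). steering_set I A \<alpha> d k) ` idx"
  have "countable ({A. finite A \<and> A \<subseteq> exponents I} \<times> exponents I \<times> D \<times> (UNIV :: nat set))"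
    using countable_exponents D(1) by (intro countable_SIGMA countable_Collect_finite_subset) auto
  then have "countable idx" by (rule countable_subset[rotated]) (auto simp: idx_def)
  then have "countable \<G>" unfolding \<G>_def by (rule countable_image)
  moreover have "openin (entire_power_top I) G \<and> dense_in_top (entire_power_top I) G" if G: "G \<in> \<G>" for G
  proof -
    obtain A \<alpha> d k where A: "finite A" "A \<subseteq> exponents I" "leads \<alpha> A" "d \<in> D" "G = steering_set I A \<alpha> d k"
      using G unfolding \<G>_def idx_def by auto
    have "\<alpha> \<in> A" using A(3) by (simp add: leads_def)
    then show ?thesis
      unfolding A(5) using openin_steering_set[OF A(1,2)] dense_steering_set[OF A(1-3)] D(2)[OF A(4)] by blast
  qed
  moreover have "f \<in> steering_set I A \<alpha> d k"
    if "f \<in> \<Inter>\<G>" "finite A" "A \<subseteq> exponents I" "leads \<alpha> A" "d \<in> D" for f A \<alpha> d k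
  proof -
    have "\<alpha> \<in> exponents I" using that(3,4) by (auto simp: leads_def)
    then have "(A, \<alpha>, d, k) \<in> idx" using that by (simp add: idx_def)
    then have "steering_set I A \<alpha> d k \<in> \<G>" unfolding \<G>_def by (rule rev_image_eqI) simp
    then show ?thesis using that(1) by blast
  qed
  ultimately show ?thesis by (intro exI[of _ \<G>]) (simp add: steered_def)
qed

end

text \<open>
  Given finitely many constraints, some coordinate is still free and can be set to \<open>d\<close>.
\<close>

lemma generic_sequence_dense:
  assumes d: "d holomorphic_on UNIV"
  shows "openin (entire_power_top UNIV) {f \<in> topspace (entire_power_top UNIV). \<exists>j. f j \<in> near d k}"
    "dense_in_top (entire_power_top UNIV) {f \<in> topspace (entire_power_top UNIV). \<exists>j. f j \<in> near d k}"
proof -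
  let ?X = "entire_power_top UNIV"
  let ?E = "{f \<in> topspace ?X. \<exists>j. f j \<in> near d k}"
  have cont: "continuous_map ?X entire_top (\<lambda>f. f j)" for j
    by (rule continuous_map_product_projection) simp
  have "openin ?X {f \<in> topspace ?X. f j \<in> near d k}" for j
    by (rule openin_continuous_map_preimage[OF cont openin_near[OF d]])
  then have "openin ?X (\<Union>j. {f \<in> topspace ?X. f j \<in> near d k})" by (intro openin_Union) auto
  also have "(\<Union>j. {f \<in> topspace ?X. f j \<in> near d k}) = ?E" by blast
  finally show "openin ?X ?E" .
  show "dense_in_top ?X ?E"
  proof (rule dense_in_topI)
    fix W x assume W: "openin ?X W" "x \<in> W"
    have x: "x \<in> topspace ?X" using openin_subset[OF W(1)] W(2) by blast
    then have x_hol: "x i holomorphic_on UNIV" for i by (auto simp: PiE_iff topspace_entire_top)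
    obtain J l where J: "finite J" "J \<subseteq> UNIV"
      "\<And>f. f \<in> topspace ?X \<Longrightarrow> (\<And>i. i \<in> J \<Longrightarrow> f i \<in> near (x i) l) \<Longrightarrow> f \<in> W"
      using entire_power_box[OF W] by blast
    obtain j where j: "j \<notin> J" using ex_new_if_finite[OF infinite_UNIV_nat J(1)] by blast
    have top: "x(j := d) \<in> topspace ?X" using x d by (auto simp: PiE_iff topspace_entire_top)
    have "x(j := d) \<in> W"
      by (rule J(3)[OF top]) (use j near_self[OF x_hol] in auto)
    moreover have "\<exists>i. (x(j := d)) i \<in> near d k" using near_self[OF d] by (intro exI[of _ j]) simp
    ultimately have "x(j := d) \<in> ?E \<inter> W" using top by blast
    then show "?E \<inter> W \<noteq> {}" by blast
  qed (rule Collect_restrict)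
qed

section \<open>Polynomials and generated algebras\<close>

abbreviation keys :: "('k \<Rightarrow>\<^sub>0 'v::zero) \<Rightarrow> 'k set" where
  "keys \<equiv> Poly_Mapping.keys"

abbreviation lookup :: "('k \<Rightarrow>\<^sub>0 'v::zero) \<Rightarrow> 'k \<Rightarrow> 'v" where
  "lookup \<equiv> Poly_Mapping.lookup"

abbreviation single :: "'k \<Rightarrow> 'v \<Rightarrow> ('k \<Rightarrow>\<^sub>0 'v::zero)" where
  "single \<equiv> Poly_Mapping.single"

abbreviation monomial_at :: "(nat \<Rightarrow>\<^sub>0 nat) \<Rightarrow> (nat \<Rightarrow> complex) \<Rightarrow> complex" where
  "monomial_at m x \<equiv> \<Prod>j\<in>keys m. x j ^ lookup m j"

lemma cmpoly_monomial_eq: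
  assumes "finite J" "keys m \<subseteq> J"
  shows "monomial_at m x = (\<Prod>j\<in>J. x j ^ lookup m j)"
  using assms by (intro prod.mono_neutral_left) (auto simp: in_keys_iff)

lemma cmpoly_monomial_add:
  "monomial_at (m + m') x =
   monomial_at m x * monomial_at m' x"
proof -
  let ?J = "keys m \<union> keys m'"
  have "monomial_at (m + m') x =
    (\<Prod>j\<in>?J. x j ^ lookup (m + m') j)"
    using keys_add[of m m'] by (intro cmpoly_monomial_eq) auto
  also have "\<dots> = (\<Prod>j\<in>?J. x j ^ lookup m j) * (\<Prod>j\<in>?J. x j ^ lookup m' j)"
    by (simp add: lookup_add power_add prod.distrib)
  also have "(\<Prod>j\<in>?J. x j ^ lookup m j) = monomial_at m x"
    by (intro cmpoly_monomial_eq[symmetric]) auto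
  also have "(\<Prod>j\<in>?J. x j ^ lookup m' j) = monomial_at m' x"
    by (intro cmpoly_monomial_eq[symmetric]) auto
  finally show ?thesis .
qed

lemma cmpoly_eval_superset:
  assumes "finite S" "keys P \<subseteq> S"
  shows "cmpoly_eval P x = (\<Sum>m\<in>S. lookup P m * monomial_at m x)"
  unfolding cmpoly_eval_def using assms by (intro sum.mono_neutral_left) (auto simp: in_keys_iff)

lemma cmpoly_eval_add: "cmpoly_eval (P + Q) x = cmpoly_eval P x + cmpoly_eval Q x"
proof -
  let ?S = "keys P \<union> keys Q"
  have "finite ?S" by simp
  note sup = cmpoly_eval_superset[OF this]
  have "keys (P + Q) \<subseteq> ?S" by (rule keys_add)
  from sup[OF this] sup[of P] sup[of Q] show ?thesis
    by (simp add: lookup_add distrib_right sum.distrib)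
qed

lemma cmpoly_eval_single:
  "cmpoly_eval (single m c) x = c * monomial_at m x"
  by (cases "c = 0") (simp_all add: cmpoly_eval_def)

lemma cmpoly_eval_zero [simp]: "cmpoly_eval 0 x = 0"
  by (simp add: cmpoly_eval_def)

lemma cmpoly_eval_sum: "finite A \<Longrightarrow> cmpoly_eval (sum F A) x = (\<Sum>i\<in>A. cmpoly_eval (F i) x)"
  by (induction A rule: finite_induct) (simp_all add: cmpoly_eval_add)

lemma poly_mapping_eq_sum_single:
  "(P :: 'k \<Rightarrow>\<^sub>0 'v::comm_monoid_add) = (\<Sum>m\<in>keys P. single m (lookup P m))"
proof (rule poly_mapping_eqI)
  fix k
  show "lookup P k =
    lookup (\<Sum>m\<in>keys P. single m (lookup P m)) k"
    by (cases "k \<in> keys P") (auto simp: lookup_sum lookup_single when_def in_keys_iff sum.delta)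
qed

lemma cmpoly_eval_mult: "cmpoly_eval (P * Q) x = cmpoly_eval P x * cmpoly_eval Q x"
proof -
  have "P * Q = (\<Sum>m\<in>keys P. single m (lookup P m)) *
      (\<Sum>m\<in>keys Q. single m (lookup Q m))"
    using poly_mapping_eq_sum_single[of P] poly_mapping_eq_sum_single[of Q] by simp
  also have "\<dots> = (\<Sum>m\<in>keys P. \<Sum>m'\<in>keys Q.
      single (m + m') (lookup P m * lookup Q m'))"
    by (simp add: sum_product mult_single)
  finally have "cmpoly_eval (P * Q) x = (\<Sum>m\<in>keys P. \<Sum>m'\<in>keys Q.
      lookup P m * lookup Q m' *
      (monomial_at m x * monomial_at m' x))"
    by (simp only: cmpoly_eval_sum finite_keys cmpoly_eval_single cmpoly_monomial_add)
  also have "\<dots> = cmpoly_eval P x * cmpoly_eval Q x"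
    unfolding cmpoly_eval_def sum_product by (intro sum.cong refl) (simp add: ac_simps)
  finally show ?thesis .
qed

lemma cmpoly_eval_const: "cmpoly_eval (single 0 c) x = c"
  by (simp add: cmpoly_eval_single)

lemma cmpoly_eval_var: "cmpoly_eval (single (single j (Suc 0)) c) x = c * x j"
  by (simp add: cmpoly_eval_single)

lemma cmpoly_eval_at_zero: "cmpoly_eval P (\<lambda>_. 0) = lookup P 0"
proof -
  have "(\<Prod>j\<in>keys m. (0::complex) ^ lookup m j) = (if m = 0 then 1 else 0)" for m :: "nat \<Rightarrow>\<^sub>0 nat"
  proof (cases "m = 0")
    case False
    then obtain j where "j \<in> keys m" by (metis keys_eq_empty all_not_in_conv)
    then show ?thesis using False by (auto simp: in_keys_iff intro!: prod_zero bexI[of _ j])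
  qed simp
  then have "cmpoly_eval P (\<lambda>_. 0) = (\<Sum>m\<in>keys P. if m = 0 then lookup P m else 0)"
    unfolding cmpoly_eval_def by (intro sum.cong) auto
  then show ?thesis by (simp add: in_keys_iff)
qed

lemma cmpoly_eval_cong:
  assumes "P \<in> polys0 n" "\<And>j. j < n \<Longrightarrow> x j = y j"
  shows "cmpoly_eval P x = cmpoly_eval P y"
proof -
  have "x j = y j" if "m \<in> keys P" "j \<in> keys m" for m j
    using assms that unfolding polys0_def by blast
  then show ?thesis
    unfolding cmpoly_eval_def by (intro sum.cong prod.cong arg_cong2[of _ _ _ _ "(*)"] refl) auto
qed

lemma polys0_mono: "P \<in> polys0 n \<Longrightarrow> n \<le> n' \<Longrightarrow> P \<in> polys0 n'"
  unfolding polys0_def by fastforce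

lemma polys0_zero: "0 \<in> polys0 n"
  by (simp add: polys0_def)

lemma polys0_add: "P \<in> polys0 n \<Longrightarrow> Q \<in> polys0 n \<Longrightarrow> P + Q \<in> polys0 n"
  unfolding polys0_def using keys_add[of P Q] by (auto simp: cmpoly_eval_add)

lemma polys0_mult:
  assumes P: "\<And>m. m \<in> keys P \<Longrightarrow> keys m \<subseteq> {..<n}" and Q: "Q \<in> polys0 n"
  shows "P * Q \<in> polys0 n"
proof -
  have "keys m \<subseteq> {..<n}" if "m \<in> keys (P * Q)" for m
  proof -
    obtain a b where ab: "m = a + b" "a \<in> keys P" "b \<in> keys Q"
      using keys_mult[of P Q] \<open>m \<in> keys (P * Q)\<close> by blast
    have "keys b \<subseteq> {..<n}" using Q ab(3) by (auto simp: polys0_def)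
    then show ?thesis using P[OF ab(2)] keys_add[of a b] ab(1) by blast
  qed
  then show ?thesis using Q by (auto simp: polys0_def cmpoly_eval_mult)
qed

lemma polys0_cmult: "P \<in> polys0 n \<Longrightarrow> single 0 c * P \<in> polys0 n"
  by (rule polys0_mult) (auto split: if_splits)

lemma polys0_var: "j < n \<Longrightarrow> single (single j 1) c \<in> polys0 n"
  by (auto simp: polys0_def cmpoly_eval_var split: if_splits)

lemma generated_algebraI:
  "P \<in> polys0 n \<Longrightarrow> {..<n} \<subseteq> I \<Longrightarrow> (\<lambda>z. cmpoly_eval P (\<lambda>j. f j z)) \<in> generated_algebra I f"
  unfolding generated_algebra_def by blast

lemma generated_algebraE:
  assumes "g \<in> generated_algebra I f"
  obtains n P where "{..<n} \<subseteq> I" "P \<in> polys0 n" "g = (\<lambda>z. cmpoly_eval P (\<lambda>j. f j z))"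
  using assms unfolding generated_algebra_def by blast

lemma generated_algebra_generator: "{..j} \<subseteq> I \<Longrightarrow> f j \<in> generated_algebra I f"
  using generated_algebraI[OF polys0_var[of j "Suc j" 1], of I f] by (simp add: cmpoly_eval_var lessThan_Suc_atMost)

lemma subalgebra_generated_algebra:
  assumes f: "\<And>i. i \<in> I \<Longrightarrow> f i holomorphic_on UNIV"
  shows "subalgebra (generated_algebra I f)"
  unfolding subalgebra_def
proof (intro conjI ballI allI subsetI)
  fix g assume "g \<in> generated_algebra I f"
  then obtain n P where P: "{..<n} \<subseteq> I" "P \<in> polys0 n" "g = (\<lambda>z. cmpoly_eval P (\<lambda>j. f j z))"
    by (rule generated_algebraE)
  have "f j holomorphic_on UNIV" if "m \<in> keys P" "j \<in> keys m" for m j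
    using P(1,2) that by (intro f) (auto simp: polys0_def)
  then show "g \<in> {f. f holomorphic_on UNIV}"
    unfolding P(3) cmpoly_eval_def by (auto intro!: holomorphic_intros)
  show "(\<lambda>z. c * g z) \<in> generated_algebra I f" for c
    using generated_algebraI[OF polys0_cmult[OF P(2)] P(1), of c f]
    by (simp add: P(3) cmpoly_eval_mult cmpoly_eval_const)
  fix h assume "h \<in> generated_algebra I f"
  then obtain n' Q where Q: "{..<n'} \<subseteq> I" "Q \<in> polys0 n'" "h = (\<lambda>z. cmpoly_eval Q (\<lambda>j. f j z))"
    by (rule generated_algebraE)
  have P': "P \<in> polys0 (max n n')" and Q': "Q \<in> polys0 (max n n')"
    using P(2) Q(2) by (auto intro: polys0_mono)
  have I: "{..<max n n'} \<subseteq> I" using P(1) Q(1) by (auto simp: max_def)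
  show "(\<lambda>z. g z + h z) \<in> generated_algebra I f"
    using generated_algebraI[OF polys0_add[OF P' Q'] I, of f] by (simp add: P(3) Q(3) cmpoly_eval_add)
  have "P * Q \<in> polys0 (max n n')" using P' Q' by (intro polys0_mult) (auto simp: polys0_def)
  from generated_algebraI[OF this I, of f] show "(\<lambda>z. g z * h z) \<in> generated_algebra I f"
    by (simp add: P(3) Q(3) cmpoly_eval_mult)
next
  show "(\<lambda>z. 0) \<in> generated_algebra I f" using generated_algebraI[OF polys0_zero, of 0 I f] by simp
qed

text \<open>
  Finitely many elements involve only finitely many of the generators, so they would express a later
  generator as a polynomial in earlier ones.
\<close>

lemma not_finitely_generated:
  assumes f: "\<And>i. f i holomorphic_on UNIV" and ind: "alg_independent UNIV f"
  shows "\<not> finitely_generated (generated_algebra UNIV f)"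
proof
  assume "finitely_generated (generated_algebra UNIV f)"
  then obtain F where F: "finite F" "F \<subseteq> generated_algebra UNIV f" "generated_algebra UNIV f = subalgebra hull F"
    unfolding finitely_generated_def by blast
  have "\<forall>g\<in>F. \<exists>n. \<exists>P\<in>polys0 n. g = (\<lambda>z. cmpoly_eval P (\<lambda>j. f j z))"
  proof
    fix g assume "g \<in> F"
    then have "g \<in> generated_algebra UNIV f" using F(2) by blast
    then show "\<exists>n. \<exists>P\<in>polys0 n. g = (\<lambda>z. cmpoly_eval P (\<lambda>j. f j z))"
      by (rule generated_algebraE) blast
  qed
  then obtain \<nu> where \<nu>: "\<forall>g\<in>F. \<exists>P\<in>polys0 (\<nu> g). g = (\<lambda>z. cmpoly_eval P (\<lambda>j. f j z))"
    using bchoice[of F "\<lambda>g n. \<exists>P\<in>polys0 n. g = (\<lambda>z. cmpoly_eval P (\<lambda>j. f j z))"] by blast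
  define N where "N = Max (insert 0 (\<nu> ` F))"
  have N: "\<nu> g \<le> N" if "g \<in> F" for g unfolding N_def using F(1) that by (intro Max_ge) auto
  have "F \<subseteq> generated_algebra {..<N} f"
  proof
    fix g assume g: "g \<in> F"
    then obtain P where P: "P \<in> polys0 (\<nu> g)" "g = (\<lambda>z. cmpoly_eval P (\<lambda>j. f j z))" using \<nu> by blast
    then show "g \<in> generated_algebra {..<N} f"
      using generated_algebraI[OF polys0_mono[OF P(1) N[OF g]] order_refl, of f] by simp
  qed
  moreover have "subalgebra (generated_algebra {..<N} f)" by (rule subalgebra_generated_algebra) (rule f)
  ultimately have "subalgebra hull F \<subseteq> generated_algebra {..<N} f" by (rule hull_minimal)
  moreover have "f N \<in> generated_algebra UNIV f" by (rule generated_algebra_generator) simp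
  ultimately have "f N \<in> generated_algebra {..<N} f" unfolding F(3) by blast
  then obtain n P where P: "{..<n} \<subseteq> {..<N}" "P \<in> polys0 n" "f N = (\<lambda>z. cmpoly_eval P (\<lambda>j. f j z))"
    by (rule generated_algebraE)
  have PN: "P \<in> polys0 N" using P(1,2) by (intro polys0_mono[OF P(2)]) auto
  let ?R = "single 0 (- 1) * P"
  \<comment> \<open>the polynomial relation that expresses \<open>f N\<close> by the earlier generators\<close>
  let ?Q = "single (single N 1) 1 + ?R"
  have R: "?R \<in> polys0 N" by (rule polys0_cmult[OF PN])
  have "single N 1 \<notin> keys ?R"
  proof
    assume "single N 1 \<in> keys ?R"
    then have "keys (single N (1::nat)) \<subseteq> {..<N}" using R unfolding polys0_def by blast
    then show False by simp
  qed
  then have "lookup ?Q (single N 1) = 1" by (simp add: lookup_add in_keys_iff)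
  then have "?Q \<noteq> 0" by (metis lookup_zero zero_neq_one)
  moreover have "?Q \<in> polys0 (Suc N)"
    using polys0_var[of N "Suc N" 1] polys0_mono[OF R, of "Suc N"] by (intro polys0_add) auto
  ultimately have "(\<lambda>z. cmpoly_eval ?Q (\<lambda>j. f j z)) \<noteq> (\<lambda>z. 0)"
    using ind unfolding alg_independent_def by blast
  moreover have "cmpoly_eval ?Q (\<lambda>j. f j z) = 0" for z
    using fun_cong[OF P(3), of z] by (simp add: cmpoly_eval_add cmpoly_eval_mult cmpoly_eval_const cmpoly_eval_var)
  ultimately show False by blast
qed

context arc_operator
begin

lemma zero_not_hypercyclic: "\<not> hypercyclic_vector entire_top T (\<lambda>z. 0)"
proof
  assume "hypercyclic_vector entire_top T (\<lambda>z. 0)"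
  then have "entire_top closure_of (range (\<lambda>n. (T ^^ n) (\<lambda>z. 0))) = topspace entire_top"
    by (simp add: hypercyclic_vector_def dense_in_top_def)
  moreover have "(T ^^ n) (\<lambda>z. 0) = (\<lambda>z. 0)" for n by (induction n) (simp_all add: op_zero)
  ultimately have cl: "entire_top closure_of {\<lambda>z. 0} = topspace entire_top" by simp
  have one: "(\<lambda>z::complex. 1::complex) holomorphic_on UNIV" by simp
  have "{\<lambda>z. 0} \<inter> near (\<lambda>z. 1) 0 \<noteq> {}"
    using cl openin_near[OF one, of 0] near_self[OF one, of 0] unfolding dense_intersects_open by blast
  then show False by (simp add: near_def)
qed

text \<open>
  The relabelling \<open>\<pi>\<close> of the variables makes the statement apply to arbitrary tuples of distinct
  terms of the sequence, as the algebraic independence of a set requires.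
\<close>

lemma steered_polynomial_hypercyclic:
  assumes D: "\<And>d. d \<in> D \<Longrightarrow> d holomorphic_on UNIV"
      "\<And>v k. v holomorphic_on UNIV \<Longrightarrow> near v k \<inter> D \<noteq> {}"
    and f: "f \<in> topspace (entire_power_top I)" "steered D I f"
    and \<pi>: "inj_on \<pi> {..<n}" "\<pi> ` {..<n} \<subseteq> I"
    and P: "P \<in> polys0 n" "P \<noteq> 0"
  shows "hypercyclic_vector entire_top T (\<lambda>z. cmpoly_eval P (\<lambda>j. f (\<pi> j) z))"
proof -
  let ?M = "keys P"
  \<comment> \<open>the exponent of the monomial \<open>m\<close> after the variable \<open>j\<close> has been renamed to \<open>\<pi> j\<close>\<close>
  define e where "e = (\<lambda>m i. if i \<in> \<pi> ` {..<n} then lookup m (inv_into {..<n} \<pi> i) else (0::nat))"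
  have e_\<pi>: "e m (\<pi> j) = lookup m j" if "j < n" for m j
    using that inv_into_f_f[OF \<pi>(1), of j] by (simp add: e_def)
  have supp: "{i. e m i \<noteq> 0} \<subseteq> \<pi> ` {..<n}" for m by (auto simp: e_def)
  have keys_n: "keys m \<subseteq> {..<n}" if "m \<in> ?M" for m using P(1) that by (auto simp: polys0_def)
  have lk0: "lookup m j = 0" if "m \<in> ?M" "\<not> j < n" for m j
    using keys_n[OF that(1)] that(2) by (auto simp: in_keys_iff)
  have pp: "power_product (e m) f = (\<lambda>z. \<Prod>j\<in>keys m. f (\<pi> j) z ^ lookup m j)"
    if "m \<in> ?M" for m
  proof
    fix z
    have "power_product (e m) f z = (\<Prod>i\<in>\<pi> ` {..<n}. f i z ^ e m i)"
      using power_product_eq[OF _ supp, of m f] by simp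
    also have "\<dots> = (\<Prod>j\<in>{..<n}. f (\<pi> j) z ^ lookup m j)"
      unfolding prod.reindex[OF \<pi>(1)] by (intro prod.cong) (auto simp: e_\<pi>)
    also have "\<dots> = (\<Prod>j\<in>keys m. f (\<pi> j) z ^ lookup m j)"
      using keys_n[OF that] by (intro cmpoly_monomial_eq[symmetric]) auto
    finally show "power_product (e m) f z = (\<Prod>j\<in>keys m. f (\<pi> j) z ^ lookup m j)" .
  qed
  have "hypercyclic_vector entire_top T (\<lambda>z. \<Sum>m\<in>?M. lookup P m * power_product (e m) f z)"
  proof (rule hypercyclic_if_steered[where D = D and I = I])
    show "d holomorphic_on UNIV" if "d \<in> D" for d by (rule D(1)[OF that])
    show "near v k \<inter> D \<noteq> {}" if "v holomorphic_on UNIV" for v k by (rule D(2)[OF that])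
    show "f \<in> topspace (entire_power_top I)" by (rule f(1))
    show "steered D I f" by (rule f(2))
    show "?M \<noteq> {}" using P(2) by simp
    show "inj_on e ?M"
    proof (rule inj_onI)
      fix m m' assume m: "m \<in> ?M" "m' \<in> ?M" "e m = e m'"
      show "m = m'"
      proof (rule poly_mapping_eqI)
        fix j show "lookup m j = lookup m' j"
          using e_\<pi>[of j m] e_\<pi>[of j m'] m lk0[of m j] lk0[of m' j] by (cases "j < n") auto
      qed
    qed
    show "e ` ?M \<subseteq> exponents I"
    proof
      fix x assume "x \<in> e ` ?M"
      then obtain m where m: "m \<in> ?M" "x = e m" by blast
      have "m \<noteq> 0"
      proof
        assume "m = 0"
        then have "lookup P 0 \<noteq> 0" using m(1) by (simp add: in_keys_iff)
        then show False using P(1) by (simp add: polys0_def cmpoly_eval_at_zero)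
      qed
      then have "keys m \<noteq> {}" by simp
      then obtain j where jm: "j \<in> keys m" by blast
      then have j: "lookup m j \<noteq> 0" by (simp add: in_keys_iff)
      have "j < n" using keys_n[OF m(1)] jm by auto
      then have "e m (\<pi> j) \<noteq> 0" using j e_\<pi> by simp
      then have "e m \<noteq> (\<lambda>_. 0)" by (rule contrapos_nn) simp
      moreover have "finite {i. e m i \<noteq> 0}" by (rule finite_subset[OF supp]) simp
      moreover have "{i. e m i \<noteq> 0} \<subseteq> I" using supp[of m] \<pi>(2) by (rule order_trans)
      ultimately show "x \<in> exponents I" unfolding m(2) exponents_def by (intro CollectI conjI)
    qed
    show "lookup P m \<noteq> 0" if "m \<in> ?M" for m using that by (simp add: in_keys_iff)
  qed simp
  moreover have "(\<lambda>z. \<Sum>m\<in>?M. lookup P m * power_product (e m) f z) = (\<lambda>z. cmpoly_eval P (\<lambda>j. f (\<pi> j) z))"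
    unfolding cmpoly_eval_def by (intro ext sum.cong refl) (simp add: pp)
  ultimately show ?thesis by (simp only:)
qed

text \<open>
  Algebraic independence is automatic: the zero function is not hypercyclic, whereas nonzero
  polynomials in the generators are.
\<close>

lemma steered_freely_generates:
  assumes D: "\<And>d. d \<in> D \<Longrightarrow> d holomorphic_on UNIV"
      "\<And>v k. v holomorphic_on UNIV \<Longrightarrow> near v k \<inter> D \<noteq> {}"
    and f: "f \<in> topspace (entire_power_top I)" "steered D I f" and I: "0 \<in> I"
  shows "freely_generates_hypercyclic_algebra T I f"
proof -
  have hyp: "hypercyclic_vector entire_top T (\<lambda>z. cmpoly_eval P (\<lambda>j. f j z))"
    if "{..<n} \<subseteq> I" "P \<in> polys0 n" "P \<noteq> 0" for n P
    using steered_polynomial_hypercyclic[OF D f, of "\<lambda>j. j" n P] that by auto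
  have ind: "alg_independent I f"
    unfolding alg_independent_def
  proof (intro allI ballI impI)
    fix n P assume P: "P \<in> polys0 n" "{..<n} \<subseteq> I \<and> P \<noteq> 0"
    then have "hypercyclic_vector entire_top T (\<lambda>z. cmpoly_eval P (\<lambda>j. f j z))" by (intro hyp) auto
    then show "(\<lambda>z. cmpoly_eval P (\<lambda>j. f j z)) \<noteq> (\<lambda>z. 0)" using zero_not_hypercyclic by auto
  qed
  have sub: "subalgebra (generated_algebra I f)"
    using f(1) by (intro subalgebra_generated_algebra) (auto simp: PiE_iff topspace_entire_top)
  have all: "hypercyclic_vector entire_top T g" if g: "g \<in> generated_algebra I f" "g \<noteq> (\<lambda>z. 0)" for g
  proof -
    obtain n P where P: "{..<n} \<subseteq> I" "P \<in> polys0 n" "g = (\<lambda>z. cmpoly_eval P (\<lambda>j. f j z))"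
      using g(1) by (rule generated_algebraE)
    moreover have "P \<noteq> 0" using g(2) P(3) by auto
    ultimately show ?thesis using hyp by simp
  qed
  have "f 0 \<in> generated_algebra I f" using I by (intro generated_algebra_generator) auto
  moreover have "f 0 \<noteq> (\<lambda>z. 0)"
  proof -
    have "lookup (single (single 0 1) 1 :: cmpoly) (single 0 1) \<noteq> 0"
      by (simp only: lookup_single_eq) simp
    then have "(single (single 0 1) 1 :: cmpoly) \<noteq> 0" by (rule contrapos_nn) (simp only: lookup_zero)
    moreover have "single (single 0 1) 1 \<in> polys0 1" by (rule polys0_var) simp
    ultimately have "hypercyclic_vector entire_top T (\<lambda>z. cmpoly_eval (single (single 0 1) 1) (\<lambda>j. f j z))"
      using I by (intro hyp[of 1]) auto
    then show ?thesis using zero_not_hypercyclic by (auto simp: cmpoly_eval_var)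
  qed
  ultimately have "generated_algebra I f \<noteq> {\<lambda>z. 0}" by auto
  then show ?thesis
    unfolding freely_generates_hypercyclic_algebra_def hypercyclic_algebra_def using ind sub all by blast
qed

lemma steered_alg_independent_range:
  assumes D: "\<And>d. d \<in> D \<Longrightarrow> d holomorphic_on UNIV"
      "\<And>v k. v holomorphic_on UNIV \<Longrightarrow> near v k \<inter> D \<noteq> {}"
    and f: "f \<in> topspace (entire_power_top UNIV)" "steered D UNIV f"
  shows "infinite (range f)" "alg_independent_set (range f)"
proof -
  have nz: "(\<lambda>z. cmpoly_eval P (\<lambda>j. f (\<pi> j) z)) \<noteq> (\<lambda>z. 0)"
    if "inj_on \<pi> {..<n}" "P \<in> polys0 n" "P \<noteq> 0" for \<pi> n P
    using steered_polynomial_hypercyclic[OF D f that(1) _ that(2,3)] zero_not_hypercyclic by auto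
  have "inj f"
  proof (rule injI, rule ccontr)
    fix i j assume eq: "f i = f j" and ne: "i \<noteq> j"
    let ?P = "single (single (0::nat) (1::nat)) (1::complex) + single (single 1 1) (- 1)"
    have s01: "single (0::nat) (1::nat) \<noteq> single 1 1"
      by (metis lookup_single_eq lookup_single_not_eq zero_neq_one)
    have "lookup ?P (single 0 1) = 1"
      using s01 by (simp add: lookup_add lookup_single_not_eq)
    then have "?P \<noteq> 0" by (metis lookup_zero zero_neq_one)
    moreover have "?P \<in> polys0 2" by (intro polys0_add polys0_var) auto
    moreover have "inj_on (\<lambda>n::nat. if n = 0 then i else j) {..<2}" using ne by (auto simp: inj_on_def)
    ultimately have "(\<lambda>z. cmpoly_eval ?P (\<lambda>n. f (if n = 0 then i else j) z)) \<noteq> (\<lambda>z. 0)" by (intro nz)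
    then show False using eq by (simp add: cmpoly_eval_add cmpoly_eval_var)
  qed
  then show "infinite (range f)" by (rule range_inj_infinite)
  show "alg_independent_set (range f)"
    unfolding alg_independent_set_def alg_independent_def
  proof (intro allI impI ballI)
    fix n h n' P
    assume h: "inj_on h {..<n} \<and> h ` {..<n} \<subseteq> range f" and P: "P \<in> polys0 n'" "{..<n'} \<subseteq> {..<n} \<and> P \<noteq> 0"
    define \<pi> where "\<pi> = (\<lambda>j. inv f (h j))"
    have f\<pi>: "f (\<pi> j) = h j" if "j < n'" for j
      unfolding \<pi>_def using h P(2) that by (intro f_inv_into_f) auto
    have "inj_on \<pi> {..<n'}"
    proof (rule inj_onI)
      fix a b assume ab: "a \<in> {..<n'}" "b \<in> {..<n'}" "\<pi> a = \<pi> b"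
      then have "h a = h b" using f\<pi>[of a] f\<pi>[of b] by simp
      then show "a = b" using h ab P(2) by (meson inj_onD subsetD)
    qed
    then have "(\<lambda>z. cmpoly_eval P (\<lambda>j. f (\<pi> j) z)) \<noteq> (\<lambda>z. 0)" using P by (intro nz) auto
    moreover have "cmpoly_eval P (\<lambda>j. f (\<pi> j) z) = cmpoly_eval P (\<lambda>j. h j z)" for z
      by (rule cmpoly_eval_cong[OF P(1)]) (simp add: f\<pi>)
    ultimately show "(\<lambda>z. cmpoly_eval P (\<lambda>j. h j z)) \<noteq> (\<lambda>z. 0)" by simp
  qed
qed

end

section \<open>Residual sets of generators\<close>

lemma dense_superset:
  assumes "dense_in_top X S" "S \<subseteq> S'" "S' \<subseteq> topspace X"
  shows "dense_in_top X S'"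
  using assms closure_of_mono[OF assms(2), of X] closure_of_subset_topspace[of X S']
  unfolding dense_in_top_def by auto

lemma dense_range_if_near:
  assumes D: "\<And>d. d \<in> D \<Longrightarrow> d holomorphic_on UNIV" "\<And>v k. v holomorphic_on UNIV \<Longrightarrow> near v k \<inter> D \<noteq> {}"
    and f: "\<And>j. f j holomorphic_on UNIV" "\<And>d k. d \<in> D \<Longrightarrow> \<exists>j::nat. f j \<in> near d k"
  shows "dense_in_top entire_top (range f)"
proof (rule dense_in_topI)
  show "range f \<subseteq> topspace entire_top" using f(1) by (auto simp: topspace_entire_top)
  fix W v assume "openin entire_top W" "v \<in> W"
  then obtain k where k: "near v k \<subseteq> W" and v: "v holomorphic_on UNIV"
    unfolding openin_entire_top_iff by blast
  obtain d where d: "d \<in> D" "d \<in> near v k" using D(2)[OF v] by blast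
  obtain l where l: "near d l \<subseteq> near v k" using near_absorbs[OF d(2) v] by blast
  obtain j where "f j \<in> near d l" using f(2)[OF d(1)] by blast
  then show "range f \<inter> W \<noteq> {}" using k l by blast
qed

theorem theorem1p1:
  fixes \<Phi> :: "complex \<Rightarrow> complex" and \<Gamma> :: "complex set"
  assumes "\<Phi> holomorphic_on UNIV"
    and "finite_exponential_type \<Phi>"
    and "norm (\<Phi> 0) < 1"
    and "nontrivial_compact_arc \<Gamma>"
    and "strictly_convex_arc \<Gamma>"
    and "\<Gamma> \<subseteq> {z. norm (\<Phi> z) = 1}"
    and "convex hull (\<Gamma> \<union> {0}) - \<Gamma> \<subseteq> \<Phi> -` ball 0 1"
  shows "dense_algebrable {f. hypercyclic_vector entire_top (convolution_operator \<Phi>) f} \<and>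
    (\<forall>N\<ge>1. residual_in_top (entire_power_top {..<N})
       {f \<in> topspace (entire_power_top {..<N}).
          freely_generates_hypercyclic_algebra (convolution_operator \<Phi>) {..<N} f}) \<and>
    residual_in_top (entire_power_top UNIV)
       {f \<in> topspace (entire_power_top UNIV).
          freely_generates_dense_hypercyclic_algebra (convolution_operator \<Phi>) UNIV f} \<and>
    densely_strongly_algebrable {f. hypercyclic_vector entire_top (convolution_operator \<Phi>) f}"
proof -
  define T where "T = convolution_operator \<Phi>"
  interpret exp_diagonal_operator T \<Phi>
    unfolding T_def by (rule exp_diagonal_convolution_operator[OF assms(1,2)])
  interpret arc_operator \<Phi> \<Gamma> T
    by unfold_locales (use assms in auto)
  obtain D :: "(complex \<Rightarrow> complex) set" where D: "countable D" "\<And>d. d \<in> D \<Longrightarrow> d holomorphic_on UNIV"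
    "\<And>f k. f holomorphic_on UNIV \<Longrightarrow> near f k \<inter> D \<noteq> {}"
    by (rule entire_separable) (rule that)
  have steer: "\<exists>\<G>. countable \<G> \<and> (\<forall>G\<in>\<G>. openin (entire_power_top I) G \<and> dense_in_top (entire_power_top I) G) \<and>
    (\<forall>f\<in>\<Inter>\<G>. steered D I f)" for I
    by (rule residual_steering) (use D(1,2) in auto)

  have a: "residual_in_top (entire_power_top {..<N})
       {f \<in> topspace (entire_power_top {..<N}). freely_generates_hypercyclic_algebra T {..<N} f}"
    if N: "N \<ge> 1" for N
  proof -
    obtain \<G> where G: "countable \<G>"
      "\<forall>G\<in>\<G>. openin (entire_power_top {..<N}) G \<and> dense_in_top (entire_power_top {..<N}) G"
      "\<forall>f\<in>\<Inter>\<G>. steered D {..<N} f"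
      using steer[of "{..<N}"] by (elim exE conjE) (rule that)
    have "freely_generates_hypercyclic_algebra T {..<N} f"
      if "f \<in> topspace (entire_power_top {..<N}) \<inter> \<Inter>\<G>" for f
      using that G(3) N by (intro steered_freely_generates[OF D(2,3)]) auto
    then have "topspace (entire_power_top {..<N}) \<inter> \<Inter>\<G> \<subseteq>
      {f \<in> topspace (entire_power_top {..<N}). freely_generates_hypercyclic_algebra T {..<N} f}" by blast
    then show ?thesis
      unfolding residual_in_top_def using G(1,2) by (intro conjI exI[of _ \<G>] Collect_restrict)
  qed

  let ?X = "entire_power_top UNIV"
  obtain \<G> where G: "countable \<G>"
    "\<forall>G\<in>\<G>. openin ?X G \<and> dense_in_top ?X G"
    "\<forall>f\<in>\<Inter>\<G>. steered D UNIV f"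
    using steer[of UNIV] by (elim exE conjE) (rule that)
  define \<H> where "\<H> = (\<lambda>(d, k). {f \<in> topspace ?X. \<exists>j. f j \<in> near d k}) ` (D \<times> (UNIV :: nat set))"
  \<comment> \<open>the sequences that are steered and have a dense set of terms\<close>
  define R where "R = topspace ?X \<inter> \<Inter>(\<G> \<union> \<H>)"
  have cnt: "countable (\<G> \<union> \<H>)"
    unfolding \<H>_def using G(1) D(1) by (intro countable_Un countable_image countable_SIGMA) auto
  have od: "\<forall>G\<in>\<G> \<union> \<H>. openin ?X G \<and> dense_in_top ?X G"
    using G(2) generic_sequence_dense[OF D(2)] by (auto simp: \<H>_def)
  have R_res: "residual_in_top ?X R"
    unfolding residual_in_top_def R_def using cnt od by (intro conjI exI[of _ "\<G> \<union> \<H>"] Int_lower1 order_refl)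
  have R_hol: "f j holomorphic_on UNIV" if "f \<in> R" for f j
    using that by (auto simp: R_def PiE_iff topspace_entire_top)
  have R_top: "f \<in> topspace ?X" if "f \<in> R" for f using that unfolding R_def by blast
  have R_steered: "steered D UNIV f" if "f \<in> R" for f
    using that G(3) unfolding R_def by blast
  have R_free: "freely_generates_hypercyclic_algebra T UNIV f" if "f \<in> R" for f
    by (rule steered_freely_generates[OF D(2,3) R_top[OF that] R_steered[OF that]]) auto
  have R_dense: "dense_in_top entire_top (range f)" if "f \<in> R" for f
  proof (rule dense_range_if_near[OF D(2,3)])
    show "\<exists>j. f j \<in> near d k" if "d \<in> D" for d k
    proof -
      have "{f \<in> topspace ?X. \<exists>j. f j \<in> near d k} \<in> \<H>"
        unfolding \<H>_def using that by (intro rev_image_eqI[of "(d, k)"]) auto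
      then show ?thesis using \<open>f \<in> R\<close> unfolding R_def by blast
    qed
  qed (use R_hol that in auto)
  have R_sub: "subalgebra (generated_algebra UNIV f)" if "f \<in> R" for f
    by (rule subalgebra_generated_algebra) (rule R_hol[OF that])
  have R_range: "range f \<subseteq> generated_algebra UNIV f" for f
    using generated_algebra_generator[of _ UNIV f] by blast
  have R_gen_dense: "dense_in_top entire_top (generated_algebra UNIV f)" if "f \<in> R" for f
    using R_sub[OF that] unfolding subalgebra_def
    by (intro dense_superset[OF R_dense[OF that] R_range]) (simp add: topspace_entire_top)
  have "R \<subseteq> {f \<in> topspace ?X. freely_generates_dense_hypercyclic_algebra T UNIV f}"
    using R_top R_free R_gen_dense unfolding freely_generates_dense_hypercyclic_algebra_def by blast
  then have b: "residual_in_top ?X {f \<in> topspace ?X. freely_generates_dense_hypercyclic_algebra T UNIV f}"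
    unfolding residual_in_top_def using cnt od
    by (intro conjI exI[of _ "\<G> \<union> \<H>"] Collect_restrict) (auto simp: R_def)

  obtain f where f: "f \<in> R" using residual_power_nonempty[OF R_res] by blast
  have hyp: "generated_algebra UNIV f \<subseteq> {f. hypercyclic_vector entire_top T f} \<union> {\<lambda>z. 0}"
    and ind: "alg_independent UNIV f"
    using R_free[OF f] unfolding freely_generates_hypercyclic_algebra_def hypercyclic_algebra_def by auto
  have c: "dense_algebrable {f. hypercyclic_vector entire_top T f}"
    unfolding dense_algebrable_def
    using R_sub[OF f] hyp R_gen_dense[OF f] not_finitely_generated[OF R_hol[OF f] ind]
    by (intro exI[of _ "generated_algebra UNIV f"] conjI)
  have hull_sub: "subalgebra hull (range f) \<subseteq> generated_algebra UNIV f"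
    using R_range[of f] R_sub[OF f] by (rule hull_minimal)
  have d: "densely_strongly_algebrable {f. hypercyclic_vector entire_top T f}"
    unfolding densely_strongly_algebrable_def
  proof (intro exI[of _ "range f"] conjI)
    show "range f \<subseteq> {f. f holomorphic_on UNIV}" using R_hol[OF f] by auto
    show "infinite (range f)" "alg_independent_set (range f)"
      using steered_alg_independent_range[OF D(2,3) R_top[OF f] R_steered[OF f]] by auto
    show "subalgebra hull range f \<subseteq> {f. hypercyclic_vector entire_top T f} \<union> {\<lambda>z. 0}"
      using hull_sub hyp by blast
    show "dense_in_top entire_top (subalgebra hull range f)"
    proof (rule dense_superset[OF R_dense[OF f] hull_subset])
      show "subalgebra hull range f \<subseteq> topspace entire_top"
        using hull_sub R_sub[OF f] unfolding subalgebra_def topspace_entire_top by blast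
    qed
  qed
  show ?thesis using a b c d unfolding T_def by blast
qed

end
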